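(* Let $\{p_j\}_{j\ge0}$ be complex numbers and $p(z):=1+\sum_{j\ge0}p_jz^{-j-1}\in\mathbb C[[z^{-1}]]$. The irreducible highest weight $\ddot Y_{h_1,h_2,h_3}(\mathfrak{gl}_1)$-module $V_p$ is in the category $\mathcal O$ if and only if there exists a rational function $P(z)$ such that $p(z)=P(z)^+$ and $P(\infty)=1$.
   Context: Let $h_1,h_2,h_3\in\mathbb C$ with $h_1+h_2+h_3=0$, $\sigma_2=h_1h_2+h_1h_3+h_2h_3$, $\sigma_3=h_1h_2h_3$, $\{a,b\}=ab+ba$, $\mathbb Z_+=\{0,1,2,\dots\}$. $\ddot Y_{h_1,h_2,h_3}(\mathfrak{gl}_1)$ is the unital associative $\mathbb C$-algebra generated by $e_j,f_j,\psi_j$ ($j\in\mathbb Z_+$) with relations ($\mathrm{Sym}_{\mathfrak S_3}$ = sum over permutations of $i_1,i_2,i_3$): - $[\psi_i,\psi_j]=0$, $[e_i,f_j]=\psi_{i+j}$; - $[e_{i+3},e_j]-3[e_{i+2},e_{j+1}]+3[e_{i+1},e_{j+2}]-[e_i,e_{j+3}]+\sigma_2([e_{i+1},e_j]-[e_i,e_{j+1}])=\sigma_3\{e_i,e_j\}$; - $[f_{i+3},f_j]-3[f_{i+2},f_{j+1}]+3[f_{i+1},f_{j+2}]-[f_i,f_{j+3}]+\sigma_2([f_{i+1},f_j]-[f_i,f_{j+1}])=-\sigma_3\{f_i,f_j\}$; - $[\psi_{i+3},e_j]-3[\psi_{i+2},e_{j+1}]+3[\psi_{i+1},e_{j+2}]-[\psi_i,e_{j+3}]+\sigma_2([\psi_{i+1},e_j]-[\psi_i,e_{j+1}])=\sigma_3\{\psi_i,e_j\}$;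 - $[\psi_{i+3},f_j]-3[\psi_{i+2},f_{j+1}]+3[\psi_{i+1},f_{j+2}]-[\psi_i,f_{j+3}]+\sigma_2([\psi_{i+1},f_j]-[\psi_i,f_{j+1}])=-\sigma_3\{\psi_i,f_j\}$; - $[\psi_0,e_j]=[\psi_1,e_j]=0$, $[\psi_2,e_j]=2e_j$; $[\psi_0,f_j]=[\psi_1,f_j]=0$, $[\psi_2,f_j]=-2f_j$; - $\mathrm{Sym}_{\mathfrak S_3}[e_{i_1},[e_{i_2},e_{i_3+1}]]=0$, $\mathrm{Sym}_{\mathfrak S_3}[f_{i_1},[f_{i_2},f_{i_3+1}]]=0$. It is $\mathbb Z$-graded by $\deg e_j=-1$, $\deg f_j=1$, $\deg\psi_j=0$. A $\mathbb Z$-graded module $L$ is in the category $\mathcal O$ if (i) for any $v\in L$ there is $N\in\mathbb Z$ such that $\ddot Y_{h_1,h_2,h_3}(\mathfrak{gl}_1)_{\ge N}(v)=0$, and (ii) all graded components $L_k$ are finite dimensional. $M_p$ is the quotient of $\ddot Y_{h_1,h_2,h_3}(\mathfrak{gl}_1)$ by the left ideal generated by $\{f_j,\psi_j-p_j\}_{j\in\mathbb Z_+}$ (highest weight vector in degree $0$), and $V_p$ is its unique irreducible quotient. $P(z)^+$ denotes the expansion of a rational function in $z^{-1}$. *)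

theory Defs
  imports
    "HOL-Algebra.QuotRing"
    "HOL-Algebra.Module"
    "HOL-Algebra.Algebraic_Closure_Type"
    "HOL-Library.Poly_Mapping"
    "HOL-Computational_Algebra.Field_as_Ring"
    "HOL-Computational_Algebra.Polynomial_Factorial"
    "HOL-Computational_Algebra.Formal_Laurent_Series"
    Complex_Main
begin

section \<open>The free associative algebra\<close>

datatype 'a free_monoid = Word (letters: "'a list")

instantiation free_monoid :: (type) monoid_add
begin

definition zero_free_monoid :: "'a free_monoid" where
  "zero_free_monoid = Word []"

definition plus_free_monoid :: "'a free_monoid \<Rightarrow> 'a free_monoid \<Rightarrow> 'a free_monoid" where
  "plus_free_monoid u v = Word (letters u @ letters v)"

instance
  by standard (simp_all add: zero_free_monoid_def plus_free_monoid_def)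

end

text \<open>Poly_Mapping writes exponents additively, so its convolution product on
  \<open>'a free_monoid \<Rightarrow>\<^sub>0 complex\<close> is the product of the noncommutative monoid algebra,
  i.e. of the free unital associative \<open>\<complex>\<close>-algebra on the alphabet \<open>'a\<close>.\<close>

type_synonym 'a free_alg = "'a free_monoid \<Rightarrow>\<^sub>0 complex"

definition free_gen :: "'a \<Rightarrow> 'a free_alg" where
  "free_gen a = Poly_Mapping.single (Word [a]) 1"

definition free_scalar :: "complex \<Rightarrow> 'a free_alg" where
  "free_scalar c = Poly_Mapping.single 0 c"


section \<open>The affine Yangian of gl(1)\<close>

datatype yangian_gen = E nat | F nat | Psi nat

abbreviation e_gen :: "nat \<Rightarrow> yangian_gen free_alg" where "e_gen j \<equiv> free_gen (E j)"
abbreviation f_gen :: "nat \<Rightarrow> yangian_gen free_alg" where "f_gen j \<equiv> free_gen (F j)"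
abbreviation psi_gen :: "nat \<Rightarrow> yangian_gen free_alg" where "psi_gen j \<equiv> free_gen (Psi j)"

definition commutator :: "'a::ring_1 \<Rightarrow> 'a \<Rightarrow> 'a" where
  "commutator a b = a * b - b * a"

definition anticommutator :: "'a::ring_1 \<Rightarrow> 'a \<Rightarrow> 'a" where
  "anticommutator a b = a * b + b * a"

definition sigma2 :: "complex \<Rightarrow> complex \<Rightarrow> complex \<Rightarrow> complex" where
  "sigma2 h1 h2 h3 = h1 * h2 + h1 * h3 + h2 * h3"

definition sigma3 :: "complex \<Rightarrow> complex \<Rightarrow> complex \<Rightarrow> complex" where
  "sigma3 h1 h2 h3 = h1 * h2 * h3"

text \<open>\<open>cubic s2 x y i j\<close> is the left-hand side common to the four cubic families of relations,
  for two sequences \<open>x\<close>, \<open>y\<close> of generators.\<close>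

definition cubic ::
  "complex \<Rightarrow> (nat \<Rightarrow> 'a free_alg) \<Rightarrow> (nat \<Rightarrow> 'a free_alg) \<Rightarrow> nat \<Rightarrow> nat \<Rightarrow> 'a free_alg" where
  "cubic s2 x y i j =
     commutator (x (i + 3)) (y j) - 3 * commutator (x (i + 2)) (y (j + 1))
     + 3 * commutator (x (i + 1)) (y (j + 2)) - commutator (x i) (y (j + 3))
     + free_scalar s2 * (commutator (x (i + 1)) (y j) - commutator (x i) (y (j + 1)))"

definition sym3 :: "(nat \<Rightarrow> nat \<Rightarrow> nat \<Rightarrow> 'a::ab_group_add) \<Rightarrow> nat \<Rightarrow> nat \<Rightarrow> nat \<Rightarrow> 'a" where
  "sym3 T i j k = T i j k + T i k j + T j i k + T j k i + T k i j + T k j i"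

definition serre :: "(nat \<Rightarrow> 'a::ring_1) \<Rightarrow> nat \<Rightarrow> nat \<Rightarrow> nat \<Rightarrow> 'a" where
  "serre x = sym3 (\<lambda>i j k. commutator (x i) (commutator (x j) (x (k + 1))))"

text \<open>A relation \<open>l = r\<close> is recorded as the element \<open>l - r\<close>.\<close>

inductive_set yangian_rels ::
  "complex \<Rightarrow> complex \<Rightarrow> complex \<Rightarrow> yangian_gen free_alg set"
  for h1 h2 h3 :: complex
where
  psi_psi: "commutator (psi_gen i) (psi_gen j) \<in> yangian_rels h1 h2 h3"
| e_f: "commutator (e_gen i) (f_gen j) - psi_gen (i + j) \<in> yangian_rels h1 h2 h3"
| e_e: "cubic (sigma2 h1 h2 h3) e_gen e_gen i j
          - free_scalar (sigma3 h1 h2 h3) * anticommutator (e_gen i) (e_gen j)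
        \<in> yangian_rels h1 h2 h3"
| f_f: "cubic (sigma2 h1 h2 h3) f_gen f_gen i j
          - (- (free_scalar (sigma3 h1 h2 h3) * anticommutator (f_gen i) (f_gen j)))
        \<in> yangian_rels h1 h2 h3"
| psi_e: "cubic (sigma2 h1 h2 h3) psi_gen e_gen i j
          - free_scalar (sigma3 h1 h2 h3) * anticommutator (psi_gen i) (e_gen j)
        \<in> yangian_rels h1 h2 h3"
| psi_f: "cubic (sigma2 h1 h2 h3) psi_gen f_gen i j
          - (- (free_scalar (sigma3 h1 h2 h3) * anticommutator (psi_gen i) (f_gen j)))
        \<in> yangian_rels h1 h2 h3"
| psi0_e: "commutator (psi_gen 0) (e_gen j) \<in> yangian_rels h1 h2 h3"
| psi1_e: "commutator (psi_gen 1) (e_gen j) \<in> yangian_rels h1 h2 h3"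
| psi2_e: "commutator (psi_gen 2) (e_gen j) - 2 * e_gen j \<in> yangian_rels h1 h2 h3"
| psi0_f: "commutator (psi_gen 0) (f_gen j) \<in> yangian_rels h1 h2 h3"
| psi1_f: "commutator (psi_gen 1) (f_gen j) \<in> yangian_rels h1 h2 h3"
| psi2_f: "commutator (psi_gen 2) (f_gen j) - (- (2 * f_gen j)) \<in> yangian_rels h1 h2 h3"
| serre_e: "serre e_gen i j k \<in> yangian_rels h1 h2 h3"
| serre_f: "serre f_gen i j k \<in> yangian_rels h1 h2 h3"

definition yangian_ideal ::
  "complex \<Rightarrow> complex \<Rightarrow> complex \<Rightarrow> yangian_gen free_alg set" where
  "yangian_ideal h1 h2 h3 = Idl\<^bsub>ring_of_type_algebra\<^esub> (yangian_rels h1 h2 h3)"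

definition yangian ::
  "complex \<Rightarrow> complex \<Rightarrow> complex \<Rightarrow> yangian_gen free_alg set ring" where
  "yangian h1 h2 h3 = ring_of_type_algebra Quot (yangian_ideal h1 h2 h3)"

definition yangian_class ::
  "complex \<Rightarrow> complex \<Rightarrow> complex \<Rightarrow> yangian_gen free_alg \<Rightarrow> yangian_gen free_alg set" where
  "yangian_class h1 h2 h3 x = yangian_ideal h1 h2 h3 +>\<^bsub>ring_of_type_algebra\<^esub> x"

fun gen_deg :: "yangian_gen \<Rightarrow> int" where
  "gen_deg (E j) = -1"
| "gen_deg (F j) = 1"
| "gen_deg (Psi j) = 0"

definition word_deg :: "yangian_gen free_monoid \<Rightarrow> int" where
  "word_deg w = sum_list (map gen_deg (letters w))"

definition yangian_grading ::
  "complex \<Rightarrow> complex \<Rightarrow> complex \<Rightarrow> int \<Rightarrow> yangian_gen free_alg set set" where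
  "yangian_grading h1 h2 h3 k =
     yangian_class h1 h2 h3 ` {x. \<forall>w \<in> Poly_Mapping.keys x. word_deg w = k}"


section \<open>Left modules\<close>

text \<open>The locale \<open>module\<close> of HOL-Algebra requires a commutative base ring.  Only its record type is
  used here; the fields \<open>mult\<close> and \<open>one\<close> play no role.\<close>

locale left_module = R?: ring R + M?: abelian_group M
  for R :: "('a, 'r) ring_scheme" (structure) and M :: "('a, 'b, 'm) module_scheme" (structure) +
  assumes smult_closed:
      "\<lbrakk>a \<in> carrier R; x \<in> carrier M\<rbrakk> \<Longrightarrow> a \<odot>\<^bsub>M\<^esub> x \<in> carrier M"
    and smult_l_distr:
      "\<lbrakk>a \<in> carrier R; b \<in> carrier R; x \<in> carrier M\<rbrakk> \<Longrightarrow>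
      (a \<oplus> b) \<odot>\<^bsub>M\<^esub> x = a \<odot>\<^bsub>M\<^esub> x \<oplus>\<^bsub>M\<^esub> b \<odot>\<^bsub>M\<^esub> x"
    and smult_r_distr:
      "\<lbrakk>a \<in> carrier R; x \<in> carrier M; y \<in> carrier M\<rbrakk> \<Longrightarrow>
      a \<odot>\<^bsub>M\<^esub> (x \<oplus>\<^bsub>M\<^esub> y) = a \<odot>\<^bsub>M\<^esub> x \<oplus>\<^bsub>M\<^esub> a \<odot>\<^bsub>M\<^esub> y"
    and smult_assoc1:
      "\<lbrakk>a \<in> carrier R; b \<in> carrier R; x \<in> carrier M\<rbrakk> \<Longrightarrow>
      (a \<otimes> b) \<odot>\<^bsub>M\<^esub> x = a \<odot>\<^bsub>M\<^esub> (b \<odot>\<^bsub>M\<^esub> x)"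
    and smult_one:
      "x \<in> carrier M \<Longrightarrow> \<one> \<odot>\<^bsub>M\<^esub> x = x"

definition irreducible_module :: "('a, 'r) ring_scheme \<Rightarrow> ('a, 'b, 'm) module_scheme \<Rightarrow> bool" where
  "irreducible_module R M \<longleftrightarrow> left_module R M \<and> carrier M \<noteq> {\<zero>\<^bsub>M\<^esub>} \<and>
     (\<forall>N. submodule N R M \<longrightarrow> N = {\<zero>\<^bsub>M\<^esub>} \<or> N = carrier M)"

definition regular_module :: "('a, 'r) ring_scheme \<Rightarrow> ('a, 'a) module" where
  "regular_module R = \<lparr>carrier = carrier R, monoid.mult = monoid.mult R, one = one R,
     zero = zero R, add = add R, module.smult = monoid.mult R\<rparr>"

definition left_ideal_gen :: "('a, 'r) ring_scheme \<Rightarrow> 'a set \<Rightarrow> 'a set" where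
  "left_ideal_gen R S = \<Inter>{J. submodule J R (regular_module R) \<and> S \<subseteq> J}"

definition quot_module ::
  "('a, 'b, 'm) module_scheme \<Rightarrow> 'b set \<Rightarrow> ('a, 'b set) module" where
  "quot_module M N = \<lparr>carrier = a_rcosets\<^bsub>M\<^esub> N, monoid.mult = undefined, one = undefined,
     zero = N, add = set_add M,
     module.smult = (\<lambda>a C. \<Union>x\<in>C. N +>\<^bsub>M\<^esub> (a \<odot>\<^bsub>M\<^esub> x))\<rparr>"

definition quot_grading ::
  "('a, 'b, 'm) module_scheme \<Rightarrow> 'b set \<Rightarrow> (int \<Rightarrow> 'b set) \<Rightarrow> int \<Rightarrow> 'b set set" where
  "quot_grading M N gr k = (\<lambda>x. N +>\<^bsub>M\<^esub> x) ` gr k"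


section \<open>Graded modules and the category O\<close>

definition graded_yangian_module ::
  "complex \<Rightarrow> complex \<Rightarrow> complex \<Rightarrow> (yangian_gen free_alg set, 'b, 'm) module_scheme \<Rightarrow>
   (int \<Rightarrow> 'b set) \<Rightarrow> bool" where
  "graded_yangian_module h1 h2 h3 L gr \<longleftrightarrow>
     left_module (yangian h1 h2 h3) L \<and>
     (\<forall>k. additive_subgroup (gr k) L) \<and>
     (\<forall>v \<in> carrier L. \<exists>!g. (\<forall>k. g k \<in> gr k) \<and> finite {k. g k \<noteq> \<zero>\<^bsub>L\<^esub>} \<and>
        v = finsum L g {k. g k \<noteq> \<zero>\<^bsub>L\<^esub>}) \<and>
     (\<forall>i k. \<forall>y \<in> yangian_grading h1 h2 h3 i. \<forall>v \<in> gr k. y \<odot>\<^bsub>L\<^esub> v \<in> gr (i + k))"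

definition yangian_fin_dim ::
  "complex \<Rightarrow> complex \<Rightarrow> complex \<Rightarrow> (yangian_gen free_alg set, 'b, 'm) module_scheme \<Rightarrow>
   'b set \<Rightarrow> bool" where
  "yangian_fin_dim h1 h2 h3 L U \<longleftrightarrow>
     (\<exists>B. finite B \<and> B \<subseteq> U \<and>
        (\<forall>v \<in> U. \<exists>c. v =
          (\<Oplus>\<^bsub>L\<^esub>b\<in>B. yangian_class h1 h2 h3 (free_scalar (c b)) \<odot>\<^bsub>L\<^esub> b)))"

definition category_O ::
  "complex \<Rightarrow> complex \<Rightarrow> complex \<Rightarrow> (yangian_gen free_alg set, 'b, 'm) module_scheme \<Rightarrow>
   (int \<Rightarrow> 'b set) \<Rightarrow> bool" where
  "category_O h1 h2 h3 L gr \<longleftrightarrow>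
     graded_yangian_module h1 h2 h3 L gr \<and>
     (\<forall>v \<in> carrier L. \<exists>N. \<forall>k \<ge> N. \<forall>y \<in> yangian_grading h1 h2 h3 k. y \<odot>\<^bsub>L\<^esub> v = \<zero>\<^bsub>L\<^esub>) \<and>
     (\<forall>k. yangian_fin_dim h1 h2 h3 L (gr k))"


section \<open>Highest weight modules\<close>

definition verma_left_ideal ::
  "complex \<Rightarrow> complex \<Rightarrow> complex \<Rightarrow> (nat \<Rightarrow> complex) \<Rightarrow> yangian_gen free_alg set set" where
  "verma_left_ideal h1 h2 h3 p = left_ideal_gen (yangian h1 h2 h3)
     (yangian_class h1 h2 h3 ` (range f_gen \<union> range (\<lambda>j. psi_gen j - free_scalar (p j))))"

definition verma ::
  "complex \<Rightarrow> complex \<Rightarrow> complex \<Rightarrow> (nat \<Rightarrow> complex) \<Rightarrow>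
   (yangian_gen free_alg set, yangian_gen free_alg set set) module" where
  "verma h1 h2 h3 p =
     quot_module (regular_module (yangian h1 h2 h3)) (verma_left_ideal h1 h2 h3 p)"

definition verma_grading ::
  "complex \<Rightarrow> complex \<Rightarrow> complex \<Rightarrow> (nat \<Rightarrow> complex) \<Rightarrow> int \<Rightarrow>
   yangian_gen free_alg set set set" where
  "verma_grading h1 h2 h3 p =
     quot_grading (regular_module (yangian h1 h2 h3)) (verma_left_ideal h1 h2 h3 p)
       (yangian_grading h1 h2 h3)"

text \<open>The kernel of the projection of the Verma module onto its unique irreducible quotient.
  No homogeneity is required: the commutation relations with \<open>psi 2\<close> make \<open>psi 2\<close> act on
  the degree \<open>k\<close> part of the Verma module as \<open>p 2 - 2 * k\<close>, so every submodule is graded.\<close>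

definition verma_radical ::
  "complex \<Rightarrow> complex \<Rightarrow> complex \<Rightarrow> (nat \<Rightarrow> complex) \<Rightarrow>
   yangian_gen free_alg set set set" where
  "verma_radical h1 h2 h3 p =
     (THE N. submodule N (yangian h1 h2 h3) (verma h1 h2 h3 p) \<and>
        irreducible_module (yangian h1 h2 h3) (quot_module (verma h1 h2 h3 p) N))"

definition irred_hw_module ::
  "complex \<Rightarrow> complex \<Rightarrow> complex \<Rightarrow> (nat \<Rightarrow> complex) \<Rightarrow>
   (yangian_gen free_alg set, yangian_gen free_alg set set set) module" where
  "irred_hw_module h1 h2 h3 p = quot_module (verma h1 h2 h3 p) (verma_radical h1 h2 h3 p)"

definition irred_hw_grading ::
  "complex \<Rightarrow> complex \<Rightarrow> complex \<Rightarrow> (nat \<Rightarrow> complex) \<Rightarrow> int \<Rightarrow>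
   yangian_gen free_alg set set set set" where
  "irred_hw_grading h1 h2 h3 p =
     quot_grading (verma h1 h2 h3 p) (verma_radical h1 h2 h3 p) (verma_grading h1 h2 h3 p)"


section \<open>Rational functions and their expansions at infinity\<close>

text \<open>Elements of \<open>\<complex>((z\<^sup>-\<^sup>1))\<close> are represented as Laurent series in the variable
  \<open>fls_X = 1/z\<close>; hence \<open>z\<close> itself is \<open>fls_X_inv\<close>.\<close>

definition poly_at_infinity :: "complex poly \<Rightarrow> complex fls" where
  "poly_at_infinity a = poly (map_poly fls_const a) fls_X_inv"

text \<open>\<open>quot_of_fract\<close> returns numerator and denominator in lowest terms, with monic
  denominator.\<close>

definition ratfun_expansion :: "complex poly fract \<Rightarrow> complex fls" where
  "ratfun_expansion P =
     poly_at_infinity (fst (quot_of_fract P)) / poly_at_infinity (snd (quot_of_fract P))"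

definition ratfun_eval :: "complex poly fract \<Rightarrow> complex \<Rightarrow> complex" where
  "ratfun_eval P z = poly (fst (quot_of_fract P)) z / poly (snd (quot_of_fract P)) z"

text \<open>\<open>P(\<infinity>) = c\<close>, with \<open>c\<close> finite.\<close>

definition ratfun_at_infinity :: "complex poly fract \<Rightarrow> complex \<Rightarrow> bool" where
  "ratfun_at_infinity P c \<longleftrightarrow> (ratfun_eval P \<longlongrightarrow> c) at_infinity"

text \<open>The series \<open>1 + \<Sum>j. p j * z\<^bsup>-j-1\<^esup>\<close>.\<close>

definition weight_series :: "(nat \<Rightarrow> complex) \<Rightarrow> complex fls" where
  "weight_series p = fps_to_fls (Abs_fps (\<lambda>n. case n of 0 \<Rightarrow> 1 | Suc j \<Rightarrow> p j))"

end

theory Submission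
  imports
    Defs
    "HOL-Library.Function_Algebras"
    "HOL-Library.Product_Plus"
    "HOL-Computational_Algebra.Fundamental_Theorem_Algebra"
begin

text \<open>
  Write \<open>v\<close> for the highest weight vector of \<open>V\<^sub>p\<close>. Both sides of the equivalence say that the
  weights satisfy a linear recurrence with constant coefficients: there are \<open>q\<^sub>0, \<dots>, q\<^sub>n\<close>, not all
  zero, with \<open>\<Sum>\<^sub>j q\<^sub>j p\<^sub>m\<^sub>+\<^sub>j = 0\<close> for every \<open>m\<close>. For rational functions this is the comparison of
  coefficients in \<open>rational_iff_recurrent\<close>: \<open>q(z) p(z)\<close> has no negative powers of \<open>z\<close>.

  If the degree \<open>-1\<close> part is finite dimensional, the vectors \<open>e\<^sub>j v\<close> are linearly dependent, and
  \<open>f\<^sub>m e\<^sub>j v = - p\<^sub>m\<^sub>+\<^sub>j v\<close> turns a dependence into a recurrence. Conversely, a recurrence for \<open>p\<close>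
  propagates down the grading. A vector of negative degree in \<open>V\<^sub>p\<close> is zero as soon as all \<open>f\<^sub>k\<close> kill
  it, and \<open>f\<^sub>k e\<^sub>j = e\<^sub>j f\<^sub>k - \<psi>\<^sub>j\<^sub>+\<^sub>k\<close>; so the product of a recurrence for the \<open>e\<^sub>j\<close> one degree
  higher and one for the \<open>\<psi>\<^sub>i\<close> is a recurrence for the \<open>e\<^sub>j\<close> (\<open>e_rec_step\<close>). The exchange
  relation between \<open>\<psi>\<close> and \<open>e\<close> says that, with \<open>S\<close> and \<open>T\<close> shifting the indices of \<open>\<psi>\<^sub>i\<close> and \<open>e\<^sub>j\<close>,
  a cubic polynomial in \<open>S - T\<close> applied to \<open>\<psi>\<^sub>i e\<^sub>j\<close> is another one applied to \<open>e\<^sub>j \<psi>\<^sub>i\<close>. Eliminating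
  \<open>T\<close> gives a recurrence for the \<open>\<psi>\<^sub>i\<close> one degree lower (\<open>psi_rec_step\<close>). With a recurrence for the
  \<open>e\<^sub>j\<close> in each degree, finitely many of them generate the next component from the last.

  All of this presupposes control of \<open>V\<^sub>p\<close>: that the Verma module is not zero, that it has exactly one
  maximal submodule, and that the quotient is the module just described. For this a concrete copy of
  \<open>V\<^sub>p\<close> is built inside the space of all functions on words in the natural numbers, a word
  \<open>k\<^sub>1 \<dots> k\<^sub>n\<close> standing for \<open>e\<^sub>k\<^sub>1 \<dots> e\<^sub>k\<^sub>n\<close>. Dualising the action on a free module on such words and
  exchanging the roles of \<open>e\<close> and \<open>f\<close>, the operator \<open>f\<^sub>k\<close> becomes \<open>(f\<^sub>k \<phi>)(w) = \<phi>(k w)\<close>, the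
  exchange relation with \<open>f\<close> becomes a recursion that defines \<open>\<psi>\<^sub>i\<close>, and
  \<open>f\<^sub>k e\<^sub>j = e\<^sub>j f\<^sub>k - \<psi>\<^sub>j\<^sub>+\<^sub>k\<close> becomes one that defines \<open>e\<^sub>j\<close>. Since a function is determined by its
  value at the empty word and by its images under all \<open>f\<^sub>k\<close>, identities between operators can be proved
  by commuting them past \<open>f\<^sub>k\<close>. This yields, in this order, that the \<open>\<psi>\<^sub>i\<close> commute (\<open>P_commute\<close>),
  the exchange relation with \<open>e\<close> (\<open>P_E\<close>), and the quadratic and Serre relations for \<open>e\<close> (\<open>E_quad\<close>,
  \<open>E_serre\<close>). The relations between the \<open>f\<^sub>k\<close> fail on arbitrary functions, but they commute with all
  \<open>e\<^sub>j\<close> and kill the indicator function \<open>vac\<close> of the empty word, hence they hold on the module that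
  \<open>vac\<close> generates (\<open>F_quad\<close>, \<open>F_serre\<close>).

  That module is irreducible: if \<open>w\<close> is a longest word at which \<open>\<phi>\<close> does not vanish, removing the
  letters of \<open>w\<close> by operators \<open>f\<^sub>k\<close> maps \<open>\<phi>\<close> to a nonzero multiple of \<open>vac\<close> (\<open>vac_generated\<close>). It is
  the only irreducible quotient of the Verma module, because modulo the Verma ideal every element is
  a combination of words in the \<open>e\<^sub>j\<close>, so degree \<open>0\<close> is a line, and \<open>\<psi>\<^sub>2\<close> has different eigenvalues
  in different degrees (\<open>left_ideal_dichotomy\<close>, \<open>radical_unique\<close>).
\<close>

section \<open>Linear operators on functions on words\<close>

text \<open>Types of their own, rather than \<open>nat list \<Rightarrow> complex\<close> and functions on it, keep the
  additive and multiplicative structure available to type classes without eta-expansion getting in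
  the way of unification.\<close>

typedef wordfun = "UNIV :: (nat list \<Rightarrow> complex) set"
  morphisms coef Wordfun ..

setup_lifting type_definition_wordfun

lemma wordfun_eqI: "(\<And>w. coef \<phi> w = coef \<chi> w) \<Longrightarrow> \<phi> = \<chi>"
  by transfer auto

instantiation wordfun :: ab_group_add
begin

lift_definition zero_wordfun :: wordfun is "\<lambda>_. 0" .
lift_definition plus_wordfun :: "wordfun \<Rightarrow> wordfun \<Rightarrow> wordfun" is "\<lambda>\<phi> \<chi> w. \<phi> w + \<chi> w" .
lift_definition minus_wordfun :: "wordfun \<Rightarrow> wordfun \<Rightarrow> wordfun" is "\<lambda>\<phi> \<chi> w. \<phi> w - \<chi> w" .
lift_definition uminus_wordfun :: "wordfun \<Rightarrow> wordfun" is "\<lambda>\<phi> w. - \<phi> w" .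

instance
  by standard (transfer; simp add: fun_eq_iff)+

end

lift_definition fscale :: "complex \<Rightarrow> wordfun \<Rightarrow> wordfun" is "\<lambda>c \<phi> w. c * \<phi> w" .

lemma coef_simps [simp]:
  "coef 0 w = 0" "coef (\<phi> + \<chi>) w = coef \<phi> w + coef \<chi> w"
  "coef (\<phi> - \<chi>) w = coef \<phi> w - coef \<chi> w" "coef (- \<phi>) w = - coef \<phi> w"
  "coef (fscale c \<phi>) w = c * coef \<phi> w"
  by (transfer; simp)+

lemma coef_sum: "coef (sum g I) w = (\<Sum>i\<in>I. coef (g i) w)"
  by (induction I rule: infinite_finite_induct) auto

lemma fscale_simps [simp]:
  "fscale c 0 = 0" "fscale 0 \<phi> = 0" "fscale 1 \<phi> = \<phi>" "fscale c (fscale d \<phi>) = fscale (c * d) \<phi>"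
  by (rule wordfun_eqI; simp)+

lemma fscale_distribs:
  "fscale c (\<phi> + \<chi>) = fscale c \<phi> + fscale c \<chi>" "fscale c (\<phi> - \<chi>) = fscale c \<phi> - fscale c \<chi>"
  "fscale (c + d) \<phi> = fscale c \<phi> + fscale d \<phi>" "fscale c (- \<phi>) = - fscale c \<phi>"
  by (rule wordfun_eqI; simp add: algebra_simps)+

typedef endo = "{A :: wordfun \<Rightarrow> wordfun.
    (\<forall>\<phi> \<chi>. A (\<phi> + \<chi>) = A \<phi> + A \<chi>) \<and> (\<forall>c \<phi>. A (fscale c \<phi>) = fscale c (A \<phi>))}"
  morphisms app Endo
  by (rule exI[of _ "\<lambda>\<phi>. \<phi>"]) simp

setup_lifting type_definition_endo

lemma endo_eqI: "(\<And>\<phi>. app A \<phi> = app B \<phi>) \<Longrightarrow> A = B"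
  by (metis app_inject ext)

lemma app_add: "app A (\<phi> + \<chi>) = app A \<phi> + app A \<chi>"
  and app_fscale: "app A (fscale c \<phi>) = fscale c (app A \<phi>)"
  using app[of A] by auto

lemma app_zero [simp]: "app A 0 = 0"
  using app_add[of A 0 0] by simp

instantiation endo :: ring_1
begin

lift_definition zero_endo :: endo is "\<lambda>_. 0" by simp
lift_definition one_endo :: endo is "\<lambda>\<phi>. \<phi>" by simp
lift_definition plus_endo :: "endo \<Rightarrow> endo \<Rightarrow> endo" is "\<lambda>A B \<phi>. A \<phi> + B \<phi>"
  by (simp add: algebra_simps fscale_distribs)
lift_definition minus_endo :: "endo \<Rightarrow> endo \<Rightarrow> endo" is "\<lambda>A B \<phi>. A \<phi> - B \<phi>"
  by (simp add: algebra_simps fscale_distribs)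
lift_definition uminus_endo :: "endo \<Rightarrow> endo" is "\<lambda>A \<phi>. - A \<phi>"
  by (simp add: algebra_simps fscale_distribs)
lift_definition times_endo :: "endo \<Rightarrow> endo \<Rightarrow> endo" is "\<lambda>A B \<phi>. A (B \<phi>)"
  by simp

instance
proof
  show "(0::endo) \<noteq> 1"
  proof
    assume "(0::endo) = 1"
    then have "app 0 \<phi> = app 1 \<phi>" for \<phi> by simp
    then have "coef (Wordfun (\<lambda>_. 1)) [] = coef 0 []"
      by (metis one_endo.rep_eq zero_endo.rep_eq)
    then show False by (simp add: Wordfun_inverse)
  qed
qed (transfer; simp add: fun_eq_iff algebra_simps)+

end

lift_definition scal :: "complex \<Rightarrow> endo" is fscale
  by (simp add: fscale_distribs mult.commute)

lemma app_simps [simp]: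
  "app 0 \<phi> = 0" "app 1 \<phi> = \<phi>" "app (A + B) \<phi> = app A \<phi> + app B \<phi>"
  "app (A - B) \<phi> = app A \<phi> - app B \<phi>" "app (- A) \<phi> = - app A \<phi>"
  "app (A * B) \<phi> = app A (app B \<phi>)" "app (scal c) \<phi> = fscale c \<phi>"
  by (simp_all add: zero_endo.rep_eq one_endo.rep_eq plus_endo.rep_eq minus_endo.rep_eq
      uminus_endo.rep_eq times_endo.rep_eq scal.rep_eq)

lemma app_diff: "app A (\<phi> - \<chi>) = app A \<phi> - app A \<chi>"
  using app_add[of A "\<phi> - \<chi>" \<chi>] by (simp add: algebra_simps)

lemma app_sum: "app A (sum g I) = (\<Sum>i\<in>I. app A (g i))"
  by (induction I rule: infinite_finite_induct) (auto simp: app_add)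

lemma app_sum_left: "app (sum g I) \<phi> = (\<Sum>i\<in>I. app (g i) \<phi>)"
  by (induction I rule: infinite_finite_induct) auto

lemma scal_add: "scal (a + b) = scal a + scal b"
  and scal_mult: "scal (a * b) = scal a * scal b"
  and scal_minus: "scal (- a) = - scal a"
  and scal_0 [simp]: "scal 0 = 0"
  and scal_1 [simp]: "scal 1 = 1"
  by (intro endo_eqI wordfun_eqI; simp add: algebra_simps)+

lemma scal_numeral: "scal (numeral n) = numeral n"
  by (induction n) (simp_all only: numeral.simps scal_add scal_1)

lemma scal_commute: "A * scal c = scal c * A"
  by (intro endo_eqI) (simp add: app_fscale)

lemma scal_left_commute: "A * (scal c * B) = scal c * (A * B)"
  by (metis mult.assoc scal_commute)

section \<open>Linear extension to monoid algebras\<close>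

definition lin_ext :: "('k \<Rightarrow> endo) \<Rightarrow> ('k \<Rightarrow>\<^sub>0 complex) \<Rightarrow> endo" where
  "lin_ext g q = (\<Sum>s\<in>Poly_Mapping.keys q. scal (Poly_Mapping.lookup q s) * g s)"

lemma lin_ext_superset:
  assumes "finite S" "Poly_Mapping.keys q \<subseteq> S"
  shows "lin_ext g q = (\<Sum>s\<in>S. scal (Poly_Mapping.lookup q s) * g s)"
  unfolding lin_ext_def
  by (rule sum.mono_neutral_left) (use assms in \<open>auto simp: in_keys_iff\<close>)

lemma lin_ext_add: "lin_ext g (q + r) = lin_ext g q + lin_ext g r"
proof -
  let ?S = "Poly_Mapping.keys q \<union> Poly_Mapping.keys r"
  have "lin_ext g (q + r) = (\<Sum>s\<in>?S. scal (Poly_Mapping.lookup (q + r) s) * g s)"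
    by (rule lin_ext_superset) (auto simp: Poly_Mapping.keys_add)
  also have "\<dots> = (\<Sum>s\<in>?S. scal (Poly_Mapping.lookup q s) * g s)
                + (\<Sum>s\<in>?S. scal (Poly_Mapping.lookup r s) * g s)"
    by (simp add: lookup_add scal_add distrib_right sum.distrib)
  also have "\<dots> = lin_ext g q + lin_ext g r"
    using lin_ext_superset[of ?S q g] lin_ext_superset[of ?S r g] by simp
  finally show ?thesis .
qed

lemma lin_ext_single: "lin_ext g (Poly_Mapping.single s c) = scal c * g s"
  by (subst lin_ext_superset[of "{s}"]) auto

lemma sum_singles: "(\<Sum>s\<in>Poly_Mapping.keys q. Poly_Mapping.single s (Poly_Mapping.lookup q s)) = q"
proof (rule poly_mapping_eqI)
  fix k
  have "Poly_Mapping.lookup (\<Sum>s\<in>Poly_Mapping.keys q. Poly_Mapping.single s (Poly_Mapping.lookup q s)) k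
      = (\<Sum>s\<in>Poly_Mapping.keys q. if s = k then Poly_Mapping.lookup q s else 0)"
    by (simp add: lookup_sum lookup_single when_def)
  then show "Poly_Mapping.lookup (\<Sum>s\<in>Poly_Mapping.keys q. Poly_Mapping.single s (Poly_Mapping.lookup q s)) k
      = Poly_Mapping.lookup q k"
    by (simp add: in_keys_iff)
qed

text \<open>The monomials span, so additive maps need only be compared on them; used for both factors of a product.\<close>

lemma additive_eq_on_single:
  fixes G H :: "('k \<Rightarrow>\<^sub>0 complex) \<Rightarrow> 'v::ab_group_add"
  assumes "\<And>q r. G (q + r) = G q + G r" "\<And>q r. H (q + r) = H q + H r"
    and "\<And>s c. G (Poly_Mapping.single s c) = H (Poly_Mapping.single s c)"
  shows "G q = H q"
proof -
  have zero: "G 0 = 0" "H 0 = 0"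
    using assms(1)[of 0 0] assms(2)[of 0 0] by simp_all
  have "G (\<Sum>s\<in>S. Poly_Mapping.single s (f s)) = H (\<Sum>s\<in>S. Poly_Mapping.single s (f s))" for f S
    by (induction S rule: infinite_finite_induct) (auto simp: assms zero)
  from this[of "Poly_Mapping.lookup q" "Poly_Mapping.keys q"] show ?thesis
    by (simp add: sum_singles)
qed

lemma lin_ext_mult:
  fixes g :: "'k::monoid_add \<Rightarrow> endo"
  assumes hom: "\<And>s t. g (s + t) = g s * g t"
  shows "lin_ext g (q * r) = lin_ext g q * lin_ext g r"
proof (rule additive_eq_on_single[where q = q])
  fix s c
  show "lin_ext g (Poly_Mapping.single s c * r) = lin_ext g (Poly_Mapping.single s c) * lin_ext g r"
  proof (rule additive_eq_on_single[where q = r])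
    fix t d
    show "lin_ext g (Poly_Mapping.single s c * Poly_Mapping.single t d) =
          lin_ext g (Poly_Mapping.single s c) * lin_ext g (Poly_Mapping.single t d)"
      by (simp add: mult_single lin_ext_single scal_mult hom mult.assoc scal_left_commute[of "g s" d])
  qed (simp_all add: distrib_left lin_ext_add)
qed (simp_all add: distrib_right lin_ext_add)

section \<open>Polynomials acting by index shifts\<close>

type_synonym shift_poly = "(nat \<times> nat \<times> nat) \<Rightarrow>\<^sub>0 complex"
type_synonym op_family = "nat \<times> nat \<times> nat \<Rightarrow> endo"

text \<open>A polynomial in three variables acts on a family of operators indexed by triples: the
  monomial with exponent vector \<open>s\<close> replaces the index \<open>t\<close> by \<open>t + s\<close>. The polynomials form a
  commutative ring, so relations between generating series become identities of polynomials that
  ordinary ring normalisation can check.\<close>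

definition shift :: "shift_poly \<Rightarrow> op_family \<Rightarrow> op_family" where
  "shift q U = (\<lambda>t. lin_ext (\<lambda>s. U (t + s)) q)"

lemma shift_poly_add: "shift (q + r) U = shift q U + shift r U"
  by (auto simp: shift_def lin_ext_add)

lemma shift_single: "shift (Poly_Mapping.single s c) U = (\<lambda>t. scal c * U (t + s))"
  by (simp add: shift_def lin_ext_single)

lemma shift_family_add: "shift q (U + V) = shift q U + shift q V"
  by (auto simp: shift_def lin_ext_def distrib_left sum.distrib)

lemma shift_mult: "shift (q * r) U = shift q (shift r U)"
proof
  fix t
  show "shift (q * r) U t = shift q (shift r U) t"
  proof (rule additive_eq_on_single[where q = q])
    fix s c
    show "shift (Poly_Mapping.single s c * r) U t = shift (Poly_Mapping.single s c) (shift r U) t"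
    proof (rule additive_eq_on_single[where q = r])
      fix u d
      show "shift (Poly_Mapping.single s c * Poly_Mapping.single u d) U t =
            shift (Poly_Mapping.single s c) (shift (Poly_Mapping.single u d) U) t"
        by (simp add: mult_single shift_single scal_mult mult.assoc add.assoc)
    qed (simp_all add: distrib_left shift_poly_add shift_single)
  qed (simp_all add: distrib_right shift_poly_add)
qed

interpretation shift: Modules.module shift
proof
  show "shift 1 U = U" for U
    by (simp flip: single_one add: shift_single)
qed (simp_all add: shift_family_add shift_poly_add shift_mult)

declare shift.scale_scale [simp del]

definition vx :: shift_poly where "vx = Poly_Mapping.single (1, 0, 0) 1"
definition vy :: shift_poly where "vy = Poly_Mapping.single (0, 1, 0) 1"
definition vz :: shift_poly where "vz = Poly_Mapping.single (0, 0, 1) 1"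
definition vc :: "complex \<Rightarrow> shift_poly" where "vc c = Poly_Mapping.single 0 c"

lemma shift_vars [simp]:
  "shift vx U (a, b, c) = U (Suc a, b, c)"
  "shift vy U (a, b, c) = U (a, Suc b, c)"
  "shift vz U (a, b, c) = U (a, b, Suc c)"
  "shift (vc d) U (a, b, c) = scal d * U (a, b, c)"
  by (simp_all add: vx_def vy_def vz_def vc_def shift_single)

lemma shift_numeral [simp]: "shift (numeral n) U t = numeral n * U t"
proof -
  have "shift (Poly_Mapping.single 0 (numeral n)) U t = numeral n * U t"
    by (simp add: shift_single scal_numeral del: single_numeral)
  then show ?thesis by simp
qed

lemma vc_minus: "vc (- c) = - vc c"
  by (simp add: vc_def single_uminus)

text \<open>The cubic \<open>a\<^sup>3 + s2 a - s3\<close>. The exchange relations equate its value at a difference of two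
  shift variables with the same expression for \<open>- s3\<close>, applied to the two orders of a product.\<close>

definition cub :: "complex \<Rightarrow> complex \<Rightarrow> shift_poly \<Rightarrow> shift_poly" where
  "cub s2 s3 a = a * a * a + vc s2 * a - vc s3"

text \<open>The action of \<open>cub s2 s3\<close> at the difference of the two index shifts, written out
  (\<open>shift_cub\<close>).\<close>

definition cubdiff :: "complex \<Rightarrow> complex \<Rightarrow> (nat \<Rightarrow> nat \<Rightarrow> endo) \<Rightarrow> nat \<Rightarrow> nat \<Rightarrow> endo" where
  "cubdiff s2 s3 u i j = u (i + 3) j - 3 * u (i + 2) (j + 1) + 3 * u (i + 1) (j + 2) - u i (j + 3)
     + scal s2 * (u (i + 1) j - u i (j + 1)) - scal s3 * u i j"

lemma shift_cub:
  "shift (cub s2 s3 (vx - vy)) U (a, b, c) = cubdiff s2 s3 (\<lambda>i j. U (i, j, c)) a b"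
  "shift (cub s2 s3 (vx - vz)) U (a, b, c) = cubdiff s2 s3 (\<lambda>i j. U (i, b, j)) a c"
  "shift (cub s2 s3 (vy - vz)) U (a, b, c) = cubdiff s2 s3 (\<lambda>i j. U (a, i, j)) b c"
  by (simp_all add: cub_def cubdiff_def shift_poly_add shift_mult shift.scale_left_diff_distrib
      eval_nat_numeral algebra_simps)

lemma cubdiff_sandwich:
  "cubdiff s2 s3 (\<lambda>i j. L * u i j * R) i j = L * cubdiff s2 s3 u i j * R"
proof -
  have three: "A * (3 * B) = 3 * (A * B)" for A B :: endo
    by (metis mult.assoc mult_of_nat_commute of_nat_numeral)
  show ?thesis
    by (simp add: cubdiff_def algebra_simps three scal_left_commute[of L])
qed

lemma cubdiff_swap_sign: "cubdiff s2 (- s3) u i j = cubdiff s2 s3 u i j + 2 * (scal s3 * u i j)"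
  by (simp add: cubdiff_def scal_minus algebra_simps mult_2)

section \<open>Recursions modulo a subspace of operators\<close>

locale op_subspace =
  fixes T :: "endo set"
  assumes zero: "0 \<in> T" and add: "A \<in> T \<Longrightarrow> B \<in> T \<Longrightarrow> A + B \<in> T"
    and scale: "A \<in> T \<Longrightarrow> scal c * A \<in> T"
begin

lemma minus: "A \<in> T \<Longrightarrow> - A \<in> T"
  using scale[of A "-1"] by (simp add: scal_minus)

lemma diff: "A \<in> T \<Longrightarrow> B \<in> T \<Longrightarrow> A - B \<in> T"
  using add[of A "- B"] minus[of B] by simp

lemma numeral: "A \<in> T \<Longrightarrow> numeral n * A \<in> T"
  using scale[of A "numeral n"] by (simp add: scal_numeral)

lemma sum: "(\<And>i. i \<in> I \<Longrightarrow> g i \<in> T) \<Longrightarrow> sum g I \<in> T"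
  by (induction I rule: infinite_finite_induct) (auto intro: zero add)

lemmas closed = zero add minus diff scale numeral

lemma shift_closed: "(\<And>t. U t \<in> T) \<Longrightarrow> shift q U t \<in> T"
  unfolding shift_def lin_ext_def by (intro sum scale) auto

lemma cubdiff_closed: "(\<And>i j. u i j \<in> T) \<Longrightarrow> cubdiff s2 s3 u i j \<in> T"
  unfolding cubdiff_def by (intro closed) auto

text \<open>The cubic is monic in the shift of the first index, so the family is determined by its
  image and its first three members.\<close>

lemma cubdiff_unique:
  assumes "\<And>i j. cubdiff s2 s3 u i j \<in> T" "\<And>i j. i < 3 \<Longrightarrow> u i j \<in> T"
  shows "u i j \<in> T"
proof (induction i arbitrary: j rule: less_induct)
  case (less i)
  show ?case
  proof (cases "i < 3")
    case False
    then obtain m where m: "i = m + 3" by (metis add.commute le_Suc_ex not_less)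
    have "u i j = cubdiff s2 s3 u m j + 3 * u (m + 2) (j + 1) - 3 * u (m + 1) (j + 2) + u m (j + 3)
       - scal s2 * (u (m + 1) j - u m (j + 1)) + scal s3 * u m j"
      by (simp add: m cubdiff_def)
    also have "\<dots> \<in> T"
      by (intro closed assms(1) less.IH) (auto simp: m)
    finally show ?thesis .
  qed (simp add: assms)
qed

lemma shift_unique_xy:
  assumes "\<And>t. shift (cub s2 s3 (vx - vy)) U t \<in> T" "\<And>a b c. a < 3 \<Longrightarrow> U (a, b, c) \<in> T"
  shows "U t \<in> T"
  using cubdiff_unique[of s2 s3 "\<lambda>i j. U (i, j, snd (snd t))" "fst t" "fst (snd t)"] assms
  by (metis prod.collapse shift_cub(1))

lemma shift_unique_xz:
  assumes "\<And>t. shift (cub s2 s3 (vx - vz)) U t \<in> T" "\<And>a b c. a < 3 \<Longrightarrow> U (a, b, c) \<in> T"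
  shows "U t \<in> T"
  using cubdiff_unique[of s2 s3 "\<lambda>i j. U (i, fst (snd t), j)" "fst t" "snd (snd t)"] assms
  by (metis prod.collapse shift_cub(2))

lemma shift_unique_yz:
  assumes "\<And>t. shift (cub s2 s3 (vy - vz)) U t \<in> T" "\<And>a b c. b < 3 \<Longrightarrow> U (a, b, c) \<in> T"
  shows "U t \<in> T"
  using cubdiff_unique[of s2 s3 "\<lambda>i j. U (fst t, i, j)" "fst (snd t)" "snd (snd t)"] assms
  by (metis prod.collapse shift_cub(3))

end

section \<open>Currents with a cubic exchange relation\<close>

lemma two_left: "A * (2 * B) = 2 * (A * B)" for A B :: "'a::ring_1"
  by (simp add: mult_2 distrib_left mult_2_right)

lemma shift_sandwich:
  assumes "\<And>i j. cubdiff s2 s3 u i j = v i j"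
  shows "shift (cub s2 s3 (vx - vy)) (\<lambda>(a, b, c). L c * u a b * R c) = (\<lambda>(a, b, c). L c * v a b * R c)"
    and "shift (cub s2 s3 (vx - vz)) (\<lambda>(a, b, c). L b * u a c * R b) = (\<lambda>(a, b, c). L b * v a c * R b)"
    and "shift (cub s2 s3 (vy - vz)) (\<lambda>(a, b, c). L a * u b c * R a) = (\<lambda>(a, b, c). L a * v b c * R a)"
  by (auto simp: fun_eq_iff shift_cub cubdiff_sandwich assms)

text \<open>Both exchange relations, of \<open>\<psi>\<close> with \<open>e\<close> and of \<open>\<psi>\<close> with \<open>f\<close>, have this form. Here \<open>th\<close>
  is the coefficient sequence of the series \<open>1 + s3 \<psi>(z)\<close>: the extra scalar \<open>d\<close> carries the
  constant term, and thereby the relations for \<open>\<psi>\<^sub>0\<close>, \<open>\<psi>\<^sub>1\<close> and \<open>\<psi>\<^sub>2\<close>, without division by \<open>s3\<close>.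
  The pair \<open>f\<close>, \<open>- \<psi>\<close>, \<open>- s3\<close> satisfies the same axioms as \<open>e\<close>, \<open>\<psi>\<close>, \<open>s3\<close>.\<close>

locale current =
  fixes s2 s3 :: complex and ps th e :: "nat \<Rightarrow> endo" and d :: "nat \<Rightarrow> complex"
  assumes th: "th i = scal s3 * ps i + scal (d i)"
    and rel: "cubdiff s2 s3 (\<lambda>i j. ps i * e j - e j * ps i) i j = 2 * (e j * th i)"
begin

lemma th_commutator: "th i * e j - e j * th i = scal s3 * (ps i * e j - e j * ps i)"
  by (simp add: th algebra_simps scal_left_commute[of "e j"] scal_commute[of "e j"])

lemma rel_left: "cubdiff s2 (- s3) (\<lambda>i j. ps i * e j - e j * ps i) i j = 2 * (th i * e j)"
  by (simp only: cubdiff_swap_sign rel th_commutator[symmetric]) (simp add: right_diff_distrib)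

lemma cubdiff_th: "cubdiff s2 s3 (\<lambda>i j. th i * e j - e j * th i) i j = 2 * (scal s3 * (e j * th i))"
  using cubdiff_sandwich[of s2 s3 "scal s3" "\<lambda>i j. ps i * e j - e j * ps i" 1 i j]
  by (simp add: th_commutator rel two_left mult.assoc)

lemma rel_th: "cubdiff s2 s3 (\<lambda>i j. th i * e j) i j = cubdiff s2 (- s3) (\<lambda>i j. e j * th i) i j"
proof -
  have "cubdiff s2 s3 (\<lambda>i j. th i * e j) i j =
        cubdiff s2 s3 (\<lambda>i j. e j * th i) i j + cubdiff s2 s3 (\<lambda>i j. th i * e j - e j * th i) i j"
    by (simp add: cubdiff_def algebra_simps)
  then show ?thesis by (simp add: cubdiff_th cubdiff_swap_sign)
qed

end

section \<open>The Serre relation\<close>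

text \<open>With \<open>x\<close>, \<open>y\<close>, \<open>z\<close> the shifts of \<open>\<psi>\<close> and of two \<open>e\<close>: the coefficients of the two orders
  of the \<open>e\<close> after clearing denominators in the commutator of the Serre relation with \<open>f\<close>. They
  are multiples of the cubics at \<open>y - z\<close> for \<open>s3\<close> and \<open>- s3\<close>, with the same cofactor up to sign, which
  is why the quadratic relation between the \<open>e\<close> suffices.\<close>

lemma serre_polynomial:
  fixes x y z s2 s3 :: "'a::comm_ring_1"
  defines "C \<equiv> \<lambda>a. a * a * a + s2 * a"
  shows "(x + z - 2 * y) * (C (x - z) + s3) - (x + y - 2 * z) * (C (x - y) - s3)
       = - (2 * x - y - z) * (C (y - z) - s3)"
    and "- ((x + z - 2 * y) * (C (x - z) - s3)) + (x + y - 2 * z) * (C (x - y) + s3)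
       = (2 * x - y - z) * (C (y - z) + s3)"
  unfolding C_def by (simp_all add: algebra_simps)

context current
begin

definition double_bracket :: "nat \<Rightarrow> nat \<Rightarrow> nat \<Rightarrow> endo" where
  "double_bracket a b c = (ps a * e b - e b * ps a) * e c - e c * (ps a * e b - e b * ps a)"

text \<open>The commutator of the Serre relation with \<open>f\<^sub>k\<close> is a sum of three such terms
  (\<open>serre_commutator\<close>), one for each \<open>e\<close> that \<open>f\<^sub>k\<close> can turn into a \<open>\<psi>\<close>. In terms of index shifts it is
  \<open>(x + z - 2 y) [[\<psi>, e], e]\<close>, symmetrised in the two \<open>e\<close>; here \<open>x\<close>, \<open>y\<close>, \<open>z\<close> shift the indices of \<open>\<psi>\<close>,
  of the inner and of the outer \<open>e\<close>.\<close>

definition serre_kernel :: "nat \<Rightarrow> nat \<Rightarrow> nat \<Rightarrow> endo" where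
  "serre_kernel a b c = double_bracket (Suc a) b c + double_bracket a b (Suc c) - 2 * double_bracket a (Suc b) c
     + (double_bracket (Suc a) c b + double_bracket a c (Suc b) - 2 * double_bracket a (Suc c) b)"

text \<open>The exchange relation for the inner commutator clears \<open>x - y\<close>; the one for moving \<open>th\<close> past the
  outer \<open>e\<close> then clears \<open>x - z\<close>. The second part exchanges the roles of the two \<open>e\<close>.\<close>

lemma shift_double_bracket:
  shows "shift (cub s2 s3 (vx - vy) * cub s2 s3 (vx - vz)) (\<lambda>(a, b, c). double_bracket a b c) =
      shift (2 * cub s2 (- s3) (vx - vz)) (\<lambda>(a, b, c). e b * e c * th a)
      - shift (2 * cub s2 s3 (vx - vz)) (\<lambda>(a, b, c). e c * e b * th a)" (is "?L = ?R")
    and "shift (cub s2 s3 (vx - vy) * cub s2 s3 (vx - vz)) (\<lambda>(a, b, c). double_bracket a c b) =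
      shift (2 * cub s2 (- s3) (vx - vy)) (\<lambda>(a, b, c). e c * e b * th a)
      - shift (2 * cub s2 s3 (vx - vy)) (\<lambda>(a, b, c). e b * e c * th a)" (is "?L' = ?R'")
proof -
  let ?ad = "\<lambda>i j. ps i * e j - e j * ps i"
  have double_bracket: "(\<lambda>(a, b, c). double_bracket a b c) = (\<lambda>(a, b, c). 1 * ?ad a b * e c) - (\<lambda>(a, b, c). e c * ?ad a b * 1)"
    "(\<lambda>(a, b, c). double_bracket a c b) = (\<lambda>(a, b, c). 1 * ?ad a c * e b) - (\<lambda>(a, b, c). e b * ?ad a c * 1)"
    by (auto simp: fun_eq_iff double_bracket_def)
  have xy: "shift (cub s2 s3 (vx - vy)) (\<lambda>(a, b, c). double_bracket a b c) =
       shift 2 (\<lambda>(a, b, c). e b * (th a * e c)) - shift 2 (\<lambda>(a, b, c). e c * e b * th a)"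
    unfolding double_bracket shift.scale_right_diff_distrib
    by (subst (1 2) shift_sandwich(1)[of s2 s3 ?ad "\<lambda>i j. 2 * (e j * th i)"])
       (auto simp: fun_eq_iff rel two_left mult.assoc)
  have xz: "shift (cub s2 s3 (vx - vz)) (\<lambda>(a, b, c). double_bracket a c b) =
       shift 2 (\<lambda>(a, b, c). e c * (th a * e b)) - shift 2 (\<lambda>(a, b, c). e b * e c * th a)"
    unfolding double_bracket shift.scale_right_diff_distrib
    by (subst (1 2) shift_sandwich(2)[of s2 s3 ?ad "\<lambda>i j. 2 * (e j * th i)"])
       (auto simp: fun_eq_iff rel two_left mult.assoc)
  have th: "cubdiff s2 s3 (\<lambda>i j. L * (th i * e j)) i j = cubdiff s2 (- s3) (\<lambda>i j. L * (e j * th i)) i j" for L i j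
    using cubdiff_sandwich[of s2 s3 L "\<lambda>i j. th i * e j" 1 i j]
      cubdiff_sandwich[of s2 "- s3" L "\<lambda>i j. e j * th i" 1 i j]
    by (simp add: rel_th mult.assoc)
  have th1: "shift (cub s2 s3 (vx - vz)) (\<lambda>(a, b, c). e b * (th a * e c)) =
             shift (cub s2 (- s3) (vx - vz)) (\<lambda>(a, b, c). e b * e c * th a)"
    by (auto simp: fun_eq_iff shift_cub th mult.assoc)
  have th2: "shift (cub s2 s3 (vx - vy)) (\<lambda>(a, b, c). e c * (th a * e b)) =
             shift (cub s2 (- s3) (vx - vy)) (\<lambda>(a, b, c). e c * e b * th a)"
    by (auto simp: fun_eq_iff shift_cub th mult.assoc)
  have "?L = shift (cub s2 s3 (vx - vz)) (shift (cub s2 s3 (vx - vy)) (\<lambda>(a, b, c). double_bracket a b c))"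
    by (simp only: shift_mult[symmetric] mult.commute)
  also have "\<dots> = shift 2 (shift (cub s2 s3 (vx - vz)) (\<lambda>(a, b, c). e b * (th a * e c)))
     - shift (2 * cub s2 s3 (vx - vz)) (\<lambda>(a, b, c). e c * e b * th a)"
    by (simp only: xy shift.scale_right_diff_distrib shift_mult[symmetric] mult.commute)
  also have "\<dots> = ?R"
    by (simp only: th1 shift_mult)
  finally show "?L = ?R" .
  have "?L' = shift (cub s2 s3 (vx - vy)) (shift (cub s2 s3 (vx - vz)) (\<lambda>(a, b, c). double_bracket a c b))"
    by (simp only: shift_mult[symmetric] mult.commute)
  also have "\<dots> = shift 2 (shift (cub s2 s3 (vx - vy)) (\<lambda>(a, b, c). e c * (th a * e b)))
     - shift (2 * cub s2 s3 (vx - vy)) (\<lambda>(a, b, c). e b * e c * th a)"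
    by (simp only: xz shift.scale_right_diff_distrib shift_mult[symmetric] mult.commute)
  also have "\<dots> = ?R'"
    by (simp only: th2 shift_mult)
  finally show "?L' = ?R'" .
qed

text \<open>The quadratic relation between the \<open>e\<close>, both sides collected: it holds iff this vanishes.\<close>

definition quad :: "nat \<Rightarrow> nat \<Rightarrow> endo" where
  "quad i j = cubdiff s2 s3 (\<lambda>i j. e i * e j) i j - cubdiff s2 (- s3) (\<lambda>i j. e j * e i) i j"

lemma shift_serre_kernel:
  "shift (cub s2 s3 (vx - vy) * cub s2 s3 (vx - vz)) (\<lambda>(a, b, c). serre_kernel a b c) =
   shift (- 2 * (2 * vx - vy - vz)) (\<lambda>(a, b, c). quad b c * th a)"
proof -
  let ?PP = "cub s2 s3 (vx - vy) * cub s2 s3 (vx - vz)"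
  let ?v = "\<lambda>(a, b, c). e b * e c * th a" and ?v' = "\<lambda>(a, b, c). e c * e b * th a"
  have ker: "(\<lambda>(a, b, c). serre_kernel a b c) =
      shift (vx + vz - 2 * vy) (\<lambda>(a, b, c). double_bracket a b c) + shift (vx + vy - 2 * vz) (\<lambda>(a, b, c). double_bracket a c b)"
    by (auto simp: fun_eq_iff serre_kernel_def shift_poly_add shift_mult shift.scale_left_diff_distrib)
  have "shift ?PP (\<lambda>(a, b, c). serre_kernel a b c) =
      shift (vx + vz - 2 * vy) (shift ?PP (\<lambda>(a, b, c). double_bracket a b c))
    + shift (vx + vy - 2 * vz) (shift ?PP (\<lambda>(a, b, c). double_bracket a c b))"
    by (simp only: ker shift_family_add shift_mult[symmetric] mult.commute)
  also have "\<dots> = shift ((vx + vz - 2 * vy) * (2 * cub s2 (- s3) (vx - vz)) - (vx + vy - 2 * vz) * (2 * cub s2 s3 (vx - vy))) ?v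
    + shift (- ((vx + vz - 2 * vy) * (2 * cub s2 s3 (vx - vz))) + (vx + vy - 2 * vz) * (2 * cub s2 (- s3) (vx - vy))) ?v'"
    by (simp only: shift_double_bracket shift.scale_right_diff_distrib shift_mult[symmetric] shift_poly_add
        shift.scale_left_diff_distrib shift.scale_minus_left) simp
  also have "(vx + vz - 2 * vy) * (2 * cub s2 (- s3) (vx - vz)) - (vx + vy - 2 * vz) * (2 * cub s2 s3 (vx - vy))
    = - 2 * (2 * vx - vy - vz) * cub s2 s3 (vy - vz)"
    using arg_cong[OF serre_polynomial(1)[of vx vz vy "vc s2" "vc s3"], of "(*) 2"]
    by (simp add: cub_def vc_minus algebra_simps)
  also have "- ((vx + vz - 2 * vy) * (2 * cub s2 s3 (vx - vz))) + (vx + vy - 2 * vz) * (2 * cub s2 (- s3) (vx - vy))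
    = - (- 2 * (2 * vx - vy - vz) * cub s2 (- s3) (vy - vz))"
    using arg_cong[OF serre_polynomial(2)[of vx vz vy "vc s2" "vc s3"], of "(*) 2"]
    by (simp add: cub_def vc_minus algebra_simps)
  also have "shift (- 2 * (2 * vx - vy - vz) * cub s2 s3 (vy - vz)) ?v
    + shift (- (- 2 * (2 * vx - vy - vz) * cub s2 (- s3) (vy - vz))) ?v'
    = shift (- 2 * (2 * vx - vy - vz)) (shift (cub s2 s3 (vy - vz)) ?v - shift (cub s2 (- s3) (vy - vz)) ?v')"
    by (simp only: shift_mult shift.scale_minus_left shift.scale_right_diff_distrib) simp
  also have "shift (cub s2 s3 (vy - vz)) ?v - shift (cub s2 (- s3) (vy - vz)) ?v' = (\<lambda>(a, b, c). quad b c * th a)"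
    using cubdiff_sandwich[of _ _ 1 "\<lambda>i j. e i * e j"] cubdiff_sandwich[of _ _ 1 "\<lambda>i j. e j * e i"]
    by (auto simp: fun_eq_iff shift_cub quad_def left_diff_distrib)
  finally show ?thesis .
qed

text \<open>The kernel is a solution of two successive cubic recursions whose right-hand side lies in
  \<open>T\<close>, and it vanishes for small first index.\<close>

lemma serre_kernel_vanishes:
  assumes "op_subspace T" and quad: "\<And>a b c. quad b c * th a \<in> T" and small: "\<And>i. i < 8 \<Longrightarrow> ps i = 0"
  shows "serre_kernel a b c \<in> T"
proof -
  interpret op_subspace T by fact
  let ?K = "\<lambda>(a, b, c). serre_kernel a b c"
  have K0: "serre_kernel a b c = 0" if "a < 7" for a b c
    using that by (simp add: serre_kernel_def double_bracket_def small)
  have "shift (cub s2 s3 (vx - vz)) ?K t \<in> T" for t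
  proof (rule shift_unique_xy[of s2 s3])
    show "shift (cub s2 s3 (vx - vy)) (shift (cub s2 s3 (vx - vz)) ?K) t \<in> T" for t
      unfolding shift_mult[symmetric] shift_serre_kernel
      by (rule shift_closed) (auto simp: quad)
    show "shift (cub s2 s3 (vx - vz)) ?K (a, b, c) \<in> T" if "a < 3" for a b c
      using that by (simp add: shift_cub cubdiff_def K0 zero)
  qed
  from shift_unique_xz[OF this, of "(a, b, c)"] show ?thesis
    by (simp add: K0 zero)
qed

end

lemma cubdiff_add: "cubdiff s2 s3 (\<lambda>i j. u i j + v i j) i j = cubdiff s2 s3 u i j + cubdiff s2 s3 v i j"
  and cubdiff_diff: "cubdiff s2 s3 (\<lambda>i j. u i j - v i j) i j = cubdiff s2 s3 u i j - cubdiff s2 s3 v i j"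
  by (simp_all add: cubdiff_def algebra_simps)

lemma cubdiff_flip: "cubdiff s2 s3 (\<lambda>i j. u j i) i j = - cubdiff s2 (- s3) u j i"
  by (simp add: cubdiff_def scal_minus algebra_simps)

text \<open>The index of \<open>ps\<close> is shifted by \<open>8\<close>: \<open>ps (i + 8)\<close> is \<open>\<psi>\<^sub>i\<close>, and \<open>ps\<close> vanishes below. The cubic
  recursions can then start from zero, also for families built from \<open>ps\<close> by raising its index a few
  times; \<open>serre_kernel_vanishes\<close> needs the most room.\<close>

locale current_pair = current +
  fixes f :: "nat \<Rightarrow> endo"
  assumes ef: "e i * f k = f k * e i + ps (i + k + 8)"
    and d_ge: "d (i + 8) = 0" and small: "i < 8 \<Longrightarrow> ps i = 0"
begin

lemma ef_assoc: "e i * (f k * A) = f k * (e i * A) + ps (i + k + 8) * A"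
  using arg_cong[OF ef[of i k], of "\<lambda>B. B * A"] by (simp add: distrib_right mult.assoc)

lemma rel_ge: "cubdiff s2 s3 (\<lambda>i j. ps (i + k + 8) * e j) i j = cubdiff s2 (- s3) (\<lambda>i j. e j * ps (i + k + 8)) i j"
proof -
  have "cubdiff s2 s3 (\<lambda>i j. ps (i + k + 8) * e j) i j - cubdiff s2 s3 (\<lambda>i j. e j * ps (i + k + 8)) i j
      = cubdiff s2 s3 (\<lambda>i j. ps i * e j - e j * ps i) (i + k + 8) j"
    by (simp add: cubdiff_def algebra_simps)
  also have "\<dots> = 2 * (scal s3 * (e j * ps (i + k + 8)))"
    using d_ge[of "i + k"] by (simp add: rel th scal_left_commute[of "e j"])
  finally show ?thesis
    by (simp add: cubdiff_swap_sign algebra_simps)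
qed

text \<open>Commuting with \<open>f\<^sub>k\<close> replaces one of the two \<open>e\<close> by a \<open>\<psi>\<close>. The four resulting terms cancel in
  pairs by the exchange relation, used once as it stands and once with the two indices swapped.\<close>

lemma quad_commute: "quad i j * f k = f k * quad i j"
proof -
  have "quad i j * f k - f k * quad i j
      = cubdiff s2 s3 (\<lambda>i j. e i * e j * f k - f k * (e i * e j)) i j
      - cubdiff s2 (- s3) (\<lambda>i j. e j * e i * f k - f k * (e j * e i)) i j"
    using cubdiff_sandwich[of s2 s3 1 "\<lambda>i j. e i * e j" "f k"] cubdiff_sandwich[of s2 s3 "f k" "\<lambda>i j. e i * e j" 1]
      cubdiff_sandwich[of s2 "- s3" 1 "\<lambda>i j. e j * e i" "f k"] cubdiff_sandwich[of s2 "- s3" "f k" "\<lambda>i j. e j * e i" 1]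
    by (simp add: quad_def cubdiff_diff algebra_simps)
  also have "\<dots> = cubdiff s2 s3 (\<lambda>i j. ps (i + k + 8) * e j + e i * ps (j + k + 8)) i j
      - cubdiff s2 (- s3) (\<lambda>i j. e j * ps (i + k + 8) + ps (j + k + 8) * e i) i j"
    by (simp add: mult.assoc ef ef_assoc distrib_left add.commute)
  also have "\<dots> = 0"
    using rel_ge[of k i j] rel_ge[of k j i]
      cubdiff_flip[of s2 s3 "\<lambda>j i. e i * ps (j + k + 8)" i j]
      cubdiff_flip[of s2 "- s3" "\<lambda>j i. ps (j + k + 8) * e i" i j]
    by (simp add: cubdiff_add)
  finally show ?thesis by simp
qed

lemma serre_commutator:
  "serre e i j l * f k - f k * serre e i j l =
   serre_kernel (i + k + 8) j l + serre_kernel (j + k + 8) i l + serre_kernel (l + k + 8) i j"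
  by (simp add: serre_def sym3_def commutator_def serre_kernel_def double_bracket_def mult_2 ef ef_assoc algebra_simps)

lemma serre_commute:
  assumes "op_subspace T" and "\<And>a b c. quad b c * th a \<in> T"
  shows "serre e i j l * f k - f k * serre e i j l \<in> T"
  unfolding serre_commutator
  by (intro op_subspace.add[OF assms(1)] serre_kernel_vanishes[OF assms(1)] assms(2) small)

end

section \<open>A representation on functions on words\<close>

lemma scal_assoc: "scal a * (scal b * A) = scal (a * b) * A"
  by (simp add: scal_mult mult.assoc)

locale dual_model =
  fixes s2 s3 :: complex and p :: "nat \<Rightarrow> complex"
begin

text \<open>The constant term of \<open>1 + s3 \<psi>(z)\<close>. It belongs to \<open>\<psi>\<^sub>-\<^sub>1\<close>, which has index \<open>7\<close> after the shift of all
  indices by \<open>8\<close>.\<close>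

definition delta :: "nat \<Rightarrow> complex" where
  "delta n = (if n = 7 then 1 else 0)"

text \<open>The recursive equation is the exchange relation of \<open>\<psi>\<close> with \<open>f\<close>, solved for
  \<open>f\<^sub>k \<psi>\<^sub>n\<^sub>-\<^sub>8\<close> and evaluated at \<open>w\<close>. It lowers the index of \<open>\<psi>\<close> or shortens the word. At the empty
  word \<open>\<psi>\<^sub>i\<close> acts by \<open>p\<^sub>i\<close>.\<close>

function psi_at :: "nat \<Rightarrow> (nat list \<Rightarrow> complex) \<Rightarrow> nat list \<Rightarrow> complex" where
  "psi_at n \<phi> [] = (if n < 8 then 0 else p (n - 8) * \<phi> [])"
| "psi_at n \<phi> (k # w) = (if n < 8 then 0 else
     psi_at n (\<lambda>u. \<phi> (k # u)) w
     - 3 * (psi_at (n - 1) (\<lambda>u. \<phi> (Suc k # u)) w - psi_at (n - 1) \<phi> (Suc k # w))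
     + 3 * (psi_at (n - 2) (\<lambda>u. \<phi> ((k + 2) # u)) w - psi_at (n - 2) \<phi> ((k + 2) # w))
     - (psi_at (n - 3) (\<lambda>u. \<phi> ((k + 3) # u)) w - psi_at (n - 3) \<phi> ((k + 3) # w))
     + s2 * (psi_at (n - 2) (\<lambda>u. \<phi> (k # u)) w - psi_at (n - 2) \<phi> (k # w))
     - s2 * (psi_at (n - 3) (\<lambda>u. \<phi> (Suc k # u)) w - psi_at (n - 3) \<phi> (Suc k # w))
     + s3 * (psi_at (n - 3) (\<lambda>u. \<phi> (k # u)) w + psi_at (n - 3) \<phi> (k # w))
     + 2 * delta (n - 3) * \<phi> (k # w))"
  by pat_completeness auto
termination
  by (relation "(\<lambda>(n, \<phi>, w). length w) <*mlex*> measure fst") (auto simp: mlex_prod_def)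

declare psi_at.simps [simp del]

text \<open>The equation \<open>f\<^sub>k e\<^sub>j = e\<^sub>j f\<^sub>k - \<psi>\<^sub>j\<^sub>+\<^sub>k\<close>, evaluated at \<open>w\<close>. Images under \<open>e\<^sub>j\<close> have no component
  of degree \<open>0\<close>, hence the value at the empty word.\<close>

fun e_at :: "nat \<Rightarrow> (nat list \<Rightarrow> complex) \<Rightarrow> nat list \<Rightarrow> complex" where
  "e_at j \<phi> [] = 0"
| "e_at j \<phi> (k # w) = e_at j (\<lambda>u. \<phi> (k # u)) w - psi_at (j + k + 8) \<phi> w"

lemma psi_at_small [simp]: "n < 8 \<Longrightarrow> psi_at n \<phi> w = 0"
  by (cases w) (auto simp: psi_at.simps)

lemma psi_at_linear:
  "psi_at n (\<lambda>u. c * \<phi> u + \<chi> u) w = c * psi_at n \<phi> w + psi_at n \<chi> w"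
proof (induction n \<phi> w arbitrary: \<chi> rule: psi_at.induct)
  case (2 n \<phi> k w)
  show ?case
  proof (cases "n < 8")
    case False
    show ?thesis
      unfolding psi_at.simps(2)[of n _ k w] 2(1)[OF False] 2(2)[OF False] 2(3)[OF False] 2(4)[OF False]
        2(5)[OF False] 2(6)[OF False] 2(7)[OF False] 2(8)[OF False] 2(9)[OF False] 2(10)[OF False]
        2(11)[OF False] 2(12)[OF False] 2(13)[OF False]
      using False by (simp add: algebra_simps)
  qed simp
qed (simp add: psi_at.simps algebra_simps)

lemma e_at_linear:
  "e_at n (\<lambda>u. c * \<phi> u + \<chi> u) w = c * e_at n \<phi> w + e_at n \<chi> w"
  by (induction n \<phi> w arbitrary: \<chi> rule: e_at.induct) (simp_all add: psi_at_linear right_diff_distrib)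

definition to_endo :: "((nat list \<Rightarrow> complex) \<Rightarrow> nat list \<Rightarrow> complex) \<Rightarrow> endo" where
  "to_endo g = Endo (\<lambda>\<phi>. Wordfun (g (coef \<phi>)))"

lemma coef_to_endo:
  assumes "\<And>c \<phi> \<chi> w. g (\<lambda>u. c * \<phi> u + \<chi> u) w = c * g \<phi> w + g \<chi> w"
  shows "coef (app (to_endo g) \<phi>) w = g (coef \<phi>) w"
proof -
  have zero: "g (\<lambda>_. 0) w = 0" for w
    using assms[of 1 "\<lambda>_. 0" "\<lambda>_. 0" w] by simp
  have "(\<lambda>\<phi>. Wordfun (g (coef \<phi>))) \<in> {A. (\<forall>\<phi> \<chi>. A (\<phi> + \<chi>) = A \<phi> + A \<chi>) \<and> (\<forall>c \<phi>. A (fscale c \<phi>) = fscale c (A \<phi>))}"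
    using assms[of 1] assms[of _ _ "\<lambda>_. 0"]
    by (auto intro!: wordfun_eqI simp: Wordfun_inverse plus_wordfun.rep_eq fscale.rep_eq zero)
  then show ?thesis
    by (simp add: to_endo_def Endo_inverse Wordfun_inverse)
qed

definition F_op :: "nat \<Rightarrow> endo" where "F_op k = to_endo (\<lambda>\<phi> w. \<phi> (k # w))"
definition E_op :: "nat \<Rightarrow> endo" where "E_op j = to_endo (e_at j)"
definition P_op :: "nat \<Rightarrow> endo" where "P_op n = to_endo (psi_at n)"
definition Th_op :: "nat \<Rightarrow> endo" where "Th_op n = scal s3 * P_op n + scal (delta n)"

lemma coef_F [simp]: "coef (app (F_op k) \<phi>) w = coef \<phi> (k # w)"
  and coef_E: "coef (app (E_op j) \<phi>) w = e_at j (coef \<phi>) w"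
  and coef_P: "coef (app (P_op n) \<phi>) w = psi_at n (coef \<phi>) w"
  by (simp_all add: F_op_def E_op_def P_op_def coef_to_endo psi_at_linear e_at_linear)

lemma coef_F_fun: "coef (app (F_op k) \<phi>) = (\<lambda>w. coef \<phi> (k # w))"
  by auto

lemma P_small [simp]: "n < 8 \<Longrightarrow> P_op n = 0"
  by (intro endo_eqI wordfun_eqI) (simp add: coef_P)

lemma E_F: "E_op j * F_op k = F_op k * E_op j + P_op (j + k + 8)"
  by (intro endo_eqI wordfun_eqI) (simp add: coef_P coef_E coef_F_fun)

lemma delta_zero: "n \<noteq> 7 \<Longrightarrow> delta n = 0" by (simp add: delta_def)

lemma P_F: "cubdiff s2 (- s3) (\<lambda>i j. (- P_op i) * F_op j - F_op j * (- P_op i)) i j = 2 * (F_op j * Th_op i)"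
proof (cases "i < 5")
  case True
  then show ?thesis
    by (simp add: cubdiff_def Th_op_def delta_zero)
next
  case False
  have "app (1 + 1) \<phi> = \<phi> + \<phi>" "app (1 + 1 + 1) \<phi> = \<phi> + \<phi> + \<phi>" for \<phi>
    by (simp_all only: app_simps)
  then have two: "app 2 \<phi> = \<phi> + \<phi>" "app 3 \<phi> = \<phi> + \<phi> + \<phi>" for \<phi>
    by simp_all
  have step: "i + 3 - 1 = i + 2" "i + 3 - 2 = i + 1" "i + 3 - 3 = i" "\<not> i + 3 < 8"
    using False by auto
  show ?thesis
    by (intro endo_eqI wordfun_eqI)
      (simp only: cubdiff_def Th_op_def two app_diff app_add app_fscale coef_P coef_F_fun coef_F app_simps coef_simps
        psi_at.simps(2)[of "i + 3" _ j] step if_False, simp add: algebra_simps numeral_2_eq_2 numeral_3_eq_3)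
qed

sublocale F: current s2 "- s3" "\<lambda>i. - P_op i" Th_op F_op delta
  using P_F by unfold_locales (simp_all add: Th_op_def scal_minus)

text \<open>Induction on words: an operator lies in all these right ideals iff it is zero, and lies in
  the one at \<open>k # w\<close> iff its product with \<open>F_op k\<close> lies in the one at \<open>w\<close>.\<close>

definition null_at :: "nat list \<Rightarrow> endo set" where
  "null_at w = {A. \<forall>\<phi>. coef (app A \<phi>) w = 0}"

lemma null_at_subspace: "op_subspace (null_at w)"
  by unfold_locales (auto simp: null_at_def)

lemma null_at_mult: "A \<in> null_at w \<Longrightarrow> A * B \<in> null_at w"
  by (simp add: null_at_def)

lemma null_at_Cons: "A \<in> null_at (k # w) \<longleftrightarrow> F_op k * A \<in> null_at w"
  by (simp add: null_at_def)

lemma eq_zero_iff_null: "A = 0 \<longleftrightarrow> (\<forall>w. A \<in> null_at w)"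
  by (auto simp: null_at_def intro!: endo_eqI wordfun_eqI)

text \<open>Moving \<open>f\<close> to the right past both \<open>\<psi>\<close>, at the cost of one cubic for each, turns \<open>f [\<psi>, \<psi>]\<close> into
  combinations of \<open>[\<psi>, \<psi>] f\<close>, which vanish at \<open>w\<close> by induction.\<close>

lemma P_commute: "P_op i * P_op j = P_op j * P_op i"
proof -
  have "P_op i * P_op j - P_op j * P_op i \<in> null_at w" for i j w
  proof (induction w arbitrary: i j)
    case Nil
    show ?case by (simp add: null_at_def coef_P psi_at.simps)
  next
    case (Cons k w)
    interpret op_subspace "null_at w" by (rule null_at_subspace)
    let ?\<alpha> = "cub s2 s3 (vx - vz)" and ?\<beta> = "cub s2 s3 (vy - vz)"
    let ?V = "\<lambda>(a, b, c). F_op c * (P_op a * P_op b - P_op b * P_op a)"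
    let ?D = "\<lambda>(a, b, c). (P_op a * P_op b - P_op b * P_op a) * F_op c"
    have rel: "cubdiff s2 s3 (\<lambda>i j. F_op j * P_op i - P_op i * F_op j) i j = 2 * (Th_op i * F_op j)" for i j
      using F.rel_left[of i j] by simp
    have xz: "shift ?\<alpha> (\<lambda>(a, b, c). (F_op c * P_op a - P_op a * F_op c) * R b) = shift 2 (\<lambda>(a, b, c). Th_op a * F_op c * R b)" for R
      using shift_sandwich(2)[of s2 s3, OF rel, of "\<lambda>_. 1" R]
      by (auto simp: fun_eq_iff mult.assoc)
    have yz: "shift ?\<beta> (\<lambda>(a, b, c). L a * (F_op c * P_op b - P_op b * F_op c)) = shift 2 (\<lambda>(a, b, c). L a * Th_op b * F_op c)" for L
      using shift_sandwich(3)[of s2 s3, OF rel, of L "\<lambda>_. 1"]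
      by (auto simp: fun_eq_iff mult.assoc two_left)
    have xz': "shift ?\<alpha> (\<lambda>(a, b, c). L b * (F_op c * P_op a - P_op a * F_op c)) = shift 2 (\<lambda>(a, b, c). L b * Th_op a * F_op c)" for L
      using shift_sandwich(2)[of s2 s3, OF rel, of L "\<lambda>_. 1"]
      by (auto simp: fun_eq_iff mult.assoc two_left)
    have yz': "shift ?\<beta> (\<lambda>(a, b, c). (F_op c * P_op b - P_op b * F_op c) * R a) = shift 2 (\<lambda>(a, b, c). Th_op b * F_op c * R a)" for R
      using shift_sandwich(3)[of s2 s3, OF rel, of "\<lambda>_. 1" R]
      by (auto simp: fun_eq_iff mult.assoc)
    \<comment> \<open>\<open>f\<close> passes \<open>\<psi>\<^sub>a\<close> and \<open>\<psi>\<^sub>b\<close> in either order; what remains is \<open>[\<psi>\<^sub>a, \<psi>\<^sub>b] f\<close>.\<close>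
    have 1: "?V = (\<lambda>(a, b, c). (F_op c * P_op a - P_op a * F_op c) * P_op b)
         - (\<lambda>(a, b, c). (F_op c * P_op b - P_op b * F_op c) * P_op a)
         + (\<lambda>(a, b, c). P_op a * (F_op c * P_op b - P_op b * F_op c))
         - (\<lambda>(a, b, c). P_op b * (F_op c * P_op a - P_op a * F_op c)) + ?D"
      by (auto simp: fun_eq_iff algebra_simps)
    have 2: "(\<lambda>(a, b, c). Th_op a * F_op c * P_op b) = (\<lambda>(a, b, c). Th_op a * (F_op c * P_op b - P_op b * F_op c)) + (\<lambda>(a, b, c). Th_op a * P_op b * F_op c)"
       "(\<lambda>(a, b, c). Th_op b * F_op c * P_op a) = (\<lambda>(a, b, c). Th_op b * (F_op c * P_op a - P_op a * F_op c)) + (\<lambda>(a, b, c). Th_op b * P_op a * F_op c)"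
      by (auto simp: fun_eq_iff algebra_simps)
    let ?A = "\<lambda>(a, b, c). (Th_op a * P_op b - P_op b * Th_op a) * F_op c"
    let ?B = "\<lambda>(a, b, c). (P_op a * Th_op b - Th_op b * P_op a) * F_op c"
    let ?C = "\<lambda>(a, b, c). (Th_op a * Th_op b - Th_op b * Th_op a) * F_op c"
    have "shift (?\<beta> * ?\<alpha>) ?V = shift ?\<beta> (shift ?\<alpha> (\<lambda>(a, b, c). (F_op c * P_op a - P_op a * F_op c) * P_op b))
         - shift ?\<alpha> (shift ?\<beta> (\<lambda>(a, b, c). (F_op c * P_op b - P_op b * F_op c) * P_op a))
         + shift ?\<alpha> (shift ?\<beta> (\<lambda>(a, b, c). P_op a * (F_op c * P_op b - P_op b * F_op c)))
         - shift ?\<beta> (shift ?\<alpha> (\<lambda>(a, b, c). P_op b * (F_op c * P_op a - P_op a * F_op c))) + shift (?\<beta> * ?\<alpha>) ?D"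
      unfolding 1 shift_family_add shift.scale_right_diff_distrib
      by (simp only: shift_mult[symmetric] mult.commute)
    also have "\<dots> = shift 2 (shift ?\<beta> (\<lambda>(a, b, c). Th_op a * P_op b * F_op c) - shift ?\<alpha> (\<lambda>(a, b, c). Th_op b * P_op a * F_op c)
         + shift ?\<alpha> (\<lambda>(a, b, c). P_op a * Th_op b * F_op c) - shift ?\<beta> (\<lambda>(a, b, c). P_op b * Th_op a * F_op c)
         + shift 2 (\<lambda>(a, b, c). Th_op a * Th_op b * F_op c) - shift 2 (\<lambda>(a, b, c). Th_op b * Th_op a * F_op c)) + shift (?\<beta> * ?\<alpha>) ?D"
      unfolding xz yz xz' yz'
      by (simp only: shift.scale_left_commute[of ?\<beta> 2] shift.scale_left_commute[of ?\<alpha> 2] 2 shift_family_add yz xz'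
          shift.scale_right_diff_distrib) (simp add: algebra_simps)
    also have "\<dots> = shift (2 * ?\<beta>) ?A + shift (2 * ?\<alpha>) ?B + shift (2 * 2) ?C + shift (?\<beta> * ?\<alpha>) ?D"
    proof -
      have "?A = (\<lambda>(a, b, c). Th_op a * P_op b * F_op c) - (\<lambda>(a, b, c). P_op b * Th_op a * F_op c)"
        "?B = (\<lambda>(a, b, c). P_op a * Th_op b * F_op c) - (\<lambda>(a, b, c). Th_op b * P_op a * F_op c)"
        "?C = (\<lambda>(a, b, c). Th_op a * Th_op b * F_op c) - (\<lambda>(a, b, c). Th_op b * Th_op a * F_op c)"
        by (auto simp: fun_eq_iff algebra_simps)
      then show ?thesis
        by (simp only: shift_mult shift_family_add shift.scale_right_diff_distrib) (simp add: algebra_simps)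
    qed
    finally have eq: "shift (?\<beta> * ?\<alpha>) ?V = shift (2 * ?\<beta>) ?A + shift (2 * ?\<alpha>) ?B + shift (2 * 2) ?C + shift (?\<beta> * ?\<alpha>) ?D" .
    have comm: "Th_op a * P_op b - P_op b * Th_op a = scal s3 * (P_op a * P_op b - P_op b * P_op a)"
      "Th_op a * Th_op b - Th_op b * Th_op a = scal s3 * (scal s3 * (P_op a * P_op b - P_op b * P_op a))" for a b
      by (simp_all add: Th_op_def algebra_simps scal_left_commute[of "P_op _"] scal_commute[of "P_op _"] scal_assoc flip: scal_mult)
    have inD: "(P_op a * P_op b - P_op b * P_op a) * B \<in> null_at w" for a b B
      by (rule null_at_mult) (rule Cons.IH)
    have inA: "(Th_op a * P_op b - P_op b * Th_op a) * B \<in> null_at w" for a b B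
      by (subst comm) (auto intro!: null_at_mult scale Cons.IH)
    have inC: "(Th_op a * Th_op b - Th_op b * Th_op a) * B \<in> null_at w" for a b B
      by (subst comm) (auto intro!: null_at_mult scale Cons.IH)
    have inB: "(P_op a * Th_op b - Th_op b * P_op a) * B \<in> null_at w" for a b B
      using minus[OF inA[of b a B]] by (simp add: algebra_simps)
    have "shift (?\<beta> * ?\<alpha>) ?V t \<in> null_at w" for t
      unfolding eq plus_fun_apply by (intro add shift_closed) (auto simp: inA inB inC inD)
    then have "shift ?\<beta> (shift ?\<alpha> ?V) t \<in> null_at w" for t
      by (simp only: shift_mult)
    then have "shift ?\<alpha> ?V t \<in> null_at w" for t
      by (rule shift_unique_yz) (auto simp: shift_cub cubdiff_def zero)
    then have "?V (i, j, k) \<in> null_at w"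
      by (rule shift_unique_xz) (auto simp: zero)
    then show ?case by (simp add: null_at_Cons)
  qed
  then have "P_op i * P_op j - P_op j * P_op i = 0"
    by (subst eq_zero_iff_null) auto
  then show ?thesis by simp
qed

lemma Th_P_commute: "Th_op a * P_op b = P_op b * Th_op a"
  by (simp add: Th_op_def algebra_simps P_commute[of a b] scal_left_commute[of "P_op b"] scal_commute[of "P_op b"])

text \<open>Let \<open>R\<close> be the difference of the two sides. Moving \<open>f\<close> to the right, at the cost of the
  cubic for \<open>\<psi>\<close> and \<open>f\<close>, turns \<open>f R\<close> into combinations of \<open>R f\<close>. The terms with two \<open>\<psi>\<close> that
  \<open>[e, f]\<close> produces cancel because the \<open>\<psi>\<close> commute and the shifts of \<open>e\<close> and \<open>f\<close> agree on
  \<open>\<psi>\<^sub>b\<^sub>+\<^sub>c\<close>.\<close>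

lemma P_E: "cubdiff s2 s3 (\<lambda>i j. P_op i * E_op j - E_op j * P_op i) i j = 2 * (E_op j * Th_op i)"
proof -
  define R where "R i j = cubdiff s2 s3 (\<lambda>i j. P_op i * E_op j - E_op j * P_op i) i j - 2 * (E_op j * Th_op i)" for i j
  have R0: "R a b = 0" if "a < 3" for a b
    using that by (simp add: R_def cubdiff_def Th_op_def delta_zero)
  have "R i j \<in> null_at w" for i j w
  proof (induction w arbitrary: i j)
    case Nil
    interpret op_subspace "null_at []" by (rule null_at_subspace)
    have "E_op j * B \<in> null_at []" "P_op i * (E_op j * B) \<in> null_at []" "P_op i * E_op j \<in> null_at []" for i j B
      by (simp_all add: null_at_def coef_E coef_P psi_at.simps)
    then show ?case
      unfolding R_def by (intro diff cubdiff_closed numeral) auto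
  next
    case (Cons k w)
    interpret op_subspace "null_at w" by (rule null_at_subspace)
    let ?\<alpha> = "cub s2 s3 (vx - vz)" and ?\<beta> = "cub s2 s3 (vx - vy)"
    let ?V = "\<lambda>(a, b, c). F_op c * R a b"
    let ?Rf = "\<lambda>(a, b, c). R a b * F_op c"
    let ?W = "\<lambda>(a, b, c). E_op b * Th_op a * F_op c"
    let ?H = "\<lambda>(a, b, c). Th_op a * P_op (b + c + 8)"
    let ?S = "\<lambda>(a, b, c). (P_op a * E_op b - E_op b * P_op a) * F_op c"
    have FP: "cubdiff s2 s3 (\<lambda>i j. F_op j * P_op i - P_op i * F_op j) i j = 2 * (Th_op i * F_op j)" for i j
      using F.rel_left[of i j] by simp
    have FTh: "cubdiff s2 s3 (\<lambda>i j. F_op j * Th_op i - Th_op i * F_op j) i j = 2 * (scal s3 * (Th_op i * F_op j))" for i j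
    proof -
      have "F_op j * Th_op i - Th_op i * F_op j = scal s3 * (F_op j * P_op i - P_op i * F_op j) * 1" for i j
        using F.th_commutator[of i j] by (simp add: scal_minus algebra_simps)
      then show ?thesis
        by (simp only: cubdiff_sandwich FP) (simp add: two_left)
    qed
    have fpe: "shift ?\<alpha> (\<lambda>(a, b, c). (F_op c * P_op a - P_op a * F_op c) * E_op b) = shift 2 (\<lambda>(a, b, c). Th_op a * F_op c * E_op b)"
      using shift_sandwich(2)[of s2 s3, OF FP, of "\<lambda>_. 1" E_op]
      by (auto simp: fun_eq_iff mult.assoc)
    have efp: "shift ?\<alpha> (\<lambda>(a, b, c). E_op b * (F_op c * P_op a - P_op a * F_op c)) = shift 2 ?W"
      using shift_sandwich(2)[of s2 s3, OF FP, of E_op "\<lambda>_. 1"]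
      by (auto simp: fun_eq_iff mult.assoc two_left)
    have efth: "shift ?\<alpha> (\<lambda>(a, b, c). E_op b * (F_op c * Th_op a - Th_op a * F_op c)) = shift (2 * vc s3) ?W"
      using shift_sandwich(2)[of s2 s3, OF FTh, of E_op "\<lambda>_. 1"]
      by (auto simp: fun_eq_iff mult.assoc two_left shift_mult scal_left_commute[of "E_op _"])
    \<comment> \<open>\<open>\<psi>\<^sub>b\<^sub>+\<^sub>c\<close> depends on \<open>b + c\<close> only, so raising \<open>b\<close> or \<open>c\<close> is the same.\<close>
    have H: "shift ?\<alpha> ?H = shift ?\<beta> ?H"
    proof -
      have *: "(b + m + c :: nat) = b + (m + c)" "(b + (c + m) :: nat) = b + (m + c)" for b c m by auto
      show ?thesis
        by (auto simp: fun_eq_iff shift_cub cubdiff_def * add.commute add.left_commute)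
    qed
    have SR: "shift ?\<beta> ?S = ?Rf + shift 2 ?W"
      using cubdiff_sandwich[of s2 s3 1 "\<lambda>i j. P_op i * E_op j - E_op j * P_op i"]
      by (auto simp: fun_eq_iff shift_cub R_def algebra_simps)
    have V: "?V = shift ?\<beta> (\<lambda>(a, b, c). F_op c * (P_op a * E_op b - E_op b * P_op a)) - shift 2 (\<lambda>(a, b, c). F_op c * (E_op b * Th_op a))"
      using cubdiff_sandwich[of s2 s3 _ "\<lambda>i j. P_op i * E_op j - E_op j * P_op i" 1]
      by (auto simp: fun_eq_iff shift_cub R_def right_diff_distrib two_left)
    have fe: "F_op c * (E_op b * B) = E_op b * (F_op c * B) - P_op (b + c + 8) * B" for b c B
      using arg_cong[OF E_F[of b c], of "\<lambda>A. A * B"] by (simp add: distrib_right mult.assoc)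
    have fe': "F_op c * E_op b = E_op b * F_op c - P_op (b + c + 8)" for b c
      using fe[of c b 1] by simp
    have 1: "(\<lambda>(a, b, c). F_op c * (P_op a * E_op b - E_op b * P_op a)) =
         (\<lambda>(a, b, c). (F_op c * P_op a - P_op a * F_op c) * E_op b)
       - (\<lambda>(a, b, c). E_op b * (F_op c * P_op a - P_op a * F_op c)) + ?S"
      by (auto simp: fun_eq_iff algebra_simps fe fe' P_commute)
    have 2: "(\<lambda>(a, b, c). F_op c * (E_op b * Th_op a)) =
         (\<lambda>(a, b, c). E_op b * (F_op c * Th_op a - Th_op a * F_op c)) + ?W - ?H"
      by (auto simp: fun_eq_iff algebra_simps fe Th_P_commute)
    have 3: "(\<lambda>(a, b, c). Th_op a * F_op c * E_op b) = ?W + (\<lambda>(a, b, c). scal s3 * (P_op a * E_op b - E_op b * P_op a) * F_op c) - ?H"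
      by (auto simp: fun_eq_iff algebra_simps fe' Th_op_def scal_left_commute[of "E_op _"])
    have 4: "(\<lambda>(a, b, c). scal s3 * (P_op a * E_op b - E_op b * P_op a) * F_op c) = shift (vc s3) ?S"
      by (auto simp: fun_eq_iff mult.assoc)
    have "shift ?\<alpha> ?V = shift ?\<beta> (shift ?\<alpha> (\<lambda>(a, b, c). (F_op c * P_op a - P_op a * F_op c) * E_op b))
       - shift ?\<beta> (shift ?\<alpha> (\<lambda>(a, b, c). E_op b * (F_op c * P_op a - P_op a * F_op c))) + shift ?\<alpha> (shift ?\<beta> ?S)
       - shift 2 (shift ?\<alpha> (\<lambda>(a, b, c). E_op b * (F_op c * Th_op a - Th_op a * F_op c))) - shift 2 (shift ?\<alpha> ?W)
       + shift 2 (shift ?\<alpha> ?H)"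
      unfolding V 1 2 shift_family_add shift.scale_right_diff_distrib
      by (simp only: shift_mult[symmetric] mult.commute) (simp add: algebra_simps)
    also have "\<dots> = shift ?\<beta> (shift 2 (shift (vc s3) ?S)) + shift ?\<alpha> ?Rf + shift ?\<alpha> (shift 2 ?W)
       - shift 2 (shift (2 * vc s3) ?W) - shift 2 (shift ?\<alpha> ?W) - shift ?\<beta> (shift 2 ?H) + shift 2 (shift ?\<beta> ?H)"
      unfolding fpe efp efth 3 4 SR H
      by (simp only: shift_family_add shift.scale_right_diff_distrib) (simp add: algebra_simps)
    also have "\<dots> = shift (2 * vc s3) (shift ?\<beta> ?S) + shift ?\<alpha> ?Rf - shift (2 * (2 * vc s3)) ?W"
      by (simp only: shift_mult[symmetric] mult.commute mult.left_commute) (simp add: algebra_simps)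
    also have "\<dots> = shift (2 * vc s3) ?Rf + shift ?\<alpha> ?Rf"
      unfolding SR by (simp only: shift_family_add shift_mult[symmetric] mult.commute mult.left_commute) simp
    finally have eq: "shift ?\<alpha> ?V = shift (2 * vc s3) ?Rf + shift ?\<alpha> ?Rf" .
    have "shift ?\<alpha> ?V t \<in> null_at w" for t
      unfolding eq plus_fun_apply by (intro add shift_closed) (auto intro: null_at_mult Cons.IH)
    then have "?V (i, j, k) \<in> null_at w"
      by (rule shift_unique_xz) (auto simp: R0 zero)
    then show ?case by (simp add: null_at_Cons)
  qed
  then have "R i j = 0"
    by (subst eq_zero_iff_null) auto
  then show ?thesis by (simp add: R_def)
qed

sublocale E: current_pair s2 s3 P_op Th_op E_op delta F_op
  using P_E E_F by unfold_locales (simp_all add: Th_op_def delta_zero)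

sublocale F: current_pair s2 "- s3" "\<lambda>i. - P_op i" Th_op F_op delta E_op
  using E_F by unfold_locales (simp_all add: Th_op_def delta_zero add.commute)

text \<open>A function is determined by its value at the empty word and by its images under all \<open>f\<^sub>k\<close>.\<close>

lemma commuting_zero:
  assumes comm: "\<And>k. A * F_op k = F_op k * A" and nil: "A \<in> null_at []"
  shows "A = 0"
proof -
  have "A \<in> null_at w" for w
  proof (induction w)
    case (Cons k w)
    then show ?case
      by (subst null_at_Cons, subst comm[symmetric]) (rule null_at_mult)
  qed (rule nil)
  then show ?thesis by (subst eq_zero_iff_null) blast
qed

lemma E_null: "E_op j * B \<in> null_at []" "E_op j \<in> null_at []"
  by (simp_all add: null_at_def coef_E)

lemma E_quad: "E.quad i j = 0"
proof (rule commuting_zero)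
  interpret op_subspace "null_at []" by (rule null_at_subspace)
  show "E.quad i j \<in> null_at []"
    unfolding E.quad_def by (intro diff cubdiff_closed E_null)
qed (rule E.quad_commute)

lemma E_serre: "serre E_op i j l = 0"
proof (rule commuting_zero)
  show "serre E_op i j l * F_op k = F_op k * serre E_op i j l" for k
    using E.serre_commute[of "{0}" i j l k] by (simp add: E_quad op_subspace_def)
  interpret op_subspace "null_at []" by (rule null_at_subspace)
  show "serre E_op i j l \<in> null_at []"
    unfolding serre_def sym3_def commutator_def
    by (intro add diff) (simp_all add: left_diff_distrib right_diff_distrib mult.assoc diff E_null)
qed

section \<open>Grading by word length\<close>

lemma psi_at_support: "(\<And>u. length u = length w \<Longrightarrow> \<phi> u = 0) \<Longrightarrow> psi_at n \<phi> w = 0"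
proof (induction n \<phi> w rule: psi_at.induct)
  case (2 n \<phi> k w)
  show ?case
  proof (cases "n < 8")
    case False
    show ?thesis
      using 2 False by (simp add: psi_at.simps(2)[of n \<phi> k w])
  qed simp
qed (simp add: psi_at.simps)

lemma e_at_support: "(\<And>u. Suc (length u) = length w \<Longrightarrow> \<phi> u = 0) \<Longrightarrow> e_at j \<phi> w = 0"
proof (induction j \<phi> w rule: e_at.induct)
  case (2 j \<phi> k w)
  then show ?case by (simp add: psi_at_support)
qed simp

text \<open>The highest weight vector has degree \<open>0\<close> and each \<open>e\<^sub>j\<close> lowers the degree by \<open>1\<close>, so words of
  length \<open>n\<close> carry degree \<open>- n\<close>.\<close>

definition homogeneous :: "int \<Rightarrow> wordfun \<Rightarrow> bool" where
  "homogeneous d \<phi> \<longleftrightarrow> (\<forall>w. int (length w) \<noteq> - d \<longrightarrow> coef \<phi> w = 0)"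

lemma homogeneous_E: "homogeneous d \<phi> \<Longrightarrow> homogeneous (d - 1) (app (E_op j) \<phi>)"
  and homogeneous_F: "homogeneous d \<phi> \<Longrightarrow> homogeneous (d + 1) (app (F_op j) \<phi>)"
  and homogeneous_P: "homogeneous d \<phi> \<Longrightarrow> homogeneous d (app (P_op n) \<phi>)"
  by (auto simp: homogeneous_def coef_E coef_P intro!: e_at_support psi_at_support)

definition vac :: wordfun where
  "vac = Wordfun (\<lambda>w. if w = [] then 1 else 0)"

lemma coef_vac: "coef vac w = (if w = [] then 1 else 0)"
  by (simp add: vac_def Wordfun_inverse)

lemma F_vac: "app (F_op k) vac = 0"
  by (rule wordfun_eqI) (simp add: coef_vac)

lemma P_vac: "app (P_op (i + 8)) vac = fscale (p i) vac"
proof (rule wordfun_eqI)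
  fix w
  show "coef (app (P_op (i + 8)) vac) w = coef (fscale (p i) vac) w"
    by (cases "w = []") (auto simp: coef_P coef_vac psi_at.simps intro!: psi_at_support)
qed

end

section \<open>Scalars and words in the free algebra\<close>

lemma free_scalar_add: "free_scalar (c + d) = free_scalar c + free_scalar d"
  and free_scalar_mult: "free_scalar (c * d) = free_scalar c * free_scalar d"
  and free_scalar_minus: "free_scalar (- c) = - free_scalar c"
  and free_scalar_0 [simp]: "free_scalar 0 = 0"
  and free_scalar_1 [simp]: "free_scalar 1 = 1"
  by (simp_all add: free_scalar_def single_add mult_single single_uminus)

lemma free_scalar_numeral: "free_scalar (numeral n) = numeral n"
  by (induction n) (simp_all only: numeral.simps free_scalar_add free_scalar_1)

lemma free_scalar_commute: "a * free_scalar c = free_scalar c * (a :: 'a free_alg)"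
proof (rule additive_eq_on_single[where q = a])
  show "Poly_Mapping.single s d * free_scalar c = free_scalar c * Poly_Mapping.single s d" for s :: "'a free_monoid" and d
    by (simp add: free_scalar_def mult_single mult.commute)
qed (simp_all add: algebra_simps)

lemma free_scalar_left_commute: "a * (free_scalar c * b) = free_scalar c * (a * b :: 'a free_alg)"
  by (metis mult.assoc free_scalar_commute)

lemma single_word: "Poly_Mapping.single (Word xs) c = free_scalar c * prod_list (map free_gen xs)"
proof (induction xs)
  case Nil
  show ?case by (simp add: free_scalar_def zero_free_monoid_def)
next
  case (Cons x xs)
  have "Poly_Mapping.single (Word (x # xs)) c = free_gen x * Poly_Mapping.single (Word xs) c"
    by (simp add: free_gen_def mult_single plus_free_monoid_def)
  then show ?case by (simp add: Cons free_scalar_left_commute)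
qed

definition homog :: "int \<Rightarrow> yangian_gen free_alg \<Rightarrow> bool" where
  "homog k a \<longleftrightarrow> (\<forall>w \<in> Poly_Mapping.keys a. word_deg w = k)"

section \<open>Spanning by words in the generators e\<close>

text \<open>A left ideal of the free algebra whose quotient is a highest weight module, with just those
  relations that move \<open>\<psi>\<close> and \<open>f\<close> to the right past \<open>e\<close>. The quotient by such an ideal is spanned by
  words in the \<open>e\<^sub>j\<close>. The annihilator of \<open>vac\<close> is of this kind before the relations between the
  \<open>f\<^sub>k\<close> are known on the vacuum module, and so is the ideal of the Verma module.\<close>

locale hw_left_ideal =
  fixes h1 h2 h3 :: complex and p :: "nat \<Rightarrow> complex" and Z :: "yangian_gen free_alg set"
  assumes Z_add: "a \<in> Z \<Longrightarrow> b \<in> Z \<Longrightarrow> a + b \<in> Z"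
    and Z_mult: "b \<in> Z \<Longrightarrow> a * b \<in> Z"
    and Z_f: "f_gen k \<in> Z" and Z_psi: "psi_gen i - free_scalar (p i) \<in> Z"
    and Z_e_f: "(commutator (e_gen i) (f_gen j) - psi_gen (i + j)) * a \<in> Z"
    and Z_psi_e: "(cubic (sigma2 h1 h2 h3) psi_gen e_gen i j
          - free_scalar (sigma3 h1 h2 h3) * anticommutator (psi_gen i) (e_gen j)) * a \<in> Z"
    and Z_psi0_e: "commutator (psi_gen 0) (e_gen j) * a \<in> Z"
    and Z_psi1_e: "commutator (psi_gen 1) (e_gen j) * a \<in> Z"
    and Z_psi2_e: "(commutator (psi_gen 2) (e_gen j) - 2 * e_gen j) * a \<in> Z"
begin

inductive spanned :: "int \<Rightarrow> yangian_gen free_alg \<Rightarrow> bool" where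
  null: "a \<in> Z \<Longrightarrow> spanned d a"
| scalar: "spanned 0 (free_scalar c)"
| add: "spanned d a \<Longrightarrow> spanned d b \<Longrightarrow> spanned d (a + b)"
| e: "spanned d a \<Longrightarrow> d' = d - 1 \<Longrightarrow> spanned d' (e_gen j * a)"

lemma spanned_scale: "spanned d a \<Longrightarrow> spanned d (free_scalar c * a)"
proof (induction rule: spanned.induct)
  case (null a d)
  then show ?case by (intro spanned.null Z_mult)
next
  case (scalar c')
  show ?case using spanned.scalar[of "c * c'"] by (simp add: free_scalar_mult)
next
  case (add d a b)
  then show ?case by (simp add: distrib_left spanned.add)
next
  case (e d a d' j)
  then have "spanned d' (e_gen j * (free_scalar c * a))" by (intro spanned.e)
  then show ?case by (simp add: free_scalar_left_commute)
qed

lemma spanned_minus: "spanned d a \<Longrightarrow> spanned d (- a)"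
  using spanned_scale[of d a "-1"] by (simp add: free_scalar_minus)

lemma spanned_diff: "spanned d a \<Longrightarrow> spanned d b \<Longrightarrow> spanned d (a - b)"
  using spanned.add[of d a "- b"] spanned_minus[of d b] by simp

lemma spanned_numeral: "spanned d a \<Longrightarrow> spanned d (numeral n * a)"
  using spanned_scale[of d a "numeral n"] by (simp add: free_scalar_numeral)

lemma spanned_zero: "spanned d 0"
  using spanned.null[OF Z_mult[OF Z_f, of 0]] by simp

lemma spanned_sum: "(\<And>i. i \<in> I \<Longrightarrow> spanned d (g i)) \<Longrightarrow> spanned d (sum g I)"
  by (induction I rule: infinite_finite_induct) (auto intro: spanned.add spanned_zero)

lemmas spanned_closed = spanned.add spanned_diff spanned_scale spanned_numeral

text \<open>The exchange relation expresses \<open>\<psi>\<^sub>i\<^sub>+\<^sub>3 e\<^sub>j\<close> by products \<open>e \<psi>\<close> and by \<open>\<psi>\<close> of lower index to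
  the left of an \<open>e\<close>.\<close>

lemma spanned_psi_e:
  assumes a: "spanned d a" and psi: "\<And>i. spanned d (psi_gen i * a)"
  shows "spanned (d - 1) (psi_gen i * (e_gen j * a))"
proof (induction i arbitrary: j rule: less_induct)
  case (less i)
  have e: "spanned (d - 1) (e_gen j * a)" "spanned (d - 1) (e_gen j * (psi_gen m * a))" for j m
    by (rule spanned.e[OF a] spanned.e[OF psi]; simp)+
  consider "i = 0" | "i = 1" | "i = 2" | m where "i = m + 3"
  proof (cases "i < 3")
    case True
    then have "i = 0 \<or> i = 1 \<or> i = 2" by auto
    then show ?thesis using that by blast
  next
    case False
    then show ?thesis using that(4)[of "i - 3"] by simp
  qed
  then show ?case
  proof cases
    case 1
    have "psi_gen i * (e_gen j * a) = commutator (psi_gen 0) (e_gen j) * a + e_gen j * (psi_gen 0 * a)"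
      by (simp add: 1 commutator_def algebra_simps)
    then show ?thesis by (simp only:) (intro spanned.add e spanned.null[OF Z_psi0_e])
  next
    case 2
    have "psi_gen i * (e_gen j * a) = commutator (psi_gen 1) (e_gen j) * a + e_gen j * (psi_gen 1 * a)"
      by (simp add: 2 commutator_def algebra_simps)
    then show ?thesis by (simp only:) (intro spanned.add e spanned.null[OF Z_psi1_e])
  next
    case 3
    have "psi_gen i * (e_gen j * a) = (commutator (psi_gen 2) (e_gen j) - 2 * e_gen j) * a
        + e_gen j * (psi_gen 2 * a) + 2 * (e_gen j * a)"
      by (simp add: 3 commutator_def algebra_simps)
    then show ?thesis by (simp only:) (intro spanned_closed e spanned.null[OF Z_psi2_e])
  next
    case (4 m)
    have "psi_gen i * (e_gen j * a) = (cubic (sigma2 h1 h2 h3) psi_gen e_gen m j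
          - free_scalar (sigma3 h1 h2 h3) * anticommutator (psi_gen m) (e_gen j)) * a
        + e_gen j * (psi_gen (m + 3) * a)
        + 3 * (psi_gen (m + 2) * (e_gen (j + 1) * a) - e_gen (j + 1) * (psi_gen (m + 2) * a))
        - 3 * (psi_gen (m + 1) * (e_gen (j + 2) * a) - e_gen (j + 2) * (psi_gen (m + 1) * a))
        + (psi_gen m * (e_gen (j + 3) * a) - e_gen (j + 3) * (psi_gen m * a))
        - free_scalar (sigma2 h1 h2 h3) * (psi_gen (m + 1) * (e_gen j * a) - e_gen j * (psi_gen (m + 1) * a))
        + free_scalar (sigma2 h1 h2 h3) * (psi_gen m * (e_gen (j + 1) * a) - e_gen (j + 1) * (psi_gen m * a))
        + free_scalar (sigma3 h1 h2 h3) * (psi_gen m * (e_gen j * a) + e_gen j * (psi_gen m * a))"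
      by (simp add: 4 cubic_def commutator_def anticommutator_def algebra_simps)
    also have "spanned (d - 1) \<dots>"
      by (intro spanned_closed e spanned.null[OF Z_psi_e] less.IH) (simp_all add: 4)
    finally show ?thesis .
  qed
qed

lemma spanned_psi: "spanned d a \<Longrightarrow> spanned d (psi_gen i * a)"
proof (induction arbitrary: i rule: spanned.induct)
  case (null a d)
  then show ?case by (intro spanned.null Z_mult)
next
  case (scalar c)
  have "psi_gen i * free_scalar c = free_scalar c * (psi_gen i - free_scalar (p i)) + free_scalar (c * p i)"
    by (simp add: free_scalar_commute[of "psi_gen i"] free_scalar_mult right_diff_distrib)
  then show ?case
    by (simp only:) (intro spanned.add spanned.scalar spanned.null Z_mult Z_psi)
next
  case (add d a b)
  then show ?case by (simp add: distrib_left spanned.add)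
next
  case (e d a d' j)
  then show ?case using spanned_psi_e by blast
qed

lemma spanned_f: "spanned d a \<Longrightarrow> spanned (d + 1) (f_gen k * a)"
proof (induction rule: spanned.induct)
  case (null a d)
  then show ?case by (intro spanned.null Z_mult)
next
  case (scalar c)
  have "f_gen k * free_scalar c = free_scalar c * f_gen k"
    by (rule free_scalar_commute)
  then show ?case by (simp only:) (intro spanned.null Z_mult Z_f)
next
  case (add d a b)
  then show ?case by (simp add: distrib_left spanned.add)
next
  case (e d a d' j)
  have "f_gen k * (e_gen j * a) = e_gen j * (f_gen k * a) - psi_gen (j + k) * a
      - (commutator (e_gen j) (f_gen k) - psi_gen (j + k)) * a"
    by (simp add: commutator_def algebra_simps)
  moreover have "spanned (d' + 1) (e_gen j * (f_gen k * a))"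
    using spanned.e[OF e.IH, of "d' + 1"] e.hyps by simp
  moreover have "spanned (d' + 1) (psi_gen (j + k) * a)"
    using spanned_psi[OF e.hyps(1)] e.hyps by simp
  ultimately show ?case
    using spanned.null[OF Z_e_f] by (simp only:) (intro spanned_diff)
qed

lemma spanned_word: "spanned (word_deg (Word xs)) (prod_list (map free_gen xs))"
proof (induction xs)
  case Nil
  show ?case using spanned.scalar[of 1] by (simp add: word_deg_def)
next
  case (Cons x xs)
  show ?case
  proof (cases x)
    case (E j)
    show ?thesis using spanned.e[OF Cons, of "word_deg (Word (x # xs))"] by (simp add: E word_deg_def)
  next
    case (F j)
    show ?thesis using spanned_f[OF Cons] by (simp add: F word_deg_def add.commute)
  next
    case (Psi j)
    show ?thesis using spanned_psi[OF Cons] by (simp add: Psi word_deg_def)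
  qed
qed

lemma spanned_homog: "homog k a \<Longrightarrow> spanned k a"
proof -
  assume a: "homog k a"
  have "spanned k (Poly_Mapping.single w (Poly_Mapping.lookup a w))" if "w \<in> Poly_Mapping.keys a" for w
  proof -
    have "word_deg w = k" using that a by (simp add: homog_def)
    moreover obtain xs where "w = Word xs" by (cases w)
    ultimately show ?thesis using spanned_scale[OF spanned_word[of xs]] by (simp add: single_word)
  qed
  then have "spanned k (\<Sum>w\<in>Poly_Mapping.keys a. Poly_Mapping.single w (Poly_Mapping.lookup a w))"
    by (rule spanned_sum)
  then show ?thesis by (simp add: sum_singles)
qed

text \<open>Modulo \<open>Z\<close>, there is nothing in positive degree and only scalars in degree zero.\<close>

lemma spanned_nonneg:
  "spanned d a \<Longrightarrow> (d > 0 \<longrightarrow> a \<in> Z) \<and> (d = 0 \<longrightarrow> (\<exists>c. a - free_scalar c \<in> Z))"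
proof (induction rule: spanned.induct)
  case (null a d)
  then show ?case by (auto intro: exI[of _ 0])
next
  case (scalar c)
  have "0 \<in> Z" using Z_mult[OF Z_f, of 0] by simp
  then show ?case by (auto intro: exI[of _ c])
next
  case (add d a b)
  moreover have "a + b - free_scalar (c + c') \<in> Z" if "a - free_scalar c \<in> Z" "b - free_scalar c' \<in> Z" for c c'
    using Z_add[OF that] by (simp add: free_scalar_add algebra_simps)
  ultimately show ?case by (auto intro: Z_add)
next
  case (e d a d' j)
  show ?case
  proof (intro conjI impI)
    assume "d' > 0"
    then show "e_gen j * a \<in> Z" using e by (intro Z_mult) simp
  next
    assume "d' = 0"
    then have "e_gen j * a \<in> Z" using e by (intro Z_mult) simp
    then show "\<exists>c. e_gen j * a - free_scalar c \<in> Z" by (intro exI[of _ 0]) simp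
  qed
qed

end

section \<open>The representation of the free algebra\<close>

context dual_model
begin

fun gen_op :: "yangian_gen \<Rightarrow> endo" where
  "gen_op (E j) = E_op j"
| "gen_op (F j) = F_op j"
| "gen_op (Psi j) = P_op (j + 8)"

definition rho :: "yangian_gen free_alg \<Rightarrow> endo" where
  "rho = lin_ext (\<lambda>w. prod_list (map gen_op (letters w)))"

lemma rho_add: "rho (a + b) = rho a + rho b"
  by (simp add: rho_def lin_ext_add)

lemma rho_mult: "rho (a * b) = rho a * rho b"
  unfolding rho_def by (rule lin_ext_mult) (simp add: plus_free_monoid_def)

lemma rho_scalar [simp]: "rho (free_scalar c) = scal c"
  by (simp add: rho_def free_scalar_def lin_ext_single zero_free_monoid_def)

lemma rho_gen [simp]: "rho (free_gen x) = gen_op x"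
  by (simp add: rho_def free_gen_def lin_ext_single)

lemma rho_0 [simp]: "rho 0 = 0" and rho_1 [simp]: "rho 1 = 1"
  using rho_scalar[of 0] rho_scalar[of 1] by simp_all

lemma rho_minus: "rho (- a) = - rho a"
  using rho_add[of a "- a"] by (simp add: minus_unique)

lemma rho_diff: "rho (a - b) = rho a - rho b"
  using rho_add[of a "- b"] by (simp add: rho_minus)

lemma rho_sum: "rho (sum g I) = (\<Sum>i\<in>I. rho (g i))"
  by (induction I rule: infinite_finite_induct) (auto simp: rho_add)

lemma rho_numeral: "rho (numeral n) = numeral n"
  using rho_scalar[of "numeral n"] by (simp add: free_scalar_numeral scal_numeral)

lemmas rho_simps = rho_add rho_mult rho_minus rho_diff rho_numeral

lemma rho_commutator: "rho (commutator a b) = rho a * rho b - rho b * rho a"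
  by (simp add: commutator_def rho_simps)

lemma rho_serre: "rho (serre x i j k) = serre (\<lambda>n. rho (x n)) i j k"
  by (simp add: serre_def sym3_def commutator_def rho_simps)

lemma rho_cubic:
  "rho (cubic s x y i j - free_scalar t * anticommutator (x i) (y j))
   = cubdiff s t (\<lambda>i j. rho (x i) * rho (y j) - rho (y j) * rho (x i)) i j - 2 * (scal t * (rho (y j) * rho (x i)))"
  by (simp add: cubic_def cubdiff_def rho_simps commutator_def anticommutator_def algebra_simps mult_2)

lemma rho_psi_psi: "rho (commutator (psi_gen i) (psi_gen j)) = 0"
  by (simp add: rho_commutator P_commute)

lemma rho_e_f: "rho (commutator (e_gen i) (f_gen j) - psi_gen (i + j)) = 0"
  by (simp add: rho_commutator rho_diff E_F)

lemma cubdiff_offset: "cubdiff s t u (i + 8) j = cubdiff s t (\<lambda>i j. u (i + 8) j) i j"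
  by (simp add: cubdiff_def)

lemma rho_psi_e: "rho (cubic s2 psi_gen e_gen i j - free_scalar s3 * anticommutator (psi_gen i) (e_gen j)) = 0"
  using P_E[of "i + 8" j]
  by (simp add: rho_cubic[of s2 psi_gen e_gen i j s3] cubdiff_offset Th_op_def delta_zero scal_left_commute[of "E_op j"])

lemma rho_psi_f: "rho (cubic s2 psi_gen f_gen i j - (- (free_scalar s3 * anticommutator (psi_gen i) (f_gen j)))) = 0"
proof -
  have *: "rho (cubic s2 psi_gen f_gen i j - (- (free_scalar s3 * anticommutator (psi_gen i) (f_gen j))))
    = - (cubdiff s2 (- s3) (\<lambda>i j. (- P_op i) * F_op j - F_op j * (- P_op i)) (i + 8) j - 2 * (F_op j * Th_op (i + 8)))"
    by (simp add: cubic_def cubdiff_def rho_simps commutator_def anticommutator_def algebra_simps mult_2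
      Th_op_def delta_zero scal_left_commute[of "F_op j"] scal_minus)
  show ?thesis unfolding * by (simp only: P_F) simp
qed

lemma rho_psi012:
  shows "rho (commutator (psi_gen 0) (e_gen j)) = 0" and "rho (commutator (psi_gen 1) (e_gen j)) = 0"
    and "rho (commutator (psi_gen 2) (e_gen j) - 2 * e_gen j) = 0"
    and "rho (commutator (psi_gen 0) (f_gen j)) = 0" and "rho (commutator (psi_gen 1) (f_gen j)) = 0"
    and "rho (commutator (psi_gen 2) (f_gen j) - (- (2 * f_gen j))) = 0"
proof -
  have 0: "P_op 8 * E_op j = E_op j * P_op 8" for j
    using P_E[of 5 j] by (simp add: cubdiff_def Th_op_def delta_def)
  have 1: "P_op 9 * E_op j = E_op j * P_op 9" for j
    using P_E[of 6 j] by (simp add: cubdiff_def Th_op_def delta_def 0)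
  have 2: "P_op 10 * E_op j - E_op j * P_op 10 = 2 * E_op j" for j
    using P_E[of 7 j] by (simp add: cubdiff_def Th_op_def delta_def 0 1)
  have 3: "P_op 8 * F_op j = F_op j * P_op 8" for j
    using P_F[of 5 j] by (simp add: cubdiff_def Th_op_def delta_def algebra_simps)
  have 4: "P_op 9 * F_op j = F_op j * P_op 9" for j
    using P_F[of 6 j] by (simp add: cubdiff_def Th_op_def delta_def 3 algebra_simps)
  have 5: "F_op j * P_op 10 - P_op 10 * F_op j = 2 * F_op j" for j
    using P_F[of 7 j] by (simp add: cubdiff_def Th_op_def delta_def 3 4)
  show "rho (commutator (psi_gen 0) (e_gen j)) = 0" "rho (commutator (psi_gen 1) (e_gen j)) = 0"
     "rho (commutator (psi_gen 2) (e_gen j) - 2 * e_gen j) = 0"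
     "rho (commutator (psi_gen 0) (f_gen j)) = 0" "rho (commutator (psi_gen 1) (f_gen j)) = 0"
     "rho (commutator (psi_gen 2) (f_gen j) - (- (2 * f_gen j))) = 0"
    using 0[of j] 1[of j] 2[of j] 3[of j] 4[of j] 5[of j] by (simp_all add: rho_commutator rho_simps algebra_simps)
qed

lemma rho_e_e: "rho (cubic s2 e_gen e_gen i j - free_scalar s3 * anticommutator (e_gen i) (e_gen j)) = 0"
proof -
  have "rho (cubic s2 e_gen e_gen i j - free_scalar s3 * anticommutator (e_gen i) (e_gen j)) = E.quad i j"
    by (simp add: rho_cubic[of s2 e_gen e_gen i j s3] E.quad_def cubdiff_swap_sign cubdiff_diff)
  then show ?thesis by (simp add: E_quad)
qed

lemma rho_f_f: "rho (cubic s2 f_gen f_gen i j - (- (free_scalar s3 * anticommutator (f_gen i) (f_gen j)))) = F.quad i j"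
  by (simp add: cubic_def cubdiff_def rho_simps commutator_def anticommutator_def algebra_simps mult_2
      F.quad_def scal_minus)

lemma rho_serre_e: "rho (serre e_gen i j k) = 0"
  by (simp add: rho_serre E_serre)

section \<open>All defining relations on the vacuum module\<close>

definition vac_null :: "endo set" where
  "vac_null = {A. \<forall>a. app A (app (rho a) vac) = 0}"

lemma vac_null_subspace: "op_subspace vac_null"
  by unfold_locales (auto simp: vac_null_def)

lemma vac_null_rho: "A \<in> vac_null \<Longrightarrow> A * rho b \<in> vac_null"
proof -
  assume "A \<in> vac_null"
  then have "app A (app (rho (b * a)) vac) = 0" for a unfolding vac_null_def by blast
  then show ?thesis by (simp add: vac_null_def rho_mult)
qed

lemma vac_null_left: "A \<in> vac_null \<Longrightarrow> B * A \<in> vac_null"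
  by (auto simp: vac_null_def)

lemma vac_null_Th: "A \<in> vac_null \<Longrightarrow> A * Th_op n \<in> vac_null"
proof -
  have "Th_op n = rho (free_scalar s3 * (if n < 8 then 0 else psi_gen (n - 8)) + free_scalar (delta n))"
    by (simp add: Th_op_def rho_simps)
  then show "A \<in> vac_null \<Longrightarrow> ?thesis" by (simp only: vac_null_rho)
qed

end

locale yangian_model =
  fixes h1 h2 h3 :: complex and p :: "nat \<Rightarrow> complex"
begin

sublocale dual_model "sigma2 h1 h2 h3" "sigma3 h1 h2 h3" p .

definition vac_ann :: "yangian_gen free_alg set" where
  "vac_ann = {a. app (rho a) vac = 0}"

lemma vac_ann_ideal: "hw_left_ideal h1 h2 h3 p vac_ann"
proof
  show "psi_gen i - free_scalar (p i) \<in> vac_ann" for i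
    by (simp add: vac_ann_def rho_simps P_vac)
  show "f_gen k \<in> vac_ann" for k
    by (simp add: vac_ann_def F_vac)
qed (auto simp: vac_ann_def rho_add rho_mult rho_e_f rho_psi_e rho_psi012 rho_psi012(2)[unfolded One_nat_def])

sublocale ann: hw_left_ideal h1 h2 h3 p vac_ann
  by (rule vac_ann_ideal)

text \<open>The module is spanned by words in the \<open>e\<^sub>j\<close> applied to \<open>vac\<close>; the commutators with \<open>e\<^sub>j\<close> only
  have to vanish on the module itself.\<close>

lemma vac_nullI:
  assumes comm: "\<And>j. A * E_op j - E_op j * A \<in> vac_null" and vac: "app A vac = 0"
  shows "A \<in> vac_null"
proof -
  have sp: "app A (app (rho a) vac) = 0" if "ann.spanned d a" for d a
    using that
  proof (induction rule: ann.spanned.induct)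
    case (null a d)
    then show ?case by (simp add: vac_ann_def)
  next
    case (scalar c)
    show ?case by (simp add: app_fscale vac)
  next
    case (add d a b)
    then show ?case by (simp add: rho_add app_add)
  next
    case (e d a d' j)
    have "app (A * E_op j - E_op j * A) (app (rho a) vac) = 0"
      using comm[of j] unfolding vac_null_def by blast
    then show ?case by (simp add: rho_mult e.IH)
  qed
  have "app A (app (rho a) vac) = 0" for a
  proof -
    have "app A (app (rho (Poly_Mapping.single w c)) vac) = 0" for w c
      using sp[OF ann.spanned_scale[OF ann.spanned_word[of "letters w"]], of c]
      by (simp flip: single_word)
    then have "app A (app (rho (\<Sum>w\<in>Poly_Mapping.keys a. Poly_Mapping.single w (Poly_Mapping.lookup a w))) vac) = 0"
      by (simp add: rho_sum app_sum app_sum_left)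
    then show ?thesis by (simp add: sum_singles)
  qed
  then show ?thesis by (simp add: vac_null_def)
qed

text \<open>The symmetry between \<open>e\<close> and \<open>f\<close> makes this the counterpart of \<open>quad_commute\<close>, with \<open>vac\<close> in
  place of the empty word.\<close>

lemma F_quad: "F.quad i j \<in> vac_null"
proof (rule vac_nullI)
  show "F.quad i j * E_op k - E_op k * F.quad i j \<in> vac_null" for k
    by (simp add: F.quad_commute vac_null_def)
  have "app (cubdiff s t (\<lambda>i j. F_op i * F_op j) i j) vac = 0" "app (cubdiff s t (\<lambda>i j. F_op j * F_op i) i j) vac = 0" for s t
    by (simp_all add: cubdiff_def F_vac)
  then show "app (F.quad i j) vac = 0"
    by (simp add: F.quad_def)
qed

lemma F_serre: "serre F_op i j l \<in> vac_null"
proof (rule vac_nullI)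
  show "serre F_op i j l * E_op k - E_op k * serre F_op i j l \<in> vac_null" for k
    by (intro F.serre_commute vac_null_subspace vac_null_Th F_quad)
  show "app (serre F_op i j l) vac = 0"
    by (simp add: serre_def sym3_def commutator_def F_vac)
qed

lemma rels_null:
  assumes "r \<in> yangian_rels h1 h2 h3"
  shows "rho r \<in> vac_null"
proof -
  have 0: "0 \<in> vac_null" by (simp add: vac_null_def)
  from assms show ?thesis
  proof cases
    case (serre_f i j k)
    then show ?thesis using F_serre[of i j k] by (simp add: rho_serre)
  next
    case (f_f i j)
    then show ?thesis by (simp only: rho_f_f F_quad)
  qed (simp_all only: rho_psi_psi rho_e_f rho_e_e rho_psi_e rho_psi_f rho_psi012 rho_serre_e 0)
qed

section \<open>Generation of the vacuum module by each of its vectors\<close>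

lemma homogeneous_word: "homogeneous (word_deg (Word xs)) (app (prod_list (map gen_op xs)) vac)"
proof (induction xs)
  case Nil
  show ?case by (simp add: homogeneous_def word_deg_def coef_vac)
next
  case (Cons x xs)
  then show ?case
    using homogeneous_E[OF Cons] homogeneous_F[OF Cons] homogeneous_P[OF Cons]
    by (cases x) (auto simp: word_deg_def algebra_simps)
qed

lemma homogeneous_rho:
  assumes "homog k a"
  shows "homogeneous k (app (rho a) vac)"
proof -
  have "coef (app (rho a) vac) w = 0" if "int (length w) \<noteq> - k" for w
  proof -
    have "coef (app (prod_list (map gen_op (letters u))) vac) w = 0" if "u \<in> Poly_Mapping.keys a" for u
      using homogeneous_word[of "letters u"] assms that \<open>int (length w) \<noteq> - k\<close>
      by (simp add: homogeneous_def homog_def)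
    then show ?thesis by (simp add: rho_def lin_ext_def app_sum_left coef_sum)
  qed
  then show ?thesis by (simp add: homogeneous_def)
qed

lemma bounded_support: "\<exists>n. \<forall>w. length w > n \<longrightarrow> coef (app (rho a) vac) w = 0"
proof -
  define n where "n = Max (insert 0 ((\<lambda>u. nat (- word_deg u)) ` Poly_Mapping.keys a))"
  have "coef (app (rho a) vac) w = 0" if w: "length w > n" for w
  proof -
    have "coef (app (prod_list (map gen_op (letters u))) vac) w = 0" if "u \<in> Poly_Mapping.keys a" for u
    proof -
      have "nat (- word_deg u) \<le> n" unfolding n_def using that by (intro Max_ge) auto
      then have "int (length w) \<noteq> - word_deg u" using w by auto
      then show ?thesis using homogeneous_word[of "letters u"] by (simp add: homogeneous_def)
    qed
    then show ?thesis by (simp add: rho_def lin_ext_def app_sum_left coef_sum)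
  qed
  then show ?thesis by blast
qed

lemma coef_F_word: "coef (app (rho (prod_list (map f_gen (rev w)))) \<phi>) u = coef \<phi> (w @ u)"
proof (induction w arbitrary: \<phi>)
  case (Cons k w)
  have "rho (prod_list (map f_gen (rev (k # w)))) = rho (prod_list (map f_gen (rev w))) * F_op k"
    by (simp add: rho_mult)
  then show ?case by (simp add: Cons)
qed simp

text \<open>Take a longest word \<open>w\<close> in the support. Removing its letters by operators \<open>f\<^sub>k\<close> leaves a
  function supported at the empty word only, whose value there is the value at \<open>w\<close>.\<close>

lemma vac_generated:
  assumes "a \<notin> vac_ann"
  obtains b where "b * a - 1 \<in> vac_ann"
proof -
  let ?\<phi> = "app (rho a) vac"
  obtain n where n: "\<And>w. length w > n \<Longrightarrow> coef ?\<phi> w = 0"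
    using bounded_support by blast
  obtain w0 where "coef ?\<phi> w0 \<noteq> 0"
    using assms wordfun_eqI[of ?\<phi> 0] by (auto simp: vac_ann_def)
  then have "\<exists>w. coef ?\<phi> w \<noteq> 0 \<and> (\<forall>u. length u > length w \<longrightarrow> coef ?\<phi> u = 0)"
  proof (induction "n - length w0" arbitrary: w0 rule: less_induct)
    case less
    show ?case
    proof (cases "\<forall>u. length u > length w0 \<longrightarrow> coef ?\<phi> u = 0")
      case False
      then obtain u where u: "length u > length w0" "coef ?\<phi> u \<noteq> 0" by blast
      then have "length u \<le> n" using n by (meson not_less)
      with u show ?thesis by (intro less.hyps[of u]) auto
    qed (use less.prems in blast)
  qed
  then obtain w where w: "coef ?\<phi> w \<noteq> 0" "\<And>u. length u > length w \<Longrightarrow> coef ?\<phi> u = 0" by blast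
  let ?b = "free_scalar (1 / coef ?\<phi> w) * prod_list (map f_gen (rev w))"
  have "app (rho (?b * a)) vac = vac"
    by (rule wordfun_eqI) (use w in \<open>auto simp: rho_mult coef_F_word coef_vac\<close>)
  then have "?b * a - 1 \<in> vac_ann" by (simp add: vac_ann_def rho_diff)
  then show ?thesis by (rule that)
qed

lemma one_notin_ann: "1 \<notin> vac_ann"
proof
  assume "1 \<in> vac_ann"
  then have "coef vac [] = 0" by (simp add: vac_ann_def)
  then show False by (simp add: coef_vac)
qed

end

section \<open>Quotients of left modules\<close>

context left_module
begin

lemma submodule_abelian_subgroup:
  assumes "submodule N R M"
  shows "abelian_subgroup N M"
  using assms by (intro abelian_subgroupI3 additive_subgroupI) (auto simp: submodule_def M.abelian_group_axioms)

lemma submodule_subset: "submodule N R M \<Longrightarrow> N \<subseteq> carrier M"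
  by (drule submodule.axioms(1), drule subgroup.subset) simp

context
  fixes N assumes N: "submodule N R M"
begin

interpretation N: abelian_subgroup N M
  by (rule submodule_abelian_subgroup) (rule N)

lemma quot_carrier: "C \<in> carrier (quot_module M N) \<longleftrightarrow> (\<exists>x\<in>carrier M. C = N +>\<^bsub>M\<^esub> x)"
  by (auto simp: quot_module_def A_RCOSETS_defs a_r_coset_defs)

lemma quot_zero: "\<zero>\<^bsub>quot_module M N\<^esub> = N"
  by (simp add: quot_module_def)

lemma quot_add:
  "x \<in> carrier M \<Longrightarrow> y \<in> carrier M \<Longrightarrow>
   (N +>\<^bsub>M\<^esub> x) \<oplus>\<^bsub>quot_module M N\<^esub> (N +>\<^bsub>M\<^esub> y) = N +>\<^bsub>M\<^esub> (x \<oplus>\<^bsub>M\<^esub> y)"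
  by (simp add: quot_module_def N.a_rcos_sum)

lemma coset_eq_zero: "x \<in> carrier M \<Longrightarrow> N +>\<^bsub>M\<^esub> x = N \<longleftrightarrow> x \<in> N"
  using N.a_rcos_self N.a_rcos_const by blast

lemma coset_of_diff:
  assumes "h \<in> N" "x \<in> carrier M"
  shows "N +>\<^bsub>M\<^esub> (h \<oplus>\<^bsub>M\<^esub> x) = N +>\<^bsub>M\<^esub> x"
proof -
  have "h \<oplus>\<^bsub>M\<^esub> x \<in> N +>\<^bsub>M\<^esub> x"
    using assms by (auto simp: a_r_coset_def')
  then show ?thesis using N.a_repr_independence' assms by blast
qed

lemma quot_smult:
  assumes a: "a \<in> carrier R" and x: "x \<in> carrier M"
  shows "a \<odot>\<^bsub>quot_module M N\<^esub> (N +>\<^bsub>M\<^esub> x) = N +>\<^bsub>M\<^esub> (a \<odot>\<^bsub>M\<^esub> x)"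
proof -
  have const: "N +>\<^bsub>M\<^esub> (a \<odot>\<^bsub>M\<^esub> y) = N +>\<^bsub>M\<^esub> (a \<odot>\<^bsub>M\<^esub> x)" if "y \<in> N +>\<^bsub>M\<^esub> x" for y
  proof -
    from that obtain h where h: "h \<in> N" "y = h \<oplus>\<^bsub>M\<^esub> x" by (auto simp: a_r_coset_def')
    have "h \<in> carrier M" using h(1) N.a_subset by blast
    then have "a \<odot>\<^bsub>M\<^esub> y = a \<odot>\<^bsub>M\<^esub> h \<oplus>\<^bsub>M\<^esub> a \<odot>\<^bsub>M\<^esub> x"
      by (simp add: h smult_r_distr a x)
    moreover have "a \<odot>\<^bsub>M\<^esub> h \<in> N" using submodule.smult_closed[OF N a h(1)] .
    ultimately show ?thesis by (simp add: coset_of_diff smult_closed a x)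
  qed
  have self: "x \<in> N +>\<^bsub>M\<^esub> x" by (rule N.a_rcos_self) (rule x)
  have "a \<odot>\<^bsub>quot_module M N\<^esub> (N +>\<^bsub>M\<^esub> x) = (\<Union>y\<in>N +>\<^bsub>M\<^esub> x. N +>\<^bsub>M\<^esub> (a \<odot>\<^bsub>M\<^esub> y))"
    by (simp add: quot_module_def)
  also have "\<dots> = (\<Union>y\<in>N +>\<^bsub>M\<^esub> x. N +>\<^bsub>M\<^esub> (a \<odot>\<^bsub>M\<^esub> x))"
    by (rule SUP_cong) (simp_all only: const)
  also have "\<dots> = N +>\<^bsub>M\<^esub> (a \<odot>\<^bsub>M\<^esub> x)"
    using self by (intro UN_constant_eq) auto
  finally show ?thesis .
qed

lemma quot_left_module: "left_module R (quot_module M N)"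
proof -
  let ?Q = "quot_module M N"
  have zero: "\<zero>\<^bsub>?Q\<^esub> = N +>\<^bsub>M\<^esub> \<zero>\<^bsub>M\<^esub>"
    by (metis M.zero_closed N.zero_closed coset_eq_zero quot_zero)
  have ag: "abelian_group ?Q"
  proof (rule abelian_groupI)
    show "\<exists>y\<in>carrier ?Q. y \<oplus>\<^bsub>?Q\<^esub> x = \<zero>\<^bsub>?Q\<^esub>" if "x \<in> carrier ?Q" for x
    proof -
      from that obtain u where u: "u \<in> carrier M" "x = N +>\<^bsub>M\<^esub> u" by (auto simp: quot_carrier)
      then show ?thesis
        by (intro bexI[of _ "N +>\<^bsub>M\<^esub> (\<ominus>\<^bsub>M\<^esub> u)"]) (auto simp: quot_add quot_carrier zero M.l_neg)
    qed
  qed (auto simp: quot_carrier quot_add zero M.a_ac)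
  show ?thesis
  proof (intro left_module.intro left_module_axioms.intro ag R.ring_axioms)
    show "a \<odot>\<^bsub>?Q\<^esub> x \<in> carrier ?Q" if "a \<in> carrier R" "x \<in> carrier ?Q" for a x
      using that by (auto simp: quot_carrier quot_smult intro: smult_closed)
    show "(a \<oplus> b) \<odot>\<^bsub>?Q\<^esub> x = a \<odot>\<^bsub>?Q\<^esub> x \<oplus>\<^bsub>?Q\<^esub> b \<odot>\<^bsub>?Q\<^esub> x"
      if "a \<in> carrier R" "b \<in> carrier R" "x \<in> carrier ?Q" for a b x
      using that by (auto simp: quot_carrier quot_smult quot_add smult_closed smult_l_distr)
    show "a \<odot>\<^bsub>?Q\<^esub> (x \<oplus>\<^bsub>?Q\<^esub> y) = a \<odot>\<^bsub>?Q\<^esub> x \<oplus>\<^bsub>?Q\<^esub> a \<odot>\<^bsub>?Q\<^esub> y"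
      if "a \<in> carrier R" "x \<in> carrier ?Q" "y \<in> carrier ?Q" for a x y
      using that by (auto simp: quot_carrier quot_smult quot_add smult_closed smult_r_distr)
    show "(a \<otimes> b) \<odot>\<^bsub>?Q\<^esub> x = a \<odot>\<^bsub>?Q\<^esub> (b \<odot>\<^bsub>?Q\<^esub> x)"
      if "a \<in> carrier R" "b \<in> carrier R" "x \<in> carrier ?Q" for a b x
      using that by (auto simp: quot_carrier quot_smult smult_closed smult_assoc1)
    show "\<one> \<odot>\<^bsub>?Q\<^esub> x = x" if "x \<in> carrier ?Q" for x
      using that by (auto simp: quot_carrier quot_smult smult_one)
  qed
qed

end

lemma submodule_intro:
  assumes "H \<subseteq> carrier M" "\<zero>\<^bsub>M\<^esub> \<in> H" "\<And>x y. x \<in> H \<Longrightarrow> y \<in> H \<Longrightarrow> x \<oplus>\<^bsub>M\<^esub> y \<in> H"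
    "\<And>a x. a \<in> carrier R \<Longrightarrow> x \<in> H \<Longrightarrow> a \<odot>\<^bsub>M\<^esub> x \<in> H" "\<And>x. x \<in> H \<Longrightarrow> \<ominus>\<^bsub>M\<^esub> x \<in> H"
  shows "submodule H R M"
  using assms by (intro submodule.intro subgroup.intro) (auto simp: submodule_axioms_def a_inv_def)

end

section \<open>The Yangian as a quotient ring\<close>

abbreviation free_ring :: "yangian_gen free_alg ring" where
  "free_ring \<equiv> ring_of_type_algebra"

lemma free_ring_simps [simp]:
  "carrier free_ring = UNIV" "x \<otimes>\<^bsub>free_ring\<^esub> y = x * y" "x \<oplus>\<^bsub>free_ring\<^esub> y = x + y"
  "\<one>\<^bsub>free_ring\<^esub> = 1" "\<zero>\<^bsub>free_ring\<^esub> = 0"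
  by (simp_all add: ring_of_type_algebra_def)

lemma free_ring_ring: "ring free_ring"
proof -
  have "\<exists>y. x + y = 0" for x :: "yangian_gen free_alg"
    using add.right_inverse by blast
  then show ?thesis
    unfolding ring_of_type_algebra_def using add.right_inverse
    by unfold_locales (auto simp: algebra_simps Units_def)
qed

lemma free_ring_minus [simp]: "\<ominus>\<^bsub>free_ring\<^esub> x = - x"
  using abelian_group.minus_equality[OF ring.is_abelian_group[OF free_ring_ring], of "- x" x] by simp

lemma yangian_ideal_ideal: "ideal (yangian_ideal h1 h2 h3) free_ring"
  unfolding yangian_ideal_def by (intro ring.genideal_ideal free_ring_ring) simp

lemma yangian_rels_in_ideal: "r \<in> yangian_rels h1 h2 h3 \<Longrightarrow> r \<in> yangian_ideal h1 h2 h3"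
  using ring.genideal_self[OF free_ring_ring, of "yangian_rels h1 h2 h3"] unfolding yangian_ideal_def by auto

lemma yangian_ring: "ring (yangian h1 h2 h3)"
  unfolding yangian_def by (rule ideal.quotient_is_ring[OF yangian_ideal_ideal])

lemma yangian_carrier: "y \<in> carrier (yangian h1 h2 h3) \<longleftrightarrow> (\<exists>a. y = yangian_class h1 h2 h3 a)"
  by (auto simp: yangian_def yangian_class_def FactRing_def A_RCOSETS_defs a_r_coset_defs)

lemma class_closed [simp]: "yangian_class h1 h2 h3 a \<in> carrier (yangian h1 h2 h3)"
  by (auto simp: yangian_carrier)

lemma class_add: "yangian_class h1 h2 h3 a \<oplus>\<^bsub>yangian h1 h2 h3\<^esub> yangian_class h1 h2 h3 b = yangian_class h1 h2 h3 (a + b)"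
  and class_mult: "yangian_class h1 h2 h3 a \<otimes>\<^bsub>yangian h1 h2 h3\<^esub> yangian_class h1 h2 h3 b = yangian_class h1 h2 h3 (a * b)"
  and class_zero_iff: "yangian_class h1 h2 h3 a = \<zero>\<^bsub>yangian h1 h2 h3\<^esub> \<longleftrightarrow> a \<in> yangian_ideal h1 h2 h3"
proof -
  interpret ideal "yangian_ideal h1 h2 h3" free_ring by (rule yangian_ideal_ideal)
  show "yangian_class h1 h2 h3 a \<oplus>\<^bsub>yangian h1 h2 h3\<^esub> yangian_class h1 h2 h3 b = yangian_class h1 h2 h3 (a + b)"
    using a_rcos_sum[of a b] by (simp add: yangian_def yangian_class_def FactRing_def)
  show "yangian_class h1 h2 h3 a \<otimes>\<^bsub>yangian h1 h2 h3\<^esub> yangian_class h1 h2 h3 b = yangian_class h1 h2 h3 (a * b)"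
    using rcoset_mult_add[of a b] by (simp add: yangian_def yangian_class_def FactRing_def)
  show "yangian_class h1 h2 h3 a = \<zero>\<^bsub>yangian h1 h2 h3\<^esub> \<longleftrightarrow> a \<in> yangian_ideal h1 h2 h3"
    using a_rcos_self[of a] a_rcos_const[of a] by (auto simp: yangian_def yangian_class_def FactRing_def)
qed

lemma regular_left_module: "ring R \<Longrightarrow> left_module R (regular_module R)"
proof -
  assume "ring R"
  then interpret R: ring R .
  have "abelian_group (regular_module R)"
  proof (rule abelian_groupI)
    show "\<exists>y\<in>carrier (regular_module R). y \<oplus>\<^bsub>regular_module R\<^esub> x = \<zero>\<^bsub>regular_module R\<^esub>"
      if "x \<in> carrier (regular_module R)" for x
      using that by (auto simp: regular_module_def intro: R.l_neg R.a_inv_closed)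
  qed (auto simp: regular_module_def R.a_ac)
  then show ?thesis
    by (intro left_module.intro left_module_axioms.intro \<open>ring R\<close>)
       (auto simp: regular_module_def R.l_distr R.r_distr R.m_assoc)
qed

section \<open>Modules covered by the free algebra\<close>

text \<open>A cyclic module over the Yangian, presented by the map that applies elements of the free
  algebra to the generator. Submodules then correspond to left ideals of the free algebra, and iterated
  quotients need no cosets of cosets.\<close>

locale yangian_cover =
  fixes h1 h2 h3 :: complex and L :: "(yangian_gen free_alg set, 'b, 'm) module_scheme"
    and cov :: "yangian_gen free_alg \<Rightarrow> 'b"
  assumes left_module: "left_module (yangian h1 h2 h3) L"
    and closed [simp]: "cov a \<in> carrier L"
    and surj: "v \<in> carrier L \<Longrightarrow> \<exists>a. v = cov a"
    and cov_add: "cov (a + b) = cov a \<oplus>\<^bsub>L\<^esub> cov b"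
    and cov_smult: "yangian_class h1 h2 h3 a \<odot>\<^bsub>L\<^esub> cov b = cov (a * b)"
begin

sublocale left_module "yangian h1 h2 h3" L by (rule left_module)

lemma cov_zero: "cov 0 = \<zero>\<^bsub>L\<^esub>"
  using cov_add[of 0 0] closed[of 0] M.add.l_cancel_one' by fastforce

lemma cov_minus: "cov (- a) = \<ominus>\<^bsub>L\<^esub> cov a"
  using cov_add[of "- a" a] by (simp add: cov_zero M.minus_equality)

lemma cov_eq_iff: "cov a = cov b \<longleftrightarrow> cov (a - b) = \<zero>\<^bsub>L\<^esub>"
proof
  assume "cov a = cov b"
  then show "cov (a - b) = \<zero>\<^bsub>L\<^esub>"
    using cov_add[of a "- b"] by (simp add: cov_minus M.r_neg)
next
  assume "cov (a - b) = \<zero>\<^bsub>L\<^esub>"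
  then show "cov a = cov b" using cov_add[of "a - b" b] by simp
qed

lemma submodule_preimage:
  assumes "submodule W (yangian h1 h2 h3) L"
  shows "cov a \<in> W \<Longrightarrow> cov b \<in> W \<Longrightarrow> cov (a + b) \<in> W" "cov b \<in> W \<Longrightarrow> cov (a * b) \<in> W"
    "cov 0 \<in> W"
proof -
  interpret W: abelian_subgroup W L by (rule submodule_abelian_subgroup[OF assms])
  show "cov a \<in> W \<Longrightarrow> cov b \<in> W \<Longrightarrow> cov (a + b) \<in> W" by (simp add: cov_add)
  show "cov b \<in> W \<Longrightarrow> cov (a * b) \<in> W"
    using submodule.smult_closed[OF assms, of "yangian_class h1 h2 h3 a" "cov b"] by (simp add: cov_smult)
  show "cov 0 \<in> W" by (simp add: cov_zero)
qed

lemma submodule_image: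
  assumes zero: "0 \<in> B" and add: "\<And>a b. a \<in> B \<Longrightarrow> b \<in> B \<Longrightarrow> a + b \<in> B" and mult: "\<And>a b. b \<in> B \<Longrightarrow> a * b \<in> B"
  shows "submodule (cov ` B) (yangian h1 h2 h3) L"
proof (rule submodule_intro)
  show "\<zero>\<^bsub>L\<^esub> \<in> cov ` B" using zero by (metis cov_zero imageI)
  show "x \<oplus>\<^bsub>L\<^esub> y \<in> cov ` B" if "x \<in> cov ` B" "y \<in> cov ` B" for x y
    using that add by (auto simp flip: cov_add)
  show "a \<odot>\<^bsub>L\<^esub> x \<in> cov ` B" if "a \<in> carrier (yangian h1 h2 h3)" "x \<in> cov ` B" for a x
    using that mult by (auto simp: yangian_carrier cov_smult)
  show "\<ominus>\<^bsub>L\<^esub> x \<in> cov ` B" if "x \<in> cov ` B" for x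
    using that mult[of _ "- 1"] by (auto simp flip: cov_minus)
qed auto

lemma quotient_cover:
  assumes N: "submodule N (yangian h1 h2 h3) L"
  shows "yangian_cover h1 h2 h3 (quot_module L N) (\<lambda>a. N +>\<^bsub>L\<^esub> cov a)"
proof (rule yangian_cover.intro)
  show "\<exists>a. v = N +>\<^bsub>L\<^esub> cov a" if "v \<in> carrier (quot_module L N)" for v
    using that surj by (auto simp: quot_carrier[OF N])
  show "yangian_class h1 h2 h3 a \<odot>\<^bsub>quot_module L N\<^esub> (N +>\<^bsub>L\<^esub> cov b) = N +>\<^bsub>L\<^esub> cov (a * b)" for a b
    by (simp add: quot_smult[OF N] cov_smult)
qed (auto simp: quot_left_module[OF N] quot_carrier[OF N] quot_add[OF N] cov_add)

lemma quotient_kernel: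
  assumes N: "submodule N (yangian h1 h2 h3) L"
  shows "N +>\<^bsub>L\<^esub> cov a = \<zero>\<^bsub>quot_module L N\<^esub> \<longleftrightarrow> cov a \<in> N"
  by (simp add: quot_zero[OF N] coset_eq_zero[OF N])

lemma cov_finsum: "finsum L (\<lambda>i. cov (g i)) I = cov (sum g I)" if "finite I"
  using that by (induction I) (simp_all add: cov_zero cov_add)

end

lemma class_cover: "yangian_cover h1 h2 h3 (regular_module (yangian h1 h2 h3)) (yangian_class h1 h2 h3)"
  by (rule yangian_cover.intro, rule regular_left_module[OF yangian_ring])
     (auto simp: yangian_carrier class_add class_mult regular_module_def)

section \<open>Left ideals containing the Verma ideal\<close>

context hw_left_ideal
begin

lemma Z_zero: "0 \<in> Z"
  using Z_mult[OF Z_f, of 0] by simp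

lemma Z_minus: "a \<in> Z \<Longrightarrow> - a \<in> Z"
  using Z_mult[of a "- 1"] by simp

lemma Z_diff: "a \<in> Z \<Longrightarrow> b \<in> Z \<Longrightarrow> a - b \<in> Z"
  using Z_add[of a "- b"] Z_minus[of b] by simp

lemma Z_sum: "(\<And>i. i \<in> I \<Longrightarrow> g i \<in> Z) \<Longrightarrow> sum g I \<in> Z"
  by (induction I rule: infinite_finite_induct) (auto intro: Z_add Z_zero)

text \<open>Each \<open>e\<^sub>j\<close> raises the eigenvalue of \<open>\<psi>\<^sub>2\<close> by \<open>2\<close> and lowers the degree by \<open>1\<close>.\<close>

lemma psi2_eigen: "spanned d a \<Longrightarrow> psi_gen 2 * a - free_scalar (p 2 - 2 * of_int d) * a \<in> Z"
proof (induction rule: spanned.induct)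
  case (null a d)
  then show ?case by (intro Z_diff Z_mult)
next
  case (scalar c)
  have "psi_gen 2 * free_scalar c - free_scalar (p 2 - 2 * of_int 0) * free_scalar c = free_scalar c * (psi_gen 2 - free_scalar (p 2))"
    by (simp add: free_scalar_commute[of "psi_gen 2"] right_diff_distrib mult.commute flip: free_scalar_mult)
  then show ?case by (simp only: Z_mult[OF Z_psi])
next
  case (add d a b)
  then show ?case using Z_add[OF add.IH] by (simp add: algebra_simps)
next
  case (e d a d' j)
  have "p 2 - 2 * of_int d' = (p 2 - 2 * of_int d) + 2" by (simp add: e.hyps(2))
  then have k: "free_scalar (p 2 - 2 * of_int d') = free_scalar (p 2 - 2 * of_int d) + (2 :: yangian_gen free_alg)"
    by (simp only: free_scalar_add free_scalar_numeral)
  have "psi_gen 2 * (e_gen j * a) - free_scalar (p 2 - 2 * of_int d') * (e_gen j * a)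
     = (commutator (psi_gen 2) (e_gen j) - 2 * e_gen j) * a
     + e_gen j * (psi_gen 2 * a - free_scalar (p 2 - 2 * of_int d) * a)"
    by (simp add: k commutator_def distrib_left distrib_right left_diff_distrib right_diff_distrib mult.assoc
      free_scalar_left_commute[of "e_gen j"])
  then show ?case by (simp only: Z_add Z_psi2_e Z_mult[OF e.IH])
qed

text \<open>The eigenvalues of \<open>\<psi>\<^sub>2\<close> in the degrees of \<open>D\<close> differ from that in degree \<open>0\<close>. Applying
  \<open>\<psi>\<^sub>2\<close> minus the eigenvalue in degree \<open>d\<^sub>0\<close> removes the term of degree \<open>d\<^sub>0\<close>, and rescales the
  other terms, the scalar \<open>c\<close> by the nonzero factor \<open>2 d\<^sub>0\<close>.\<close>

lemma left_ideal_scalar: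
  assumes B: "Z \<subseteq> B" "\<And>a b. a \<in> B \<Longrightarrow> b \<in> B \<Longrightarrow> a + b \<in> B" "\<And>a b. b \<in> B \<Longrightarrow> a * b \<in> B"
    and "finite D" "\<And>d. d \<in> D \<Longrightarrow> d < 0" "\<And>d. d \<in> D \<Longrightarrow> spanned d (g d)"
    and "free_scalar c + sum g D \<in> B" "c \<noteq> 0"
  shows "1 \<in> B"
  using assms(4-)
proof (induction D arbitrary: g c rule: finite_induct)
  case empty
  then have "free_scalar (1 / c) * free_scalar c \<in> B" using B(3) by auto
  then show ?case using \<open>c \<noteq> 0\<close> by (simp flip: free_scalar_mult)
next
  case (insert d0 D)
  let ?k = "p 2 - 2 * of_int d0"
  let ?x = "psi_gen 2 - free_scalar ?k"
  define g' where "g' d = free_scalar (2 * of_int (d0 - d)) * g d" for d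
  have eigen: "?x * a - free_scalar (2 * of_int (d0 - d)) * a \<in> Z" if "spanned d a" for d a
  proof -
    have "?x * a - free_scalar (2 * of_int (d0 - d)) * a = psi_gen 2 * a - free_scalar (?k + 2 * of_int (d0 - d)) * a"
      by (simp only: free_scalar_add left_diff_distrib distrib_right diff_diff_eq)
    also have "?k + 2 * of_int (d0 - d) = p 2 - 2 * of_int d" by (simp add: algebra_simps)
    finally show ?thesis using psi2_eigen[OF that] by simp
  qed
  have "?x * (free_scalar c + sum g (insert d0 D)) \<in> B" by (rule B(3)) (rule insert.prems)
  moreover have "free_scalar (2 * of_int d0 * c) + sum g' D - ?x * (free_scalar c + sum g (insert d0 D)) \<in> Z"
  proof -
    have "?x * (free_scalar c + sum g (insert d0 D)) - (free_scalar (2 * of_int d0 * c) + sum g' D)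
        = (?x * free_scalar c - free_scalar (2 * of_int (d0 - 0)) * free_scalar c)
        + (?x * g d0 - free_scalar (2 * of_int (d0 - d0)) * g d0)
        + (\<Sum>d\<in>D. ?x * g d - free_scalar (2 * of_int (d0 - d)) * g d)"
      using insert.hyps by (simp add: g'_def distrib_left sum_distrib_left sum_subtractf free_scalar_mult)
    also have "\<dots> \<in> Z"
      by (intro Z_add Z_sum eigen spanned.scalar insert.prems) auto
    finally show ?thesis using Z_minus by fastforce
  qed
  ultimately have "free_scalar (2 * of_int d0 * c) + sum g' D \<in> B"
    using B(1) B(2) by (metis (no_types, lifting) diff_add_cancel subsetD)
  moreover have "2 * of_int d0 * c \<noteq> 0" using insert.prems(1)[of d0] insert.prems(4) by simp
  ultimately show ?case
    by (intro insert.IH[of g' "2 * of_int d0 * c"]) (auto simp: g'_def insert.prems intro!: spanned_scale)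
qed

end

definition degree_part :: "int \<Rightarrow> yangian_gen free_alg \<Rightarrow> yangian_gen free_alg" where
  "degree_part k a = (\<Sum>w\<in>{w \<in> Poly_Mapping.keys a. word_deg w = k}. Poly_Mapping.single w (Poly_Mapping.lookup a w))"

definition degrees :: "yangian_gen free_alg \<Rightarrow> int set" where
  "degrees a = word_deg ` Poly_Mapping.keys a"

lemma finite_degrees [simp]: "finite (degrees a)" by (simp add: degrees_def)

lemma homog_add: "homog k a \<Longrightarrow> homog k b \<Longrightarrow> homog k (a + b)"
  using Poly_Mapping.keys_add[of a b] by (auto simp: homog_def)

lemma homog_zero [simp]: "homog k 0" by (simp add: homog_def)

lemma homog_minus: "homog k a \<Longrightarrow> homog k (- a)" by (simp add: homog_def)

lemma homog_diff: "homog k a \<Longrightarrow> homog k b \<Longrightarrow> homog k (a - b)"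
  using homog_add[of k a "- b"] homog_minus[of k b] by simp

lemma homog_sum: "(\<And>i. i \<in> I \<Longrightarrow> homog k (g i)) \<Longrightarrow> homog k (sum g I)"
  by (induction I rule: infinite_finite_induct) (auto intro: homog_add)

lemma word_deg_add: "word_deg (u + v) = word_deg u + word_deg v"
  by (simp add: word_deg_def plus_free_monoid_def)

lemma homog_mult: "homog k a \<Longrightarrow> homog l b \<Longrightarrow> homog (k + l) (a * b)"
  using keys_mult[of a b] by (fastforce simp: homog_def word_deg_add)

lemma homog_scalar [simp]: "homog 0 (free_scalar c)"
  by (auto simp: homog_def free_scalar_def word_deg_def zero_free_monoid_def)

lemma homog_e [simp]: "homog (- 1) (e_gen j)"
  by (simp add: homog_def free_gen_def word_deg_def)

lemma homog_degree_part: "homog k (degree_part k a)"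
  unfolding degree_part_def by (rule homog_sum) (auto simp: homog_def)

lemma sum_degree_parts: "(\<Sum>k\<in>degrees a. degree_part k a) = a"
  unfolding degree_part_def degrees_def
  by (subst sum.image_gen[where g = word_deg, symmetric]) (auto simp: sum_singles)

context yangian_model
begin

lemma ideal_null: "a \<in> yangian_ideal h1 h2 h3 \<Longrightarrow> rho a \<in> vac_null"
proof -
  interpret op_subspace vac_null by (rule vac_null_subspace)
  have "ideal {a. rho a \<in> vac_null} free_ring"
  proof (rule idealI[OF free_ring_ring])
    show "subgroup {a. rho a \<in> vac_null} (add_monoid free_ring)"
    proof (rule group.subgroupI)
      show "group (add_monoid free_ring)"
        using abelian_group.a_group[OF ring.is_abelian_group[OF free_ring_ring]] .
      show "{a. rho a \<in> vac_null} \<noteq> {}" using zero by (auto intro: exI[of _ 0])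
      show "inv\<^bsub>add_monoid free_ring\<^esub> a \<in> {a. rho a \<in> vac_null}" if "a \<in> {a. rho a \<in> vac_null}" for a
        using that minus free_ring_minus[of a] unfolding a_inv_def by (simp only: mem_Collect_eq rho_minus)
    qed (auto simp: rho_simps closed)
  qed (auto simp: rho_mult vac_null_left vac_null_rho)
  then have "yangian_ideal h1 h2 h3 \<subseteq> {a. rho a \<in> vac_null}"
    unfolding yangian_ideal_def by (rule ring.genideal_minimal[OF free_ring_ring]) (auto simp: rels_null)
  then show "a \<in> yangian_ideal h1 h2 h3 \<Longrightarrow> rho a \<in> vac_null" by blast
qed

lemma ideal_ann: "yangian_ideal h1 h2 h3 \<subseteq> vac_ann"
proof
  fix a assume "a \<in> yangian_ideal h1 h2 h3"
  then have "app (rho a) (app (rho 1) vac) = 0" using ideal_null unfolding vac_null_def by blast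
  then show "a \<in> vac_ann" by (simp add: vac_ann_def)
qed

abbreviation "Y \<equiv> yangian h1 h2 h3"
abbreviation "J \<equiv> verma_left_ideal h1 h2 h3 p"
abbreviation "cls \<equiv> yangian_class h1 h2 h3"

sublocale Reg: yangian_cover h1 h2 h3 "regular_module (yangian h1 h2 h3)" "yangian_class h1 h2 h3"
  by (rule class_cover)

definition verma_ann :: "yangian_gen free_alg set" where
  "verma_ann = {a. cls a \<in> J}"

lemma J_submodule: "submodule J Y (regular_module Y)"
proof -
  let ?S = "cls ` (range f_gen \<union> range (\<lambda>j. psi_gen j - free_scalar (p j)))"
  let ?W = "{W. submodule W Y (regular_module Y) \<and> ?S \<subseteq> W}"
  have "submodule (range cls) Y (regular_module Y)"
    by (rule Reg.submodule_image) auto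
  then have "range cls \<in> ?W" by auto
  then have "J \<subseteq> range cls" unfolding verma_left_ideal_def left_ideal_gen_def by blast
  then have "J = cls ` {a. cls a \<in> J}" by auto
  moreover have "submodule (cls ` {a. cls a \<in> J}) Y (regular_module Y)"
    by (rule Reg.submodule_image)
       (auto simp: verma_left_ideal_def left_ideal_gen_def intro: Reg.submodule_preimage)
  ultimately show ?thesis by simp
qed

lemma verma_ann_gen: "f_gen k \<in> verma_ann" "psi_gen i - free_scalar (p i) \<in> verma_ann"
  by (auto simp: verma_ann_def verma_left_ideal_def left_ideal_gen_def)

lemma verma_ann_add: "a \<in> verma_ann \<Longrightarrow> b \<in> verma_ann \<Longrightarrow> a + b \<in> verma_ann"
  and verma_ann_mult: "b \<in> verma_ann \<Longrightarrow> a * b \<in> verma_ann"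
  unfolding verma_ann_def using Reg.submodule_preimage[OF J_submodule] by auto

lemma ideal_sub_verma_ann: "yangian_ideal h1 h2 h3 \<subseteq> verma_ann"
proof
  fix a assume "a \<in> yangian_ideal h1 h2 h3"
  then have "cls a = cls 0"
    using class_zero_iff ideal.axioms(1)[OF yangian_ideal_ideal] additive_subgroup.zero_closed
    by (metis free_ring_simps(5))
  then show "a \<in> verma_ann" using Reg.submodule_preimage(3)[OF J_submodule] by (simp add: verma_ann_def)
qed

lemma verma_ann_sub_vac_ann: "verma_ann \<subseteq> vac_ann"
proof
  fix a assume "a \<in> verma_ann"
  have "submodule (cls ` vac_ann) Y (regular_module Y)"
    by (rule Reg.submodule_image) (auto intro: ann.Z_zero ann.Z_add ann.Z_mult)
  then have "J \<subseteq> cls ` vac_ann"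
    unfolding verma_left_ideal_def left_ideal_gen_def using ann.Z_f ann.Z_psi by (intro Inter_lower) auto
  with \<open>a \<in> verma_ann\<close> obtain b where b: "cls a = cls b" "b \<in> vac_ann" unfolding verma_ann_def by blast
  then have "a - b \<in> vac_ann"
    using Reg.cov_eq_iff[of a b] class_zero_iff[of h1 h2 h3 "a - b"] ideal_ann by (auto simp: regular_module_def)
  then show "a \<in> vac_ann" using ann.Z_add[OF _ b(2), of "a - b"] by simp
qed

lemma verma_ann_hw: "hw_left_ideal h1 h2 h3 p verma_ann"
proof -
  have rel: "r * a \<in> verma_ann" if "r \<in> yangian_rels h1 h2 h3" for r a
    using ideal.I_r_closed[OF yangian_ideal_ideal yangian_rels_in_ideal[OF that], of a] ideal_sub_verma_ann by auto
  show ?thesis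
    by unfold_locales (use yangian_rels.psi1_e in \<open>auto intro: verma_ann_add verma_ann_mult verma_ann_gen rel yangian_rels.intros\<close>)
qed

sublocale vI: hw_left_ideal h1 h2 h3 p verma_ann by (rule verma_ann_hw)

text \<open>If \<open>B\<close> contains some \<open>a\<close> that does not annihilate \<open>vac\<close>, it contains an \<open>x\<close> that fixes \<open>vac\<close>.
  Modulo the Verma ideal the component of \<open>x\<close> of degree \<open>0\<close> is a scalar and those of positive degree
  vanish; the components of negative degree do not contribute at the empty word, so the scalar is \<open>1\<close>
  and \<open>left_ideal_scalar\<close> applies.\<close>

lemma left_ideal_dichotomy:
  assumes B: "verma_ann \<subseteq> B" "\<And>a b. a \<in> B \<Longrightarrow> b \<in> B \<Longrightarrow> a + b \<in> B" "\<And>a b. b \<in> B \<Longrightarrow> a * b \<in> B"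
  shows "B \<subseteq> vac_ann \<or> 1 \<in> B"
proof (rule ccontr)
  assume "\<not> (B \<subseteq> vac_ann \<or> 1 \<in> B)"
  then obtain a where a: "a \<in> B" "a \<notin> vac_ann" and 1: "1 \<notin> B" by blast
  obtain b where b: "b * a - 1 \<in> vac_ann" using vac_generated[OF a(2)] .
  define x where "x = b * a"
  have x: "x \<in> B" "x - 1 \<in> vac_ann" using a b by (auto simp: x_def B(3))
  have "vI.spanned k (degree_part k x)" for k by (intro vI.spanned_homog homog_degree_part)
  note sp = vI.spanned_nonneg[OF this]
  obtain c where c: "degree_part 0 x - free_scalar c \<in> verma_ann" using sp[of 0] by auto
  let ?D = "{k \<in> degrees x. k < 0}"
  \<comment> \<open>Degree \<open>0\<close> need not occur in \<open>x\<close>, and is then added as a zero term.\<close>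
  have split: "x = degree_part 0 x + (\<Sum>k\<in>?D. degree_part k x) + (\<Sum>k\<in>{k \<in> degrees x. k > 0}. degree_part k x)"
  proof -
    have "x = (\<Sum>k\<in>insert 0 (degrees x). degree_part k x)"
    proof (cases "0 \<in> degrees x")
      case False
      then have "degree_part 0 x = 0" by (auto simp: degree_part_def degrees_def intro!: sum.neutral)
      then show ?thesis using False by (simp add: sum_degree_parts)
    qed (simp add: sum_degree_parts insert_absorb)
    also have "insert 0 (degrees x) = insert 0 (?D \<union> {k \<in> degrees x. k > 0})" by auto
    also have "(\<Sum>k\<in>\<dots>. degree_part k x) = degree_part 0 x + (\<Sum>k\<in>?D \<union> {k \<in> degrees x. k > 0}. degree_part k x)"
      by (rule sum.insert) auto
    also have "(\<Sum>k\<in>?D \<union> {k \<in> degrees x. k > 0}. degree_part k x) = (\<Sum>k\<in>?D. degree_part k x) + (\<Sum>k\<in>{k \<in> degrees x. k > 0}. degree_part k x)"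
      by (rule sum.union_disjoint) auto
    finally show ?thesis by (simp add: add.assoc)
  qed
  define y where "y = free_scalar c + (\<Sum>k\<in>?D. degree_part k x)"
  have pos: "(\<Sum>k\<in>{k \<in> degrees x. k > 0}. degree_part k x) \<in> verma_ann" using sp by (intro vI.Z_sum) auto
  have "x - y = (degree_part 0 x - free_scalar c) + (\<Sum>k\<in>{k \<in> degrees x. k > 0}. degree_part k x)"
    unfolding y_def by (subst split) (simp add: algebra_simps)
  also have "\<dots> \<in> verma_ann" by (intro vI.Z_add c pos)
  finally have xy: "x - y \<in> verma_ann" .
  have "y = x + - (x - y)" by simp
  also have "\<dots> \<in> B" using x(1) vI.Z_minus[OF xy] B by blast
  finally have yB: "y \<in> B" .
  have "coef (app (rho y) vac) [] = c"
  proof -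
    have "coef (app (rho (degree_part k x)) vac) [] = 0" if "k < 0" for k
      using homogeneous_rho[OF homog_degree_part[of k x]] that by (simp add: homogeneous_def)
    then show ?thesis by (simp add: y_def rho_add rho_sum app_sum_left coef_sum coef_vac)
  qed
  moreover have "app (rho y) vac = vac"
  proof -
    have "y - 1 = (x - 1) - (x - y)" by simp
    also have "\<dots> \<in> vac_ann" using ann.Z_diff[OF x(2)] xy verma_ann_sub_vac_ann by blast
    finally show ?thesis by (simp add: vac_ann_def rho_diff)
  qed
  ultimately have "c = 1" by (simp add: coef_vac)
  then have "1 \<in> B"
    using yB vI.spanned_homog[OF homog_degree_part] unfolding y_def
    by (intro vI.left_ideal_scalar[OF B, of ?D "\<lambda>k. degree_part k x" c]) auto
  with 1 show False by blast
qed

section \<open>The radical of the Verma module\<close>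

abbreviation "Mp \<equiv> verma h1 h2 h3 p"

definition piM :: "yangian_gen free_alg \<Rightarrow> yangian_gen free_alg set set" where
  "piM a = J +>\<^bsub>regular_module Y\<^esub> cls a"

sublocale Verma: yangian_cover h1 h2 h3 "verma h1 h2 h3 p" piM
  unfolding verma_def piM_def by (rule Reg.quotient_cover) (rule J_submodule)

lemma piM_zero_iff: "piM a = \<zero>\<^bsub>Mp\<^esub> \<longleftrightarrow> a \<in> verma_ann"
  unfolding verma_def piM_def verma_ann_def using Reg.quotient_kernel[OF J_submodule] by simp

definition Rad :: "yangian_gen free_alg set set set" where
  "Rad = piM ` vac_ann"

lemma Rad_submodule: "submodule Rad Y Mp"
  unfolding Rad_def by (rule Verma.submodule_image) (auto intro: ann.Z_zero ann.Z_add ann.Z_mult)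

lemma piM_Rad_iff: "piM a \<in> Rad \<longleftrightarrow> a \<in> vac_ann"
proof
  assume "piM a \<in> Rad"
  then obtain b where b: "piM a = piM b" "b \<in> vac_ann" by (auto simp: Rad_def)
  then have "a - b \<in> vac_ann"
    using Verma.cov_eq_iff[of a b] piM_zero_iff[of "a - b"] verma_ann_sub_vac_ann by (simp add: subset_iff)
  then show "a \<in> vac_ann" using ann.Z_add[OF _ b(2), of "a - b"] by simp
qed (auto simp: Rad_def)

lemma irreducible_Rad: "irreducible_module Y (quot_module Mp Rad)"
proof -
  let ?V = "quot_module Mp Rad" and ?pi = "\<lambda>a. Rad +>\<^bsub>Mp\<^esub> piM a"
  interpret V: yangian_cover h1 h2 h3 ?V ?pi
    by (rule Verma.quotient_cover[OF Rad_submodule])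
  have ker: "?pi a = \<zero>\<^bsub>?V\<^esub> \<longleftrightarrow> a \<in> vac_ann" for a
    using Verma.quotient_kernel[OF Rad_submodule] piM_Rad_iff by simp
  have "W = {\<zero>\<^bsub>?V\<^esub>} \<or> W = carrier ?V" if W: "submodule W Y ?V" for W
  proof (cases "\<exists>a. ?pi a \<in> W \<and> a \<notin> vac_ann")
    case True
    then obtain a where a: "?pi a \<in> W" "a \<notin> vac_ann" by blast
    obtain b where b: "b * a - 1 \<in> vac_ann" using vac_generated[OF a(2)] .
    have "?pi (b * a) \<in> W" by (rule V.submodule_preimage(2)[OF W a(1)])
    moreover have "?pi (b * a) = ?pi 1" using b V.cov_eq_iff[of "b * a" 1] ker[of "b * a - 1"] by simp
    ultimately have "?pi 1 \<in> W" by simp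
    then have "?pi x \<in> W" for x using V.submodule_preimage(2)[OF W, of 1 x] by simp
    moreover have "W \<subseteq> carrier ?V" by (rule V.submodule_subset[OF W])
    ultimately show ?thesis using V.surj by blast
  next
    case False
    have "W \<subseteq> carrier ?V" by (rule V.submodule_subset[OF W])
    then have "W \<subseteq> {\<zero>\<^bsub>?V\<^esub>}" using False ker V.surj by blast
    moreover have "\<zero>\<^bsub>?V\<^esub> \<in> W" using V.submodule_preimage(3)[OF W] V.cov_zero by simp
    ultimately show ?thesis by blast
  qed
  moreover have "carrier ?V \<noteq> {\<zero>\<^bsub>?V\<^esub>}"
    using ker[of 1] one_notin_ann V.closed[of 1] by blast
  ultimately show ?thesis using V.left_module by (auto simp: irreducible_module_def)
qed

text \<open>By the dichotomy the preimage of \<open>N\<close> is contained in the annihilator of \<open>vac\<close>; irreducibility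
  of the quotient leaves no room for a proper inclusion.\<close>

lemma radical_unique:
  assumes N: "submodule N Y Mp" and irr: "irreducible_module Y (quot_module Mp N)"
  shows "N = Rad"
proof -
  let ?V = "quot_module Mp N" and ?pi = "\<lambda>a. N +>\<^bsub>Mp\<^esub> piM a"
  interpret V: yangian_cover h1 h2 h3 ?V ?pi
    by (rule Verma.quotient_cover[OF N])
  have ker: "?pi a = \<zero>\<^bsub>?V\<^esub> \<longleftrightarrow> piM a \<in> N" for a
    by (rule Verma.quotient_kernel[OF N])
  have Nc: "N \<subseteq> carrier Mp" by (rule Verma.submodule_subset[OF N])
  let ?B = "{a. piM a \<in> N}"
  have "verma_ann \<subseteq> ?B"
  proof
    fix a assume "a \<in> verma_ann"
    then have "piM a = piM 0" using piM_zero_iff[of a] by (simp add: Verma.cov_zero)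
    then show "a \<in> ?B" using Verma.submodule_preimage(3)[OF N] by simp
  qed
  then have "?B \<subseteq> vac_ann \<or> 1 \<in> ?B"
    by (rule left_ideal_dichotomy) (auto intro: Verma.submodule_preimage[OF N])
  moreover have "1 \<notin> ?B"
  proof
    assume "1 \<in> ?B"
    then have "?pi x = \<zero>\<^bsub>?V\<^esub>" for x using ker Verma.submodule_preimage(2)[OF N, of 1 x] by simp
    then have "v = \<zero>\<^bsub>?V\<^esub>" if "v \<in> carrier ?V" for v using V.surj[OF that] by auto
    then have "carrier ?V = {\<zero>\<^bsub>?V\<^esub>}" by (auto intro: V.zero_closed)
    then show False using irr by (simp add: irreducible_module_def)
  qed
  ultimately have sub: "?B \<subseteq> vac_ann" by blast
  have "submodule (?pi ` vac_ann) Y ?V"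
    by (rule V.submodule_image) (auto intro: ann.Z_zero ann.Z_add ann.Z_mult)
  then have "?pi ` vac_ann = {\<zero>\<^bsub>?V\<^esub>} \<or> ?pi ` vac_ann = carrier ?V"
    using irr by (simp add: irreducible_module_def)
  moreover have "?pi ` vac_ann \<noteq> carrier ?V"
  proof
    assume "?pi ` vac_ann = carrier ?V"
    then have "?pi 1 \<in> ?pi ` vac_ann" using V.closed[of 1] by simp
    then obtain a where a: "?pi 1 = ?pi a" "a \<in> vac_ann" by (rule imageE)
    then have "1 - a \<in> vac_ann" using V.cov_eq_iff[of 1 a] ker[of "1 - a"] sub by auto
    then have "1 \<in> vac_ann" using ann.Z_add[OF _ a(2), of "1 - a"] by simp
    then show False using one_notin_ann by blast
  qed
  ultimately have zero: "?pi ` vac_ann = {\<zero>\<^bsub>?V\<^esub>}" by simp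
  have "piM a \<in> N" if "a \<in> vac_ann" for a
  proof -
    have "?pi a \<in> ?pi ` vac_ann" using that by (rule imageI)
    then show ?thesis unfolding zero using ker[of a] by simp
  qed
  then have "Rad \<subseteq> N" unfolding Rad_def by (rule image_subsetI)
  moreover have "N \<subseteq> Rad"
  proof
    fix x assume x: "x \<in> N"
    then obtain a where "x = piM a" using Verma.surj Nc by (meson subsetD)
    then show "x \<in> Rad" using x sub piM_Rad_iff[of a] by auto
  qed
  ultimately show ?thesis by (intro equalityI)
qed

lemma radical_eq: "verma_radical h1 h2 h3 p = Rad"
  unfolding verma_radical_def
  by (rule the_equality, intro conjI Rad_submodule irreducible_Rad, erule conjE, rule radical_unique)

end

section \<open>The irreducible module as a graded module\<close>

context yangian_model
begin

abbreviation "Vp \<equiv> irred_hw_module h1 h2 h3 p"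
abbreviation "Vgr \<equiv> irred_hw_grading h1 h2 h3 p"

definition piV :: "yangian_gen free_alg \<Rightarrow> yangian_gen free_alg set set set" where
  "piV a = Rad +>\<^bsub>Mp\<^esub> piM a"

lemma Vp_cover: "yangian_cover h1 h2 h3 Vp piV"
  unfolding irred_hw_module_def radical_eq piV_def by (rule Verma.quotient_cover) (rule Rad_submodule)

interpretation V: yangian_cover h1 h2 h3 Vp piV
  by (rule Vp_cover)

lemma piV_zero_iff: "piV a = \<zero>\<^bsub>Vp\<^esub> \<longleftrightarrow> a \<in> vac_ann"
  unfolding irred_hw_module_def radical_eq piV_def
  using Verma.quotient_kernel[OF Rad_submodule] piM_Rad_iff by simp

lemma piV_eq_iff: "piV a = piV b \<longleftrightarrow> a - b \<in> vac_ann"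
  using V.cov_eq_iff piV_zero_iff by simp

lemma grading_homog: "yangian_grading h1 h2 h3 k = cls ` {a. homog k a}"
  by (simp add: yangian_grading_def homog_def)

lemma Vgr_eq: "Vgr k = piV ` {a. homog k a}"
  by (simp add: irred_hw_grading_def verma_grading_def quot_grading_def grading_homog radical_eq
      piV_def piM_def image_image verma_def)

text \<open>Homogeneous components applied to \<open>vac\<close> have disjoint supports, so the annihilator of \<open>vac\<close> is a
  graded ideal.\<close>

lemma ann_components:
  assumes "finite D" "\<And>k. k \<in> D \<Longrightarrow> homog k (g k)" "sum g D \<in> vac_ann" "k \<in> D"
  shows "g k \<in> vac_ann"
proof -
  have "coef (app (rho (g k)) vac) w = 0" for w
  proof (cases "int (length w) = - k")
    case True
    have "coef (app (rho (g l)) vac) w = 0" if "l \<in> D - {k}" for l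
      using homogeneous_rho[OF assms(2)[of l]] that True by (auto simp: homogeneous_def)
    then have "(\<Sum>l\<in>D. coef (app (rho (g l)) vac) w) = coef (app (rho (g k)) vac) w"
      using assms by (simp add: sum.remove)
    moreover have "(\<Sum>l\<in>D. coef (app (rho (g l)) vac) w) = 0"
      using assms(3) by (simp add: vac_ann_def rho_sum app_sum_left flip: coef_sum)
    ultimately show ?thesis by simp
  next
    case False
    then show ?thesis using homogeneous_rho[OF assms(2)[OF assms(4)]] by (simp add: homogeneous_def)
  qed
  then show ?thesis by (auto simp: vac_ann_def intro: wordfun_eqI)
qed

lemma homog_positive_ann: "homog k a \<Longrightarrow> k > 0 \<Longrightarrow> a \<in> vac_ann"
  using ann.spanned_nonneg[OF ann.spanned_homog] by blast

lemma Vp_graded: "graded_yangian_module h1 h2 h3 Vp Vgr"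
  unfolding graded_yangian_module_def
proof (intro conjI allI ballI)
  show "left_module Y Vp" by (rule V.left_module)
  show "additive_subgroup (Vgr k) Vp" for k
  proof (rule additive_subgroupI, rule group.subgroupI)
    show "group (add_monoid Vp)" by (rule V.M.a_group)
    show "Vgr k \<subseteq> carrier (add_monoid Vp)" by (auto simp: Vgr_eq)
    show "Vgr k \<noteq> {}" by (auto simp: Vgr_eq intro: exI[of _ 0])
    show "inv\<^bsub>add_monoid Vp\<^esub> x \<in> Vgr k" if "x \<in> Vgr k" for x
      using that by (auto simp: Vgr_eq simp flip: a_inv_def V.cov_minus intro: homog_minus)
    show "x \<otimes>\<^bsub>add_monoid Vp\<^esub> y \<in> Vgr k" if "x \<in> Vgr k" "y \<in> Vgr k" for x y
      using that by (auto simp: Vgr_eq simp flip: V.cov_add intro: homog_add)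
  qed
  show "y \<odot>\<^bsub>Vp\<^esub> v \<in> Vgr (i + k)" if "y \<in> yangian_grading h1 h2 h3 i" "v \<in> Vgr k" for i k y v
    using that by (auto simp: Vgr_eq grading_homog V.cov_smult intro: homog_mult)
  fix v assume "v \<in> carrier Vp"
  then obtain a where a: "v = piV a" using V.surj by blast
  let ?Z = "\<zero>\<^bsub>Vp\<^esub>"
  let ?P = "\<lambda>g. (\<forall>k. g k \<in> Vgr k) \<and> finite {k. g k \<noteq> ?Z} \<and> v = finsum Vp g {k. g k \<noteq> ?Z}"
  have sum_support: "finsum Vp (\<lambda>k. piV (g k)) {k. piV (g k) \<noteq> ?Z} = piV (sum g D)"
    if "finite D" "\<And>k. k \<notin> D \<Longrightarrow> piV (g k) = ?Z" for g D
  proof -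
    let ?S = "{k. piV (g k) \<noteq> ?Z}"
    have S: "?S \<subseteq> D" using that(2) by blast
    then have "finite ?S" using that(1) finite_subset by blast
    then have "finsum Vp (\<lambda>k. piV (g k)) ?S = piV (sum g ?S)" by (rule V.cov_finsum)
    also have "\<dots> = piV (sum g D)"
    proof -
      have "sum g D = sum g ?S + sum g (D - ?S)"
        using S that(1) by (metis add.commute sum.subset_diff)
      moreover have "sum g (D - ?S) \<in> vac_ann"
        by (rule ann.Z_sum) (auto simp: piV_zero_iff)
      ultimately show ?thesis
        unfolding piV_eq_iff using ann.Z_minus by fastforce
    qed
    finally show ?thesis .
  qed
  have ex: "?P (\<lambda>k. piV (degree_part k a))"
  proof -
    have z: "piV (degree_part k a) = ?Z" if "k \<notin> degrees a" for k
    proof -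
      have "degree_part k a = 0" using that by (auto simp: degree_part_def degrees_def intro!: sum.neutral)
      then show ?thesis by (simp add: V.cov_zero)
    qed
    then have "{k. piV (degree_part k a) \<noteq> ?Z} \<subseteq> degrees a" by blast
    then have "finite {k. piV (degree_part k a) \<noteq> ?Z}" by (rule finite_subset) simp
    moreover have "v = finsum Vp (\<lambda>k. piV (degree_part k a)) {k. piV (degree_part k a) \<noteq> ?Z}"
      using sum_support[OF finite_degrees z] by (simp add: sum_degree_parts a)
    ultimately show ?thesis by (auto simp: Vgr_eq homog_degree_part)
  qed
  have un: "g = g'" if g: "?P g" and g': "?P g'" for g g'
  proof -
    have rep: "\<exists>x. \<forall>k. homog k (x k) \<and> h k = piV (x k)" if "\<forall>k. h k \<in> Vgr k" for h
      by (rule choice) (use that in \<open>auto simp: Vgr_eq\<close>)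
    obtain x where x: "\<And>k. homog k (x k)" "\<And>k. g k = piV (x k)"
      using rep[of g] g by blast
    obtain x' where x': "\<And>k. homog k (x' k)" "\<And>k. g' k = piV (x' k)"
      using rep[of g'] g' by blast
    have gx: "g = (\<lambda>k. piV (x k))" "g' = (\<lambda>k. piV (x' k))" using x x' by auto
    let ?D = "{k. g k \<noteq> ?Z} \<union> {k. g' k \<noteq> ?Z}"
    have D: "finite ?D" using g g' by blast
    have "piV (sum x ?D) = v" "piV (sum x' ?D) = v"
      using sum_support[OF D, of x] sum_support[OF D, of x'] g g' unfolding gx by auto
    then have diff: "sum (\<lambda>k. x k - x' k) ?D \<in> vac_ann"
      using piV_eq_iff[of "sum x ?D" "sum x' ?D"] by (simp add: sum_subtractf)
    have "x k - x' k \<in> vac_ann" if "k \<in> ?D" for k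
      by (rule ann_components[OF D _ diff that]) (intro homog_diff x x')
    then have "g k = g' k" if "k \<in> ?D" for k
      using that by (simp add: gx piV_eq_iff)
    moreover have "g k = g' k" if "k \<notin> ?D" for k using that by simp
    ultimately show ?thesis by blast
  qed
  show "\<exists>!g. ?P g"
    by (rule ex1I[of ?P, OF ex]) (erule un[OF _ ex])
qed

lemma Vp_locally_finite:
  assumes "v \<in> carrier Vp"
  shows "\<exists>N. \<forall>k\<ge>N. \<forall>y\<in>yangian_grading h1 h2 h3 k. y \<odot>\<^bsub>Vp\<^esub> v = \<zero>\<^bsub>Vp\<^esub>"
proof -
  obtain a where a: "v = piV a" using V.surj assms by blast
  define N where "N = 1 + Max (insert 0 ((\<lambda>d. - d) ` degrees a))"
  have "y \<odot>\<^bsub>Vp\<^esub> v = \<zero>\<^bsub>Vp\<^esub>" if k: "k \<ge> N" and y: "y \<in> yangian_grading h1 h2 h3 k" for k y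
  proof -
    obtain b where b: "homog k b" "y = cls b" using y by (auto simp: grading_homog)
    have "b * degree_part d a \<in> vac_ann" if "d \<in> degrees a" for d
    proof (rule homog_positive_ann)
      show "homog (k + d) (b * degree_part d a)" by (intro homog_mult b homog_degree_part)
      have "- d \<le> Max (insert 0 ((\<lambda>d. - d) ` degrees a))" using that by (intro Max_ge) auto
      then show "k + d > 0" using k by (simp add: N_def)
    qed
    then have "(\<Sum>d\<in>degrees a. b * degree_part d a) \<in> vac_ann" by (rule ann.Z_sum)
    then have "b * a \<in> vac_ann" by (simp add: sum_degree_parts flip: sum_distrib_left)
    then show ?thesis by (simp add: a b V.cov_smult piV_zero_iff)
  qed
  then show ?thesis by blast
qed

section \<open>Finite-dimensional graded components\<close>

definition span_mod_ann :: "yangian_gen free_alg set \<Rightarrow> yangian_gen free_alg set" where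
  "span_mod_ann B = {a. \<exists>c. a - (\<Sum>b\<in>B. free_scalar (c b) * b) \<in> vac_ann}"

text \<open>Spanning sets can be lifted to homogeneous elements of the free algebra. In the converse
  direction several elements may have the same image; their coefficients are added up.\<close>

lemma Vgr_fin_dim_iff:
  "yangian_fin_dim h1 h2 h3 Vp (Vgr k) \<longleftrightarrow>
     (\<exists>B. finite B \<and> (\<forall>b\<in>B. homog k b) \<and> {a. homog k a} \<subseteq> span_mod_ann B)"
proof
  assume "yangian_fin_dim h1 h2 h3 Vp (Vgr k)"
  then obtain B where B: "finite B" "B \<subseteq> Vgr k"
    and span: "\<And>v. v \<in> Vgr k \<Longrightarrow> \<exists>c. v = (\<Oplus>\<^bsub>Vp\<^esub>b\<in>B. cls (free_scalar (c b)) \<odot>\<^bsub>Vp\<^esub> b)"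
    unfolding yangian_fin_dim_def by blast
  have "\<forall>b\<in>B. \<exists>x. homog k x \<and> b = piV x" using B(2) by (auto simp: Vgr_eq)
  then obtain r where r: "\<And>b. b \<in> B \<Longrightarrow> homog k (r b)" "\<And>b. b \<in> B \<Longrightarrow> b = piV (r b)" by metis
  have inj: "inj_on r B" using r(2) by (intro inj_onI) metis
  have "a \<in> span_mod_ann (r ` B)" if "homog k a" for a
  proof -
    from span[of "piV a"] that obtain c where
      "piV a = (\<Oplus>\<^bsub>Vp\<^esub>b\<in>B. cls (free_scalar (c b)) \<odot>\<^bsub>Vp\<^esub> b)" by (auto simp: Vgr_eq)
    also have "\<dots> = (\<Oplus>\<^bsub>Vp\<^esub>b\<in>B. piV (free_scalar (c b) * r b))"
    proof (rule V.M.finsum_cong')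
      show "cls (free_scalar (c b)) \<odot>\<^bsub>Vp\<^esub> b = piV (free_scalar (c b) * r b)" if "b \<in> B" for b
        using r(2)[OF that] V.cov_smult[of "free_scalar (c b)" "r b"] by simp
    qed auto
    also have "\<dots> = piV (\<Sum>b\<in>B. free_scalar (c b) * r b)" by (rule V.cov_finsum) (rule B)
    also have "(\<Sum>b\<in>B. free_scalar (c b) * r b) = (\<Sum>x\<in>r ` B. free_scalar (c (the_inv_into B r x)) * x)"
      by (simp add: sum.reindex[OF inj] the_inv_into_f_f[OF inj])
    finally show ?thesis unfolding span_mod_ann_def piV_eq_iff
      by (intro CollectI exI[of _ "\<lambda>x. c (the_inv_into B r x)"])
  qed
  then show "\<exists>B. finite B \<and> (\<forall>b\<in>B. homog k b) \<and> {a. homog k a} \<subseteq> span_mod_ann B"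
    using B(1) r(1) by (intro exI[of _ "r ` B"]) auto
next
  assume "\<exists>B. finite B \<and> (\<forall>b\<in>B. homog k b) \<and> {a. homog k a} \<subseteq> span_mod_ann B"
  then obtain B where B: "finite B" "\<And>b. b \<in> B \<Longrightarrow> homog k b" and span: "\<And>a. homog k a \<Longrightarrow> a \<in> span_mod_ann B"
    by blast
  define r where "r v = (SOME b. b \<in> B \<and> piV b = v)" for v
  have r: "r v \<in> B" "piV (r v) = v" if "v \<in> piV ` B" for v
  proof -
    have "\<exists>b. b \<in> B \<and> piV b = v" using that by blast
    then have "r v \<in> B \<and> piV (r v) = v" unfolding r_def by (rule someI_ex)
    then show "r v \<in> B" "piV (r v) = v" by auto
  qed
  show "yangian_fin_dim h1 h2 h3 Vp (Vgr k)"
    unfolding yangian_fin_dim_def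
  proof (intro exI[of _ "piV ` B"] conjI ballI)
    fix v assume "v \<in> Vgr k"
    then obtain a where a: "homog k a" "v = piV a" by (auto simp: Vgr_eq)
    from span[OF a(1)] obtain c where c: "a - (\<Sum>b\<in>B. free_scalar (c b) * b) \<in> vac_ann" by (auto simp: span_mod_ann_def)
    define c' where "c' u = (\<Sum>b\<in>{b\<in>B. piV b = u}. c b)" for u
    have "(\<Oplus>\<^bsub>Vp\<^esub>u\<in>piV ` B. cls (free_scalar (c' u)) \<odot>\<^bsub>Vp\<^esub> u)
        = (\<Oplus>\<^bsub>Vp\<^esub>u\<in>piV ` B. piV (free_scalar (c' u) * r u))"
    proof (rule V.M.finsum_cong')
      show "cls (free_scalar (c' u)) \<odot>\<^bsub>Vp\<^esub> u = piV (free_scalar (c' u) * r u)" if "u \<in> piV ` B" for u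
        using r(2)[OF that] V.cov_smult[of "free_scalar (c' u)" "r u"] by simp
    qed auto
    also have "\<dots> = piV (\<Sum>u\<in>piV ` B. free_scalar (c' u) * r u)"
      by (rule V.cov_finsum) (use B in auto)
    also have "\<dots> = piV a"
    proof -
      have scalar_sum: "free_scalar (sum c S) = (\<Sum>b\<in>S. free_scalar (c b))" for S
        by (induction S rule: infinite_finite_induct) (auto simp: free_scalar_add)
      have "(\<Sum>b\<in>B. free_scalar (c b) * b) - (\<Sum>u\<in>piV ` B. free_scalar (c' u) * r u)
          = (\<Sum>u\<in>piV ` B. \<Sum>b\<in>{b\<in>B. piV b = u}. free_scalar (c b) * (b - r u))"
        using sum.image_gen[OF B(1), of "\<lambda>b. free_scalar (c b) * b" piV]
        by (simp add: c'_def scalar_sum sum_distrib_right right_diff_distrib sum_subtractf)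
      also have "\<dots> \<in> vac_ann"
      proof (intro ann.Z_sum ann.Z_mult)
        fix u b assume "u \<in> piV ` B" "b \<in> {b \<in> B. piV b = u}"
        then show "b - r u \<in> vac_ann" using r(2)[of u] by (simp flip: piV_eq_iff)
      qed
      finally have "a - (\<Sum>u\<in>piV ` B. free_scalar (c' u) * r u) \<in> vac_ann"
        using ann.Z_add[OF c] by fastforce
      then have "piV a = piV (\<Sum>u\<in>piV ` B. free_scalar (c' u) * r u)" by (simp only: piV_eq_iff)
      then show ?thesis by simp
    qed
    finally show "\<exists>c. v = (\<Oplus>\<^bsub>Vp\<^esub>b\<in>piV ` B. cls (free_scalar (c b)) \<odot>\<^bsub>Vp\<^esub> b)"
      unfolding a(2) by (intro exI[of _ c'], rule sym)
  qed (use B in \<open>auto simp: Vgr_eq\<close>)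
qed

lemma category_O_iff:
  "category_O h1 h2 h3 Vp Vgr \<longleftrightarrow>
     (\<forall>k. \<exists>B. finite B \<and> (\<forall>b\<in>B. homog k b) \<and> {a. homog k a} \<subseteq> span_mod_ann B)"
  unfolding category_O_def Vgr_fin_dim_iff using Vp_graded Vp_locally_finite by blast

lemma span_mod_ann_zero: "a \<in> vac_ann \<Longrightarrow> a \<in> span_mod_ann B"
  by (auto simp: span_mod_ann_def intro!: exI[of _ "\<lambda>_. 0"])

lemma span_mod_ann_add:
  assumes "a \<in> span_mod_ann B" "b \<in> span_mod_ann B"
  shows "a + b \<in> span_mod_ann B"
proof -
  obtain c where c: "a - (\<Sum>x\<in>B. free_scalar (c x) * x) \<in> vac_ann" using assms by (auto simp: span_mod_ann_def)
  obtain c' where c': "b - (\<Sum>x\<in>B. free_scalar (c' x) * x) \<in> vac_ann" using assms by (auto simp: span_mod_ann_def)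
  show ?thesis using ann.Z_add[OF c c']
    by (auto simp: span_mod_ann_def free_scalar_add distrib_right sum.distrib algebra_simps intro!: exI[of _ "\<lambda>x. c x + c' x"])
qed

lemma span_mod_ann_scale:
  assumes "a \<in> span_mod_ann B"
  shows "free_scalar t * a \<in> span_mod_ann B"
proof -
  obtain c where c: "a - (\<Sum>x\<in>B. free_scalar (c x) * x) \<in> vac_ann" using assms by (auto simp: span_mod_ann_def)
  show ?thesis using ann.Z_mult[OF c, of "free_scalar t"]
    by (auto simp: span_mod_ann_def free_scalar_mult right_diff_distrib sum_distrib_left mult.assoc intro!: exI[of _ "\<lambda>x. t * c x"])
qed

lemma span_mod_ann_sum: "(\<And>i. i \<in> I \<Longrightarrow> g i \<in> span_mod_ann B) \<Longrightarrow> sum g I \<in> span_mod_ann B"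
  by (induction I rule: infinite_finite_induct) (auto intro: span_mod_ann_add span_mod_ann_zero ann.Z_zero)

lemma span_mod_ann_base: "finite B \<Longrightarrow> b \<in> B \<Longrightarrow> b \<in> span_mod_ann B"
proof -
  assume B: "finite B" "b \<in> B"
  have "(\<Sum>x\<in>B. free_scalar (if x = b then 1 else 0) * x) = (\<Sum>x\<in>B. if x = b then x else 0)"
    by (rule sum.cong) auto
  also have "\<dots> = b" using B by simp
  finally show ?thesis by (auto simp: span_mod_ann_def ann.Z_zero intro!: exI[of _ "\<lambda>x. if x = b then 1 else 0"])
qed

lemma span_mod_ann_cong: "a - b \<in> vac_ann \<Longrightarrow> b \<in> span_mod_ann B \<Longrightarrow> a \<in> span_mod_ann B"
  using span_mod_ann_add[OF span_mod_ann_zero[of "a - b" B], of b] by simp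

end

section \<open>Linear recurrences with constant coefficients\<close>

text \<open>The polynomial \<open>q\<close> applied to the shift of sequences; a sequence satisfies the recurrence \<open>q\<close>
  iff it is annihilated.\<close>

definition rec_op :: "complex poly \<Rightarrow> (nat \<Rightarrow> complex) \<Rightarrow> nat \<Rightarrow> complex" where
  "rec_op q s m = (\<Sum>i\<le>degree q. coeff q i * s (m + i))"

lemma rec_op_bound: "degree q \<le> n \<Longrightarrow> rec_op q s m = (\<Sum>i\<le>n. coeff q i * s (m + i))"
  unfolding rec_op_def by (rule sum.mono_neutral_left) (auto simp: coeff_eq_0)

lemma rec_op_0 [simp]: "rec_op 0 s m = 0"
  by (simp add: rec_op_def)

lemma rec_op_pCons: "rec_op (pCons a q) s m = a * s m + rec_op q s (Suc m)"
proof -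
  have "rec_op (pCons a q) s m = (\<Sum>i\<le>Suc (degree q). coeff (pCons a q) i * s (m + i))"
    by (rule rec_op_bound) (simp add: degree_pCons_eq_if)
  also have "\<dots> = a * s m + (\<Sum>i\<le>degree q. coeff q i * s (Suc m + i))"
    by (subst sum.atMost_Suc_shift) simp
  finally show ?thesis by (simp add: rec_op_def)
qed

lemma rec_op_add: "rec_op (q + r) s m = rec_op q s m + rec_op r s m"
  using rec_op_bound[of "q + r" "max (degree q) (degree r)" s m]
    rec_op_bound[of q "max (degree q) (degree r)" s m] rec_op_bound[of r "max (degree q) (degree r)" s m]
  by (simp add: degree_add_le_max distrib_right sum.distrib)

lemma rec_op_smult: "rec_op (smult c q) s m = c * rec_op q s m"
  using rec_op_bound[of "smult c q" "degree q" s m]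
  by (simp add: rec_op_def degree_smult_le sum_distrib_left mult.assoc)

lemma rec_op_mult: "rec_op (q * r) s m = rec_op q (rec_op r s) m"
proof (induction q arbitrary: m)
  case (pCons a q)
  then show ?case by (simp add: rec_op_add rec_op_smult rec_op_pCons)
qed simp

lemma rec_op_monom: "rec_op (monom c j) s m = c * s (m + j)"
proof (cases "c = 0")
  case False
  have "rec_op (monom c j) s m = (\<Sum>i\<le>j. if i = j then c * s (m + i) else 0)"
    unfolding rec_op_bound[OF degree_monom_le] by (rule sum.cong) auto
  then show ?thesis by simp
qed simp

lemma rec_op_sum: "rec_op (sum q I) s m = (\<Sum>i\<in>I. rec_op (q i) s m)"
  by (induction I rule: infinite_finite_induct) (auto simp: rec_op_add)

lemma rec_op_seq_add: "rec_op q (\<lambda>i. s i + t i) m = rec_op q s m + rec_op q t m"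
  and rec_op_seq_diff: "rec_op q (\<lambda>i. s i - t i) m = rec_op q s m - rec_op q t m"
  and rec_op_seq_scale: "rec_op q (\<lambda>i. c * s i) m = c * rec_op q s m"
  by (simp_all add: rec_op_def algebra_simps sum.distrib sum_subtractf sum_distrib_left)

lemma rec_op_shift: "rec_op q (\<lambda>i. s (i + k)) m = rec_op q s (m + k)"
  by (simp add: rec_op_def algebra_simps)

lemma rec_op_zero_seq: "(\<And>i. s i = 0) \<Longrightarrow> rec_op q s m = 0"
  by (simp add: rec_op_def)

definition cubic_diff :: "complex \<Rightarrow> complex \<Rightarrow> (nat \<Rightarrow> nat \<Rightarrow> complex) \<Rightarrow> nat \<Rightarrow> nat \<Rightarrow> complex" where
  "cubic_diff s2 s3 u i j = u (i + 3) j - 3 * u (i + 2) (j + 1) + 3 * u (i + 1) (j + 2) - u i (j + 3)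
     + s2 * (u (i + 1) j - u i (j + 1)) - s3 * u i j"

lemma cubic_diff_rec_op:
  "cubic_diff s2 s3 (\<lambda>i j. rec_op q (\<lambda>i. u i j) i) i j = rec_op q (\<lambda>i. cubic_diff s2 s3 u i j) i"
proof -
  have "rec_op q (\<lambda>i. u (i + k) j) i = rec_op q (\<lambda>i. u i j) (i + k)" for k i j
    by (rule rec_op_shift)
  then show ?thesis
    by (simp only: cubic_diff_def rec_op_seq_add rec_op_seq_diff rec_op_seq_scale)
qed

text \<open>Write \<open>S\<close>, \<open>T\<close> for the two index shifts and \<open>P(S - T)\<close> for the operator in \<open>cubic_diff\<close>. From
  \<open>\<alpha>(T) u = 0\<close> and \<open>\<beta>(S) P(S - T) u = 0\<close> one eliminates \<open>T\<close>. For \<open>\<alpha> = T - z\<close> the shift \<open>T\<close> acts as the number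
  \<open>z\<close>, giving \<open>\<beta>(S) P(S - z) u = 0\<close>; the induction splits off one root of \<open>\<alpha>\<close> at a time.\<close>

lemma recurrence_elimination:
  assumes "\<alpha> \<noteq> 0" "\<beta> \<noteq> 0"
  shows "\<exists>\<gamma>. \<gamma> \<noteq> 0 \<and> (\<forall>u. (\<forall>i j. rec_op \<alpha> (\<lambda>j. u i j) j = 0) \<longrightarrow>
     (\<forall>i j. rec_op \<beta> (\<lambda>i. cubic_diff s2 s3 u i j) i = 0) \<longrightarrow> (\<forall>i j. rec_op \<gamma> (\<lambda>i. u i j) i = 0))"
  using assms(1)
proof (induction "degree \<alpha>" arbitrary: \<alpha>)
  case 0
  then obtain a where a: "\<alpha> = [:a:]" "a \<noteq> 0" by (metis degree_eq_zeroE pCons_eq_0_iff)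
  show ?case by (rule exI[of _ 1]) (auto simp: a rec_op_pCons one_pCons)
next
  case (Suc n)
  have "\<not> constant (poly \<alpha>)" using Suc.hyps(2) by (simp add: constant_degree)
  then obtain z where "poly \<alpha> z = 0" using fundamental_theorem_of_algebra by blast
  then obtain \<alpha>' where \<alpha>': "\<alpha> = [:- z, 1:] * \<alpha>'" by (metis dvdE poly_eq_0_iff_dvd)
  have "\<alpha>' \<noteq> 0" using Suc.prems \<alpha>' by auto
  then have "degree \<alpha>' = n" using Suc.hyps(2) unfolding \<alpha>' by (subst (asm) degree_mult_eq) auto
  from Suc.hyps(1)[OF this[symmetric] \<open>\<alpha>' \<noteq> 0\<close>] obtain \<gamma> where \<gamma>: "\<gamma> \<noteq> 0"
    and IH: "\<And>u. (\<forall>i j. rec_op \<alpha>' (\<lambda>j. u i j) j = 0) \<Longrightarrow>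
     (\<forall>i j. rec_op \<beta> (\<lambda>i. cubic_diff s2 s3 u i j) i = 0) \<Longrightarrow> (\<forall>i j. rec_op \<gamma> (\<lambda>i. u i j) i = 0)"
    by blast
  \<comment> \<open>The coefficients of \<open>P(S - z)\<close> as a polynomial in \<open>S\<close>.\<close>
  define \<kappa> where "\<kappa> = [:- (z ^ 3) - s2 * z - s3, 3 * z ^ 2 + s2, - 3 * z, 1:]"
  show ?case
  proof (intro exI[of _ "\<beta> * (\<kappa> * \<gamma>)"] conjI allI impI)
    have "\<kappa> \<noteq> 0" by (simp add: \<kappa>_def)
    then show "\<beta> * (\<kappa> * \<gamma>) \<noteq> 0" using assms(2) \<gamma> by simp
    fix u i j
    assume u: "\<forall>i j. rec_op \<alpha> (\<lambda>j. u i j) j = 0"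
      and cu: "\<forall>i j. rec_op \<beta> (\<lambda>i. cubic_diff s2 s3 u i j) i = 0"
    define u' where "u' i j = u i (j + 1) - z * u i j" for i j
    have "rec_op \<alpha>' (u' i) j = 0" for i j
    proof -
      have "u' i = rec_op [:- z, 1:] (u i)" by (auto simp: u'_def rec_op_pCons)
      then have "rec_op \<alpha>' (u' i) j = rec_op \<alpha> (u i) j"
        unfolding \<alpha>' by (simp only: mult.commute[of "[:- z, 1:]"] rec_op_mult)
      then show ?thesis using u by simp
    qed
    moreover have "rec_op \<beta> (\<lambda>i. cubic_diff s2 s3 u' i j) i = 0" for i j
    proof -
      have "cubic_diff s2 s3 u' i j = cubic_diff s2 s3 u i (j + 1) - z * cubic_diff s2 s3 u i j" for i j
        by (simp add: cubic_diff_def u'_def algebra_simps)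
      then show ?thesis using cu by (simp add: rec_op_seq_diff rec_op_seq_scale)
    qed
    ultimately have \<gamma>u: "rec_op \<gamma> (\<lambda>i. u' i j) i = 0" for i j using IH[of u'] by blast
    define v where "v i j = rec_op \<gamma> (\<lambda>i. u i j) i" for i j
    have step: "v i (Suc j) = z * v i j" for i j
      using \<gamma>u[where i = i and j = j] by (simp add: u'_def v_def rec_op_seq_diff rec_op_seq_scale)
    have "cubic_diff s2 s3 v i j = rec_op \<kappa> (\<lambda>i. v i j) i" for i j
      by (simp add: cubic_diff_def \<kappa>_def rec_op_pCons step eval_nat_numeral algebra_simps)
    moreover have "cubic_diff s2 s3 v i j = rec_op \<gamma> (\<lambda>i. cubic_diff s2 s3 u i j) i" for i j
      unfolding v_def by (rule cubic_diff_rec_op)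
    ultimately have "rec_op \<kappa> (\<lambda>i. v i j) = rec_op \<gamma> (\<lambda>i. cubic_diff s2 s3 u i j)" for j by auto
    moreover have "rec_op (\<beta> * (\<kappa> * \<gamma>)) (\<lambda>i. u i j) i = rec_op \<beta> (rec_op \<kappa> (\<lambda>i. v i j)) i"
      unfolding rec_op_mult v_def by (simp add: rec_op_mult[abs_def])
    moreover have "rec_op \<beta> (rec_op \<gamma> (\<lambda>i. cubic_diff s2 s3 u i j)) i
        = rec_op \<gamma> (rec_op \<beta> (\<lambda>i. cubic_diff s2 s3 u i j)) i"
      by (simp only: rec_op_mult[symmetric] mult.commute)
    ultimately show "rec_op (\<beta> * (\<kappa> * \<gamma>)) (\<lambda>i. u i j) i = 0"
      using cu by (simp add: rec_op_zero_seq)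
  qed
qed

text \<open>A homogeneous linear system with more unknowns than equations, by Gaussian elimination.\<close>

lemma linear_dependence:
  fixes c :: "'j \<Rightarrow> 'b \<Rightarrow> complex"
  assumes "finite B" "finite J" "card B < card J"
  shows "\<exists>a. (\<exists>j\<in>J. a j \<noteq> 0) \<and> (\<forall>b\<in>B. (\<Sum>j\<in>J. a j * c j b) = 0)"
  using assms
proof (induction B arbitrary: J c rule: finite_induct)
  case empty
  then obtain j where "j \<in> J" by fastforce
  then show ?case by (intro exI[of _ "\<lambda>_. 1"]) auto
next
  case (insert b B)
  show ?case
  proof (cases "\<forall>j\<in>J. c j b = 0")
    case True
    from insert.IH[of J c] insert.prems insert.hyps obtain a where
      "\<exists>j\<in>J. a j \<noteq> 0" "\<forall>b\<in>B. (\<Sum>j\<in>J. a j * c j b) = 0" by auto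
    then show ?thesis using True by (intro exI[of _ a]) simp
  next
    case False
    then obtain q where q: "q \<in> J" "c q b \<noteq> 0" by blast
    define c' where "c' j x = c j x - c j b / c q b * c q x" for j x
    have "card B < card (J - {q})" using insert q by simp
    then obtain a where a: "\<exists>j\<in>J - {q}. a j \<noteq> 0" "\<forall>x\<in>B. (\<Sum>j\<in>J - {q}. a j * c' j x) = 0"
      using insert.IH[of "J - {q}" c'] insert.prems by auto
    define a' where "a' = a(q := - (\<Sum>j\<in>J - {q}. a j * (c j b / c q b)))"
    have sum: "(\<Sum>j\<in>J. a' j * c j x) = (\<Sum>j\<in>J - {q}. a j * c' j x)" for x
    proof -
      have "(\<Sum>j\<in>J. a' j * c j x) = a' q * c q x + (\<Sum>j\<in>J - {q}. a' j * c j x)"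
        using insert.prems q by (simp add: sum.remove)
      also have "(\<Sum>j\<in>J - {q}. a' j * c j x) = (\<Sum>j\<in>J - {q}. a j * c j x)"
        by (rule sum.cong) (auto simp: a'_def)
      finally show ?thesis
        by (simp add: a'_def c'_def right_diff_distrib sum_subtractf sum_distrib_right mult.assoc)
    qed
    have "c' j b = 0" for j using q by (simp add: c'_def)
    then have "\<forall>x\<in>insert b B. (\<Sum>j\<in>J. a' j * c j x) = 0" using a(2) by (simp add: sum)
    moreover have "\<exists>j\<in>J. a' j \<noteq> 0" using a(1) by (auto simp: a'_def)
    ultimately show ?thesis by blast
  qed
qed

section \<open>Expansions of rational functions at infinity\<close>

notation fls_nth (infixl \<open>$$\<close> 75)

lemma poly_at_infinity_0 [simp]: "poly_at_infinity 0 = 0"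
  by (simp add: poly_at_infinity_def)

lemma poly_at_infinity_pCons:
  "poly_at_infinity (pCons c a) = fls_const c + fls_X_inv * poly_at_infinity a"
  by (cases "pCons c a = 0") (auto simp: poly_at_infinity_def map_poly_pCons)

lemma poly_at_infinity_times_nth:
  "(poly_at_infinity a * g) $$ n = (\<Sum>i\<le>degree a. coeff a i * g $$ (n + int i))"
proof (induction a arbitrary: n)
  case (pCons c a)
  have "(poly_at_infinity (pCons c a) * g) $$ n = c * g $$ n + (\<Sum>i\<le>degree a. coeff a i * g $$ (n + 1 + int i))"
    by (simp only: poly_at_infinity_pCons distrib_right mult.assoc fls_X_inv_times_conv_shift(1)[of "poly_at_infinity a * g"] fls_plus_nth
        fls_shift_nth fls_mult_const_nth pCons.IH)
  also have "\<dots> = (\<Sum>i\<le>Suc (degree a). coeff (pCons c a) i * g $$ (n + int i))"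
    by (subst sum.atMost_Suc_shift) (simp add: add.assoc)
  also have "\<dots> = (\<Sum>i\<le>degree (pCons c a). coeff (pCons c a) i * g $$ (n + int i))"
    by (rule sum.mono_neutral_right) (auto simp: degree_pCons_eq_if coeff_eq_0 split: nat.splits)
  finally show ?case .
qed simp

lemma poly_at_infinity_nth: "poly_at_infinity a $$ n = (if n \<le> 0 then coeff a (nat (- n)) else 0)"
proof -
  have "poly_at_infinity a $$ n = (\<Sum>i\<le>degree a. if i = nat (- n) \<and> n \<le> 0 then coeff a i else 0)"
    using poly_at_infinity_times_nth[of a 1 n]
    by (simp only: mult_1_right) (rule sum.cong, auto)
  also have "\<dots> = (if n \<le> 0 then coeff a (nat (- n)) else 0)"
    by (auto simp: coeff_eq_0)
  finally show ?thesis .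
qed

lemma poly_at_infinity_mult: "poly_at_infinity (a * b) = poly_at_infinity a * poly_at_infinity b"
proof (induction a)
  case (pCons c a)
  have add: "poly_at_infinity (x + y) = poly_at_infinity x + poly_at_infinity y"
    and smult: "poly_at_infinity (smult c x) = fls_const c * poly_at_infinity x" for x y
    by (auto simp: fls_eq_iff poly_at_infinity_nth)
  show ?case by (simp add: add smult poly_at_infinity_pCons pCons.IH distrib_right mult.assoc)
qed simp

lemma poly_at_infinity_eq_0_iff [simp]: "poly_at_infinity a = 0 \<longleftrightarrow> a = 0"
proof
  assume "poly_at_infinity a = 0"
  then have "poly_at_infinity a $$ (- int (degree a)) = 0" by simp
  then show "a = 0" by (simp add: poly_at_infinity_nth)
qed simp

lemma weight_series_nth:
  "weight_series p $$ n = (if n = 0 then 1 else if n > 0 then p (nat n - 1) else 0)"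
  by (auto simp: weight_series_def split: nat.splits)

text \<open>The coefficients of the negative powers of \<open>z\<close> in \<open>q(z) p(z)\<close> are the terms of the recurrence;
  the constant term \<open>1\<close> of \<open>p(z)\<close> contributes only to the polynomial part. It makes numerator and
  denominator agree in degree and leading coefficient, which is the condition at infinity.\<close>

lemma rational_iff_recurrent:
  "(\<exists>P. weight_series p = ratfun_expansion P \<and> ratfun_at_infinity P 1) \<longleftrightarrow>
     (\<exists>q. q \<noteq> 0 \<and> (\<forall>m. rec_op q p m = 0))"
proof
  assume "\<exists>P. weight_series p = ratfun_expansion P \<and> ratfun_at_infinity P 1"
  then obtain P where P: "weight_series p = ratfun_expansion P" by blast
  define a b where "a = fst (quot_of_fract P)" and "b = snd (quot_of_fract P)"
  have "b \<noteq> 0" by (simp add: b_def)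
  then have ab: "poly_at_infinity b * weight_series p = poly_at_infinity a"
    by (simp add: P ratfun_expansion_def flip: a_def b_def)
  have "rec_op b p m = 0" for m
  proof -
    have "rec_op b p m = (poly_at_infinity b * weight_series p) $$ (int m + 1)"
      unfolding poly_at_infinity_times_nth rec_op_def
      by (rule sum.cong) (auto simp: weight_series_nth nat_add_distrib)
    then show ?thesis by (simp add: ab poly_at_infinity_nth)
  qed
  with \<open>b \<noteq> 0\<close> show "\<exists>q. q \<noteq> 0 \<and> (\<forall>m. rec_op q p m = 0)" by blast
next
  assume "\<exists>q. q \<noteq> 0 \<and> (\<forall>m. rec_op q p m = 0)"
  then obtain q where q: "q \<noteq> 0" "\<And>m. rec_op q p m = 0" by blast
  let ?g = "poly_at_infinity q * weight_series p"
  define a where "a = (\<Sum>k\<le>degree q. monom (?g $$ (- int k)) k)"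
  have coeff_a: "coeff a k = (if k \<le> degree q then ?g $$ (- int k) else 0)" for k
    by (simp add: a_def coeff_sum)
  have g_pos: "?g $$ n = 0" if "n > 0" for n
  proof -
    have "?g $$ n = rec_op q p (nat n - 1)"
      unfolding poly_at_infinity_times_nth rec_op_def
      by (rule sum.cong) (use that in \<open>auto simp: weight_series_nth nat_add_distrib\<close>)
    then show ?thesis by (simp add: q)
  qed
  have g_neg: "?g $$ (- int k) = (if k = degree q then lead_coeff q else 0)" if "k \<ge> degree q" for k
  proof -
    have "?g $$ (- int k) = (\<Sum>i\<le>degree q. if i = k then lead_coeff q else 0)"
      unfolding poly_at_infinity_times_nth
      by (rule sum.cong) (use that in \<open>auto simp: weight_series_nth\<close>)
    then show ?thesis using that by auto
  qed
  have aq: "poly_at_infinity a = ?g"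
  proof (rule fls_eqI)
    fix n
    show "poly_at_infinity a $$ n = ?g $$ n"
    proof (cases "n > 0")
      case False
      then have "n = - int (nat (- n))" by simp
      then show ?thesis
        using g_neg[of "nat (- n)"] False by (auto simp: poly_at_infinity_nth coeff_a)
    qed (simp add: poly_at_infinity_nth g_pos)
  qed
  have lead: "coeff a (degree q) = lead_coeff q" by (simp add: coeff_a g_neg)
  have deg: "degree a = degree q"
  proof (rule antisym)
    show "degree a \<le> degree q" by (rule degree_le) (simp add: coeff_a)
    show "degree q \<le> degree a" using lead q(1) by (intro le_degree) simp
  qed
  define a' b' where "a' = fst (quot_of_fract (Fract a q))" and "b' = snd (quot_of_fract (Fract a q))"
  have "b' \<noteq> 0" by (simp add: b'_def)
  have cross: "a' * q = a * b'"
  proof -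
    have "Fract a' b' = Fract a q" unfolding a'_def b'_def by (rule Fract_quot_of_fract)
    then show ?thesis using \<open>b' \<noteq> 0\<close> q(1) by (simp add: eq_fract)
  qed
  have "weight_series p = poly_at_infinity a' / poly_at_infinity b'"
  proof -
    have "poly_at_infinity b' * ?g = poly_at_infinity a' * poly_at_infinity q"
      using arg_cong[OF cross, of poly_at_infinity] by (simp add: poly_at_infinity_mult mult.commute flip: aq)
    then have "poly_at_infinity b' * weight_series p = poly_at_infinity a'"
      using q(1) by simp
    then show ?thesis using \<open>b' \<noteq> 0\<close> by (metis nonzero_mult_div_cancel_left poly_at_infinity_eq_0_iff)
  qed
  moreover have "((\<lambda>z. poly a' z / poly b' z) \<longlongrightarrow> 1) at_infinity"
  proof -
    have "a \<noteq> 0" using lead q(1) by auto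
    have "a' \<noteq> 0" using cross \<open>a \<noteq> 0\<close> \<open>b' \<noteq> 0\<close> by auto
    have "degree a' + degree q = degree a + degree b'"
      using arg_cong[OF cross, of degree] q(1) \<open>a \<noteq> 0\<close> \<open>a' \<noteq> 0\<close> \<open>b' \<noteq> 0\<close> by (simp add: degree_mult_eq)
    then have deg': "degree a' = degree b'" using deg by simp
    have "lead_coeff a' * lead_coeff q = lead_coeff a * lead_coeff b'"
      using arg_cong[OF cross, of lead_coeff] by (simp add: lead_coeff_mult)
    then have lead': "lead_coeff a' = lead_coeff b'" using lead deg q(1) by simp
    have "((\<lambda>z. (poly a' z / z ^ degree a') / (poly b' z / z ^ degree b')) \<longlongrightarrow> lead_coeff a' / lead_coeff b') at_infinity"
      using \<open>b' \<noteq> 0\<close> by (intro tendsto_divide poly_divide_tendsto_aux) simp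
    moreover have "\<forall>\<^sub>F z in at_infinity. (poly a' z / z ^ degree a') / (poly b' z / z ^ degree b') = poly a' z / poly b' z"
      by (rule eventually_at_infinityI[of 1]) (auto simp: deg')
    ultimately show ?thesis using lead' \<open>b' \<noteq> 0\<close> by (simp add: tendsto_cong)
  qed
  ultimately show "\<exists>P. weight_series p = ratfun_expansion P \<and> ratfun_at_infinity P 1"
    by (intro exI[of _ "Fract a q"])
       (simp add: ratfun_expansion_def ratfun_at_infinity_def ratfun_eval_def[abs_def] a'_def b'_def)
qed

section \<open>Membership in the category O\<close>

context yangian_model
begin

definition e_rec :: "int \<Rightarrow> complex poly \<Rightarrow> bool" where
  "e_rec d \<alpha> \<longleftrightarrow> (\<forall>a w m. ann.spanned d a \<longrightarrow> rec_op \<alpha> (\<lambda>j. coef (app (E_op j) (app (rho a) vac)) w) m = 0)"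

definition psi_rec :: "int \<Rightarrow> complex poly \<Rightarrow> bool" where
  "psi_rec d \<beta> \<longleftrightarrow> (\<forall>a w m. ann.spanned d a \<longrightarrow> rec_op \<beta> (\<lambda>i. coef (app (P_op (i + 8)) (app (rho a) vac)) w) m = 0)"

lemma rec_op_app:
  assumes "\<And>w m. rec_op q (\<lambda>j. coef (\<phi> j) w) m = 0"
  shows "rec_op q (\<lambda>j. coef (app A (\<phi> j)) w) m = 0"
proof -
  have "(\<Sum>i\<le>degree q. fscale (coeff q i) (\<phi> (m + i))) = 0"
    by (rule wordfun_eqI) (use assms in \<open>simp add: coef_sum rec_op_def\<close>)
  then have "coef (app A (\<Sum>i\<le>degree q. fscale (coeff q i) (\<phi> (m + i)))) w = 0" by simp
  then show ?thesis by (simp add: app_sum app_fscale coef_sum rec_op_def)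
qed

lemma psi_rec_0:
  assumes "\<And>m. rec_op q p m = 0"
  shows "psi_rec 0 q"
  unfolding psi_rec_def
proof (intro allI impI)
  fix a w m assume "ann.spanned 0 a"
  then obtain c where "a - free_scalar c \<in> vac_ann" using ann.spanned_nonneg by blast
  then have "app (rho a) vac = fscale c vac" by (simp add: vac_ann_def rho_diff)
  then show "rec_op q (\<lambda>i. coef (app (P_op (i + 8)) (app (rho a) vac)) w) m = 0"
    by (simp add: app_fscale P_vac mult.assoc mult.commute[of "p _"] rec_op_seq_scale assms)
qed

lemma e_rec_positive: "d > 0 \<Longrightarrow> e_rec d q"
  using ann.spanned_nonneg by (auto simp: e_rec_def vac_ann_def rec_op_zero_seq)

text \<open>Evaluate at the empty word, where the image of \<open>e\<^sub>j\<close> vanishes, and at \<open>k # u\<close>, where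
  \<open>f\<^sub>k e\<^sub>j = e\<^sub>j f\<^sub>k - \<psi>\<^sub>j\<^sub>+\<^sub>k\<close> leaves a sequence killed by \<open>\<alpha>\<close> and one killed by \<open>\<beta>\<close>.\<close>

lemma e_rec_step:
  assumes "e_rec (d + 1) \<alpha>" "psi_rec d \<beta>"
  shows "e_rec d (\<alpha> * \<beta>)"
  unfolding e_rec_def
proof (intro allI impI)
  fix a w m assume a: "ann.spanned d a"
  let ?\<phi> = "app (rho a) vac"
  show "rec_op (\<alpha> * \<beta>) (\<lambda>j. coef (app (E_op j) ?\<phi>) w) m = 0"
  proof (cases w)
    case Nil
    then show ?thesis by (simp add: coef_E rec_op_zero_seq)
  next
    case (Cons k u)
    have FE: "coef (app (E_op j) ?\<phi>) w = coef (app (E_op j) (app (rho (f_gen k * a)) vac)) u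
       - coef (app (P_op ((j + k) + 8)) ?\<phi>) u" for j
    proof -
      have "F_op k * E_op j = E_op j * F_op k - P_op (j + k + 8)" by (simp add: E_F)
      then have "app (F_op k) (app (E_op j) ?\<phi>) = app (E_op j) (app (F_op k) ?\<phi>) - app (P_op (j + k + 8)) ?\<phi>"
        by (metis app_simps(4,6))
      then have "coef (app (F_op k) (app (E_op j) ?\<phi>)) u = coef (app (E_op j) (app (F_op k) ?\<phi>)) u - coef (app (P_op (j + k + 8)) ?\<phi>) u"
        by simp
      then show ?thesis by (simp add: Cons rho_mult)
    qed
    let ?s = "\<lambda>j. coef (app (E_op j) (app (rho (f_gen k * a)) vac)) u"
    let ?t = "\<lambda>j. coef (app (P_op (j + 8)) ?\<phi>) u"
    have "rec_op \<alpha> ?s = (\<lambda>_. 0)"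
      using assms(1) ann.spanned_f[OF a] by (auto simp: e_rec_def)
    then have s: "rec_op (\<alpha> * \<beta>) ?s m = 0" for m
      by (simp add: mult.commute[of \<alpha>] rec_op_mult rec_op_zero_seq)
    have "rec_op \<beta> ?t = (\<lambda>_. 0)"
      using assms(2) a by (auto simp: psi_rec_def)
    then have t: "rec_op (\<alpha> * \<beta>) ?t m = 0" for m
      by (simp add: rec_op_mult rec_op_zero_seq)
    show ?thesis
      unfolding FE rec_op_seq_diff using s[of m] t[of "m + k"] rec_op_shift[of "\<alpha> * \<beta>" ?t k m] by simp
  qed
qed

lemma coef_cubdiff:
  "coef (app (cubdiff s t U i j) \<phi>) w = cubic_diff s t (\<lambda>i j. coef (app (U i j) \<phi>) w) i j"
proof -
  have "app (1 + 1 + 1) \<psi> = \<psi> + \<psi> + \<psi>" for \<psi> by (simp only: app_simps)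
  then have "app 3 \<psi> = \<psi> + \<psi> + \<psi>" for \<psi> by simp
  then show ?thesis by (simp add: cubdiff_def cubic_diff_def)
qed

text \<open>The sequence \<open>\<psi>\<^sub>i e\<^sub>j \<phi>\<close> satisfies \<open>\<alpha>\<close> in \<open>j\<close>. The exchange relation turns the cubic applied to it
  into a cubic applied to \<open>e\<^sub>j \<psi>\<^sub>i \<phi>\<close>, which satisfies \<open>\<beta>\<close> in \<open>i\<close>; so \<open>recurrence_elimination\<close>
  applies.\<close>

lemma psi_rec_step:
  assumes \<alpha>: "e_rec d \<alpha>" "\<alpha> \<noteq> 0" and \<beta>: "psi_rec d \<beta>" "\<beta> \<noteq> 0" and d: "d \<le> 0"
  shows "\<exists>\<gamma>. \<gamma> \<noteq> 0 \<and> psi_rec (d - 1) \<gamma>"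
proof -
  let ?s2 = "sigma2 h1 h2 h3" and ?s3 = "sigma3 h1 h2 h3"
  obtain \<gamma> where \<gamma>: "\<gamma> \<noteq> 0"
    and elim: "\<And>u. \<forall>i j. rec_op \<alpha> (\<lambda>j. u i j) j = 0 \<Longrightarrow>
      \<forall>i j. rec_op \<beta> (\<lambda>i. cubic_diff ?s2 ?s3 u i j) i = 0 \<Longrightarrow> \<forall>i j. rec_op \<gamma> (\<lambda>i. u i j) i = 0"
    using recurrence_elimination[OF \<alpha>(2) \<beta>(2), of ?s2 ?s3] by blast
  have after_e: "rec_op \<gamma> (\<lambda>i. coef (app (P_op (i + 8)) (app (E_op j) (app (rho a) vac))) w) m = 0"
    if a: "ann.spanned d a" for a j w m
  proof -
    let ?\<phi> = "app (rho a) vac"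
    let ?u = "\<lambda>i j. coef (app (P_op (i + 8)) (app (E_op j) ?\<phi>)) w"
    have 1: "\<forall>i j. rec_op \<alpha> (\<lambda>j. ?u i j) j = 0"
      by (intro allI rec_op_app) (use \<alpha>(1) a in \<open>auto simp: e_rec_def\<close>)
    have "cubic_diff ?s2 ?s3 ?u i j
        = cubic_diff ?s2 (- ?s3) (\<lambda>i j. coef (app (E_op j) (app (P_op (i + 8)) ?\<phi>)) w) i j" for i j
      using arg_cong[OF E.rel_ge[of 0 i j], of "\<lambda>A. coef (app A ?\<phi>) w"] by (simp add: coef_cubdiff)
    moreover have "rec_op \<beta> (\<lambda>i. cubic_diff ?s2 (- ?s3) (\<lambda>i j. coef (app (E_op j) (app (P_op (i + 8)) ?\<phi>)) w) i j) i = 0" for i j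
    proof -
      have "rec_op \<beta> (\<lambda>i. coef (app (E_op j) (app (P_op (i + 8)) ?\<phi>)) w) i = 0" for i j
        by (rule rec_op_app) (use \<beta>(1) a in \<open>auto simp: psi_rec_def\<close>)
      then show ?thesis
        by (subst cubic_diff_rec_op[symmetric]) (simp add: cubic_diff_def)
    qed
    ultimately have 2: "\<forall>i j. rec_op \<beta> (\<lambda>i. cubic_diff ?s2 ?s3 ?u i j) i = 0" by simp
    show ?thesis using elim[OF 1 2] by blast
  qed
  have "rec_op \<gamma> (\<lambda>i. coef (app (P_op (i + 8)) (app (rho a) vac)) w) m = 0"
    if "ann.spanned d' a" "d' = d - 1" for d' a w m
    using that
  proof (induction rule: ann.spanned.induct)
    case (null a d')
    then show ?case by (simp add: vac_ann_def rec_op_zero_seq)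
  next
    case (scalar c)
    then show ?case using d by simp
  next
    case (add d' a b)
    then show ?case by (simp add: rho_add app_add rec_op_seq_add)
  next
    case (e d'' a d' j)
    then have "ann.spanned d a" by simp
    from after_e[OF this, of j w m] show ?case by (simp add: rho_mult)
  qed
  then show ?thesis using \<gamma> by (auto simp: psi_rec_def)
qed

lemma recurrences_exist:
  assumes "q \<noteq> 0" "\<And>m. rec_op q p m = 0"
  shows "\<exists>\<alpha> \<beta>. \<alpha> \<noteq> 0 \<and> \<beta> \<noteq> 0 \<and> e_rec (- int n) \<alpha> \<and> psi_rec (- int n) \<beta>"
proof (induction n)
  case 0
  have "e_rec 0 (1 * q)" by (rule e_rec_step) (auto intro: e_rec_positive psi_rec_0 assms)
  then show ?case using psi_rec_0[of q] assms by auto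
next
  case (Suc n)
  then obtain \<alpha> \<beta> where ab: "\<alpha> \<noteq> 0" "\<beta> \<noteq> 0" "e_rec (- int n) \<alpha>" "psi_rec (- int n) \<beta>" by blast
  obtain \<gamma> where \<gamma>: "\<gamma> \<noteq> 0" "psi_rec (- int n - 1) \<gamma>"
    using psi_rec_step[OF ab(3,1,4,2)] by auto
  moreover have "e_rec (- int n - 1) (\<alpha> * \<gamma>)"
    by (rule e_rec_step) (use ab \<gamma> in simp_all)
  moreover have "- int (Suc n) = - int n - 1" by simp
  ultimately show ?case using ab(1) by (metis no_zero_divisors)
qed

text \<open>The recurrence, divided by its leading coefficient, expresses \<open>e\<^sub>j b\<close> by \<open>e\<^sub>i b\<close> with smaller
  \<open>i\<close>.\<close>

lemma e_reduction:
  assumes \<alpha>: "e_rec d \<alpha>" "\<alpha> \<noteq> 0" and b: "ann.spanned d b"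
    and base: "\<And>j. j < degree \<alpha> \<Longrightarrow> e_gen j * b \<in> span_mod_ann B"
  shows "e_gen j * b \<in> span_mod_ann B"
proof (induction j rule: less_induct)
  case (less j)
  show ?case
  proof (cases "j < degree \<alpha>")
    case False
    define m where "m = j - degree \<alpha>"
    have j: "j = m + degree \<alpha>" using False by (simp add: m_def)
    let ?l = "lead_coeff \<alpha>"
    have l: "?l \<noteq> 0" using \<alpha>(2) by simp
    have split: "{..degree \<alpha>} = insert (degree \<alpha>) {..<degree \<alpha>}" by auto
    let ?r = "\<Sum>i<degree \<alpha>. free_scalar (- coeff \<alpha> i / ?l) * (e_gen (m + i) * b)"
    have "e_gen j * b - ?r \<in> vac_ann"
    proof -
      have "coef (app (rho (e_gen j * b - ?r)) vac) w = 0" for w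
      proof -
        let ?s = "\<lambda>j. coef (app (E_op j) (app (rho b) vac)) w"
        have "rec_op \<alpha> ?s m = 0" using \<alpha>(1) b by (auto simp: e_rec_def)
        then have "?l * ?s j + (\<Sum>i<degree \<alpha>. coeff \<alpha> i * ?s (m + i)) = 0"
          by (simp add: rec_op_def split j)
        then have "?s j = - (\<Sum>i<degree \<alpha>. coeff \<alpha> i * ?s (m + i)) / ?l"
          using l by (simp add: field_simps eq_neg_iff_add_eq_0)
        then show ?thesis
          by (simp add: rho_diff rho_sum rho_mult app_sum_left coef_sum sum_divide_distrib sum_negf)
      qed
      then show ?thesis by (auto simp: vac_ann_def intro: wordfun_eqI)
    qed
    moreover have "?r \<in> span_mod_ann B"
      by (intro span_mod_ann_sum span_mod_ann_scale less.IH) (simp add: j)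
    ultimately show ?thesis by (rule span_mod_ann_cong)
  qed (rule base)
qed

lemma finite_dim_level:
  assumes "q \<noteq> 0" "\<And>m. rec_op q p m = 0"
  shows "\<exists>B. finite B \<and> (\<forall>b\<in>B. homog (- int n) b) \<and> {a. ann.spanned (- int n) a} \<subseteq> span_mod_ann B"
proof (induction n)
  case 0
  have "a \<in> span_mod_ann {1}" if sp: "ann.spanned 0 a" for a
  proof -
    obtain c where c: "a - free_scalar c \<in> vac_ann" using ann.spanned_nonneg[OF sp] by blast
    have "free_scalar c * 1 \<in> span_mod_ann {1}" by (intro span_mod_ann_scale span_mod_ann_base) auto
    then show ?thesis using span_mod_ann_cong[OF c] by simp
  qed
  moreover have "homog 0 1" using homog_scalar[of 1] by simp
  ultimately show ?case by (intro exI[of _ "{1}"]) auto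
next
  case (Suc n)
  then obtain B where B: "finite B" "\<And>b. b \<in> B \<Longrightarrow> homog (- int n) b"
    and span: "\<And>a. ann.spanned (- int n) a \<Longrightarrow> a \<in> span_mod_ann B" by blast
  obtain \<alpha> where \<alpha>: "\<alpha> \<noteq> 0" "e_rec (- int n) \<alpha>" using recurrences_exist[OF assms] by blast
  define B' where "B' = (\<lambda>(j, b). e_gen j * b) ` ({..<degree \<alpha>} \<times> B)"
  have fin: "finite B'" using B(1) by (simp add: B'_def)
  have eb: "e_gen j * b \<in> span_mod_ann B'" if "b \<in> B" for j b
    by (rule e_reduction[OF \<alpha>(2,1) ann.spanned_homog[OF B(2)[OF that]]])
       (rule span_mod_ann_base[OF fin], use that in \<open>auto simp: B'_def\<close>)
  have ea: "e_gen j * a \<in> span_mod_ann B'" if sp: "ann.spanned (- int n) a" for j a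
  proof -
    obtain c where c: "a - (\<Sum>b\<in>B. free_scalar (c b) * b) \<in> vac_ann"
      using span[OF sp] by (auto simp: span_mod_ann_def)
    have "e_gen j * a - (\<Sum>b\<in>B. free_scalar (c b) * (e_gen j * b)) = e_gen j * (a - (\<Sum>b\<in>B. free_scalar (c b) * b))"
      by (simp add: right_diff_distrib sum_distrib_left free_scalar_left_commute[of "e_gen j"])
    then have "e_gen j * a - (\<Sum>b\<in>B. free_scalar (c b) * (e_gen j * b)) \<in> vac_ann"
      using ann.Z_mult[OF c] by simp
    then show ?thesis by (rule span_mod_ann_cong) (intro span_mod_ann_sum span_mod_ann_scale eb)
  qed
  have "a \<in> span_mod_ann B'" if "ann.spanned d a" "d = - int (Suc n)" for d a
    using that
  proof (induction rule: ann.spanned.induct)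
    case (e d a d' j)
    then show ?case by (intro ea) simp
  qed (auto intro: span_mod_ann_zero span_mod_ann_add)
  moreover have "homog (- int (Suc n)) b" if "b \<in> B'" for b
    using that homog_mult[OF homog_e B(2)] by (auto simp: B'_def)
  ultimately show ?case using fin by (intro exI[of _ B']) auto
qed

theorem category_O_iff_recurrent:
  "category_O h1 h2 h3 Vp Vgr \<longleftrightarrow> (\<exists>q. q \<noteq> 0 \<and> (\<forall>m. rec_op q p m = 0))"
proof
  assume "category_O h1 h2 h3 Vp Vgr"
  then obtain B where B: "finite B" and span: "{a. homog (- 1) a} \<subseteq> span_mod_ann B"
    unfolding category_O_iff by blast
  have "\<forall>j. \<exists>c. e_gen j - (\<Sum>b\<in>B. free_scalar (c b) * b) \<in> vac_ann"
  proof
    fix j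
    have "e_gen j \<in> span_mod_ann B" using span homog_e[of j] by blast
    then show "\<exists>c. e_gen j - (\<Sum>b\<in>B. free_scalar (c b) * b) \<in> vac_ann" by (simp add: span_mod_ann_def)
  qed
  then obtain c where c: "\<And>j. e_gen j - (\<Sum>b\<in>B. free_scalar (c j b) * b) \<in> vac_ann" by metis
  \<comment> \<open>At the one-letter word \<open>m\<close>, \<open>e\<^sub>j v\<close> has the coefficient of \<open>v\<close> in \<open>f\<^sub>m e\<^sub>j v\<close>, that is \<open>- p\<^sub>m\<^sub>+\<^sub>j\<close>.\<close>
  have pc: "p (m + j) = - (\<Sum>b\<in>B. c j b * coef (app (rho b) vac) [m])" for j m
  proof -
    have "coef (app (rho (e_gen j - (\<Sum>b\<in>B. free_scalar (c j b) * b))) vac) [m] = 0"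
      using c[of j] by (simp add: vac_ann_def)
    then have "coef (app (E_op j) vac) [m] = (\<Sum>b\<in>B. c j b * coef (app (rho b) vac) [m])"
      by (simp add: rho_diff rho_sum rho_mult app_sum_left coef_sum)
    moreover have "coef (app (E_op j) vac) [m] = - p (m + j)"
      by (simp add: coef_E psi_at.simps coef_vac add.commute)
    ultimately show ?thesis by (simp add: equation_minus_iff[of "p (m + j)"])
  qed
  obtain a where a: "\<exists>j\<in>{..card B}. a j \<noteq> 0" "\<And>b. b \<in> B \<Longrightarrow> (\<Sum>j\<le>card B. a j * c j b) = 0"
    using linear_dependence[OF B, of "{..card B}" c] by auto
  define q where "q = (\<Sum>j\<le>card B. monom (a j) j)"
  have coeff_q: "coeff q j = a j" if "j \<le> card B" for j
    using that by (simp add: q_def coeff_sum)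
  obtain j where "j \<le> card B" "a j \<noteq> 0" using a(1) by auto
  then have "q \<noteq> 0" using coeff_q[of j] by auto
  moreover have "rec_op q p m = 0" for m
  proof -
    have "rec_op q p m = - (\<Sum>j\<le>card B. \<Sum>b\<in>B. a j * c j b * coef (app (rho b) vac) [m])"
      by (simp add: q_def rec_op_sum rec_op_monom pc sum_distrib_left mult.assoc sum_negf)
    also have "\<dots> = - (\<Sum>b\<in>B. (\<Sum>j\<le>card B. a j * c j b) * coef (app (rho b) vac) [m])"
      by (subst sum.swap) (simp add: sum_distrib_right)
    also have "\<dots> = 0" using a(2) by simp
    finally show ?thesis .
  qed
  ultimately show "\<exists>q. q \<noteq> 0 \<and> (\<forall>m. rec_op q p m = 0)" by blast
next
  assume "\<exists>q. q \<noteq> 0 \<and> (\<forall>m. rec_op q p m = 0)"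
  then obtain q where q: "q \<noteq> 0" "\<And>m. rec_op q p m = 0" by blast
  show "category_O h1 h2 h3 Vp Vgr"
    unfolding category_O_iff
  proof
    fix k :: int
    show "\<exists>B. finite B \<and> (\<forall>b\<in>B. homog k b) \<and> {a. homog k a} \<subseteq> span_mod_ann B"
    proof (cases "k > 0")
      case True
      then show ?thesis
        by (intro exI[of _ "{}"]) (auto intro: span_mod_ann_zero homog_positive_ann)
    next
      case False
      then have "k = - int (nat (- k))" by simp
      then show ?thesis
        using finite_dim_level[OF q, of "nat (- k)"] ann.spanned_homog[of k] by (metis (no_types, lifting) mem_Collect_eq subsetD subsetI)
    qed
  qed
qed

end

theorem proposition4p11:
  fixes h1 h2 h3 :: complex and p :: "nat \<Rightarrow> complex"
  assumes "h1 + h2 + h3 = 0"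
  shows "category_O h1 h2 h3 (irred_hw_module h1 h2 h3 p) (irred_hw_grading h1 h2 h3 p) \<longleftrightarrow>
    (\<exists>P :: complex poly fract. weight_series p = ratfun_expansion P \<and> ratfun_at_infinity P 1)"
  unfolding rational_iff_recurrent by (rule yangian_model.category_O_iff_recurrent)

end
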